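(* Let $n\geqslant 1$ and let $b_1,b_2\in \mathcal{C}([0,\infty))\cap L^1([0,\infty))$ be nonnegative functions. Let $p,q>1$ satisfy $$\max\left\{\frac{p+2+q^{-1}}{pq-1},\frac{q+2+p^{-1}}{pq-1}\right\}>\frac{n-1}{2}.$$ Let $R>0$ and assume that $u_0,v_0\in H^1(\mathbb{R}^n)$ and $u_1,v_1\in L^2(\mathbb{R}^n)$ are nonnegative, pairwise nontrivial and compactly supported in $B_R=\{x\in\mathbb{R}^n:|x|\leqslant R\}$. For $\varepsilon>0$ let $(u,v)$ be an energy solution, with lifespan $T=T(\varepsilon)$, of the Cauchy problem $$\begin{cases} u_{tt}-\Delta u+b_1(t)u_t=|v|^p, & x\in\mathbb{R}^n,\ t>0,\\ v_{tt}-\Delta v+b_2(t)v_t=|u|^q, & x\in\mathbb{R}^n,\ t>0,\\ (u,u_t,v,v_t)(0,x)=(\varepsilon u_0,\varepsilon u_1,\varepsilon v_0,\varepsilon v_1)(x), & x\in\mathbb{R}^n,\end{cases}$$ such that $$\operatorname{supp} u,\ \operatorname{supp} v\subset\{(t,x)\in[0,T)\times\mathbb{R}^n:|x|\leqslant t+R\}.$$ Then there exists a positive constant $\varepsilon_0=\varepsilon_0(u_0,u_1,v_0,v_1,n,p,q,b_1,b_2,R)$ such that for any $\varepsilon\in(0,\varepsilon_0]$ the solution $(u,v)$ blows up in finite time. Moreover, the upper bound estimate for the lifespan $$T(\varepsilon)\leqslant C\,\varepsilon^{-\max\{F(n,p,q),F(n,q,p)\}^{-1}}$$ holds, where $C$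 is a positive constant independent of $\varepsilon$ and $$F(n,p,q)\doteq\frac{p+2+q^{-1}}{pq-1}-\frac{n-1}{2}.$$
   Context: Pairwise nontrivial data: $(u_0,u_1)\not\equiv(0,0)$ and $(v_0,v_1)\not\equiv(0,0)$, i.e. at least one of $u_0,u_1$ and at least one of $v_0,v_1$ is not identically zero. Energy solution: $(u,v)$ is an energy solution of the Cauchy problem on $[0,T)$ if $u\in\mathcal{C}([0,T),H^1(\mathbb{R}^n))\cap\mathcal{C}^1([0,T),L^2(\mathbb{R}^n))\cap L^q_{\mathrm{loc}}([0,T)\times\mathbb{R}^n)$ and $v\in\mathcal{C}([0,T),H^1(\mathbb{R}^n))\cap\mathcal{C}^1([0,T),L^2(\mathbb{R}^n))\cap L^p_{\mathrm{loc}}([0,T)\times\mathbb{R}^n)$ satisfy $u(0,x)=\varepsilon u_0(x)$, $v(0,x)=\varepsilon v_0(x)$ in $H^1(\mathbb{R}^n)$ and $$\int_{\mathbb{R}^n}\partial_tu(t,x)\phi(t,x)\,dx-\int_{\mathbb{R}^n}\varepsilon u_1(x)\phi(0,x)\,dx-\int_0^t\!\int_{\mathbb{R}^n}\partial_tu(s,x)\phi_s(s,x)\,dx\,ds+\int_0^t\!\int_{\mathbb{R}^n}\nabla u(s,x)\cdot\nabla\phi(s,x)\,dx\,ds+\int_0^t\!\int_{\mathbb{R}^n}b_1(s)\partial_tu(s,x)\phi(s,x)\,dx\,ds=\int_0^t\!\int_{\mathbb{R}^n}|v(s,x)|^p\phi(s,x)\,dx\,ds,$$ $$\int_{\mathbb{R}^n}\partial_tv(t,x)\psi(t,x)\,dx-\int_{\mathbb{R}^n}\varepsilon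 v_1(x)\psi(0,x)\,dx-\int_0^t\!\int_{\mathbb{R}^n}\partial_tv(s,x)\psi_s(s,x)\,dx\,ds+\int_0^t\!\int_{\mathbb{R}^n}\nabla v(s,x)\cdot\nabla\psi(s,x)\,dx\,ds+\int_0^t\!\int_{\mathbb{R}^n}b_2(s)\partial_tv(s,x)\psi(s,x)\,dx\,ds=\int_0^t\!\int_{\mathbb{R}^n}|u(s,x)|^q\psi(s,x)\,dx\,ds$$ for any $\phi,\psi\in\mathcal{C}_0^\infty([0,T)\times\mathbb{R}^n)$ and any $t\in[0,T)$. An energy solution with lifespan $T=T(\varepsilon)$ is an energy solution on $[0,T)$; "blows up in finite time" means $T(\varepsilon)<\infty$, so that the quantitative content is the stated bound on $T(\varepsilon)$. $F(n,q,p)$ is obtained from $F(n,p,q)$ by exchanging $p$ and $q$. *)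

theory Defs
  imports "HOL-Analysis.Analysis"
begin

text \<open>
  Elements of Lebesgue and Sobolev spaces are represented by functions; equality and sign
  conditions on them are understood almost everywhere with respect to \<^term>\<open>lebesgue\<close>.
\<close>

subsection \<open>Test functions\<close>

primrec times_cont_diff :: "nat \<Rightarrow> ('a::euclidean_space \<Rightarrow> real) \<Rightarrow> bool" where
  "times_cont_diff 0 f \<longleftrightarrow> continuous_on UNIV f"
| "times_cont_diff (Suc k) f \<longleftrightarrow>
     (\<forall>x. f differentiable (at x)) \<and>
     (\<forall>b\<in>Basis. times_cont_diff k (\<lambda>x. frechet_derivative f (at x) b))"

definition smooth :: "('a::euclidean_space \<Rightarrow> real) \<Rightarrow> bool" where
  "smooth f \<longleftrightarrow> (\<forall>k. times_cont_diff k f)"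

definition test_functions :: "'a::euclidean_space set \<Rightarrow> ('a \<Rightarrow> real) set" where
  "test_functions U =
     {\<phi>. smooth \<phi> \<and> compact (closure {x. \<phi> x \<noteq> 0}) \<and> closure {x. \<phi> x \<noteq> 0} \<subseteq> U}"

definition gradient :: "('a::euclidean_space \<Rightarrow> real) \<Rightarrow> 'a \<Rightarrow> 'a" where
  "gradient f x = (\<Sum>b\<in>Basis. frechet_derivative f (at x) b *\<^sub>R b)"

subsection \<open>The spaces $L^2$ and $H^1$\<close>

definition L2 :: "('a::euclidean_space \<Rightarrow> 'b::euclidean_space) set" where
  "L2 = {f. f \<in> borel_measurable lebesgue \<and> integrable lebesgue (\<lambda>x. (norm (f x))\<^sup>2)}"

definition L2_norm :: "('a::euclidean_space \<Rightarrow> 'b::euclidean_space) \<Rightarrow> real" where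
  "L2_norm f = sqrt (LINT x|lebesgue. (norm (f x))\<^sup>2)"

definition is_weak_gradient :: "('a::euclidean_space \<Rightarrow> real) \<Rightarrow> ('a \<Rightarrow> 'a) \<Rightarrow> bool" where
  "is_weak_gradient f g \<longleftrightarrow>
     (\<forall>\<phi>\<in>test_functions UNIV.
        (LINT x|lebesgue. f x *\<^sub>R gradient \<phi> x) = - (LINT x|lebesgue. \<phi> x *\<^sub>R g x))"

definition H1 :: "('a::euclidean_space \<Rightarrow> real) set" where
  "H1 = {f. f \<in> L2 \<and> (\<exists>g\<in>L2. is_weak_gradient f g)}"

text \<open>A representative; the weak gradient is unique up to null sets.\<close>
definition weak_gradient :: "('a::euclidean_space \<Rightarrow> real) \<Rightarrow> 'a \<Rightarrow> 'a" where
  "weak_gradient f = (SOME g. g \<in> L2 \<and> is_weak_gradient f g)"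

definition H1_norm :: "('a::euclidean_space \<Rightarrow> real) \<Rightarrow> real" where
  "H1_norm f = sqrt ((L2_norm f)\<^sup>2 + (L2_norm (weak_gradient f))\<^sup>2)"

subsection \<open>Functions of time with values in $L^2$ and $H^1$\<close>

definition C_L2 :: "real set \<Rightarrow> (real \<Rightarrow> 'a::euclidean_space \<Rightarrow> real) set" where
  "C_L2 I = {w. \<forall>t\<in>I. w t \<in> L2 \<and>
     ((\<lambda>s. L2_norm (\<lambda>x. w s x - w t x)) \<longlongrightarrow> 0) (at t within I)}"

definition C_H1 :: "real set \<Rightarrow> (real \<Rightarrow> 'a::euclidean_space \<Rightarrow> real) set" where
  "C_H1 I = {w. \<forall>t\<in>I. w t \<in> H1 \<and>
     ((\<lambda>s. H1_norm (\<lambda>x. w s x - w t x)) \<longlongrightarrow> 0) (at t within I)}"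

definition is_L2_time_deriv ::
  "real set \<Rightarrow> (real \<Rightarrow> 'a::euclidean_space \<Rightarrow> real) \<Rightarrow> real \<Rightarrow> ('a \<Rightarrow> real) \<Rightarrow> bool" where
  "is_L2_time_deriv I w t d \<longleftrightarrow>
     ((\<lambda>s. L2_norm (\<lambda>x. (w s x - w t x) / (s - t) - d x)) \<longlongrightarrow> 0) (at t within I)"

text \<open>A representative; the derivative in $L^2$ is unique up to null sets.\<close>
definition time_deriv ::
  "real set \<Rightarrow> (real \<Rightarrow> 'a::euclidean_space \<Rightarrow> real) \<Rightarrow> real \<Rightarrow> 'a \<Rightarrow> real" where
  "time_deriv I w t = (SOME d. d \<in> L2 \<and> is_L2_time_deriv I w t d)"

definition C1_L2 :: "real set \<Rightarrow> (real \<Rightarrow> 'a::euclidean_space \<Rightarrow> real) set" where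
  "C1_L2 I = {w. (\<forall>t\<in>I. w t \<in> L2 \<and> (\<exists>d\<in>L2. is_L2_time_deriv I w t d)) \<and>
     time_deriv I w \<in> C_L2 I}"

definition Lloc :: "real \<Rightarrow> 'a::euclidean_space set \<Rightarrow> ('a \<Rightarrow> real) set" where
  "Lloc r S = {f. f \<in> borel_measurable (lebesgue_on S) \<and>
     (\<forall>K. compact K \<and> K \<subseteq> S \<longrightarrow> set_integrable lebesgue K (\<lambda>z. \<bar>f z\<bar> powr r))}"

text \<open>Support, relative to \<open>S\<close>, of an almost everywhere equivalence class.\<close>
definition ess_support :: "'a::euclidean_space set \<Rightarrow> ('a \<Rightarrow> real) \<Rightarrow> 'a set" where
  "ess_support S f =
     {z\<in>S. \<forall>U. open U \<and> z \<in> U \<longrightarrow> \<not> (AE w in lebesgue. w \<in> S \<inter> U \<longrightarrow> f w = 0)}"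

subsection \<open>Energy solutions\<close>

definition lifespan_interval :: "ereal \<Rightarrow> real set" where
  "lifespan_interval T = {t. 0 \<le> t \<and> ereal t < T}"

text \<open>
  \<open>weak_damped_wave T b w1 w G\<close> is the weak form on $[0,T)$ of
  $w_{tt} - \Delta w + b(t) w_t = G$, $w_t(0,\cdot) = w_1$. A function in
  $C_0^\infty([0,T)\times\mathbb{R}^n)$ is smooth up to $t = 0$ and need not vanish there; such
  functions are the restrictions to $t \ge 0$ of smooth functions on space-time with compact
  support in $(-\infty,T)\times\mathbb{R}^n$, which is the form used here.
\<close>
definition weak_damped_wave ::
  "ereal \<Rightarrow> (real \<Rightarrow> real) \<Rightarrow> (real^'n \<Rightarrow> real) \<Rightarrow> (real \<Rightarrow> real^'n \<Rightarrow> real)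
     \<Rightarrow> (real \<Rightarrow> real^'n \<Rightarrow> real) \<Rightarrow> bool" where
  "weak_damped_wave T b w1 w G \<longleftrightarrow>
     (let w_t = time_deriv (lifespan_interval T) w in
      \<forall>\<phi>\<in>test_functions ({s. ereal s < T} \<times> UNIV). \<forall>t\<in>lifespan_interval T.
        (LINT x|lebesgue. w_t t x * \<phi> (t, x))
        - (LINT x|lebesgue. w1 x * \<phi> (0, x))
        - (LINT s:{0..t}|lebesgue. LINT x|lebesgue. w_t s x * deriv (\<lambda>r. \<phi> (r, x)) s)
        + (LINT s:{0..t}|lebesgue. LINT x|lebesgue.
             weak_gradient (w s) x \<bullet> gradient (\<lambda>y. \<phi> (s, y)) x)
        + (LINT s:{0..t}|lebesgue. LINT x|lebesgue. b s * w_t s x * \<phi> (s, x))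
        = (LINT s:{0..t}|lebesgue. LINT x|lebesgue. G s x * \<phi> (s, x)))"

definition energy_solution ::
  "(real \<Rightarrow> real) \<Rightarrow> (real \<Rightarrow> real) \<Rightarrow> real \<Rightarrow> real
     \<Rightarrow> (real^'n \<Rightarrow> real) \<Rightarrow> (real^'n \<Rightarrow> real) \<Rightarrow> (real^'n \<Rightarrow> real) \<Rightarrow> (real^'n \<Rightarrow> real)
     \<Rightarrow> real \<Rightarrow> ereal \<Rightarrow> (real \<Rightarrow> real^'n \<Rightarrow> real) \<Rightarrow> (real \<Rightarrow> real^'n \<Rightarrow> real) \<Rightarrow> bool" where
  "energy_solution b1 b2 p q u0 u1 v0 v1 \<epsilon> T u v \<longleftrightarrow>
     0 < T \<and>
     u \<in> C_H1 (lifespan_interval T) \<and> u \<in> C1_L2 (lifespan_interval T) \<and>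
     (\<lambda>(t, x). u t x) \<in> Lloc q (lifespan_interval T \<times> UNIV) \<and>
     v \<in> C_H1 (lifespan_interval T) \<and> v \<in> C1_L2 (lifespan_interval T) \<and>
     (\<lambda>(t, x). v t x) \<in> Lloc p (lifespan_interval T \<times> UNIV) \<and>
     (AE x in lebesgue. u 0 x = \<epsilon> * u0 x) \<and>
     (AE x in lebesgue. v 0 x = \<epsilon> * v0 x) \<and>
     weak_damped_wave T b1 (\<lambda>x. \<epsilon> * u1 x) u (\<lambda>s x. \<bar>v s x\<bar> powr p) \<and>
     weak_damped_wave T b2 (\<lambda>x. \<epsilon> * v1 x) v (\<lambda>s x. \<bar>u s x\<bar> powr q)"

definition lifespan_F :: "nat \<Rightarrow> real \<Rightarrow> real \<Rightarrow> real" where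
  "lifespan_F n p q = (p + 2 + inverse q) / (p * q - 1) - (real n - 1) / 2"

end

theory Submission
  imports Defs "HOL-Real_Asymp.Real_Asymp"
begin

text \<open>
  Fix $L < T$. Test the equations against time-independent $\theta(|x|^2)$, cut off outside the
  support cone. With $\theta = 1$ the mass $U = \int u$ satisfies $U'' + b_1 U' = \int |v|^p$, where
  $\int |v|^p \ge c (1+t)^{-n(p-1)} V^p$ by Hoelder, and likewise for $V = \int v$.
  With $\theta(|x|^2)$ the radial solution of $\Delta\Phi = \Phi$, of size
  $(1+|x|)^{-(n-1)/2} e^{|x|}$, the moment $W = \int u \Phi$ satisfies $W'' + b_1 W' - W \ge 0$. As
  $b_1$ is integrable, this forces $W \ge c \varepsilon e^t$, and Hoelder gives
  $\int |u|^q \ge c \varepsilon^q (1+t)^{(n-1)(1-q/2)}$. These bounds make $U$ and $V$ large at time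
  $L/2$. Iterating the two integral inequalities over the dyadic times $L(1 - 2^{-k-1})$ makes
  $U$ unbounded on $[0,L]$ unless $\varepsilon L^F$ is bounded.
\<close>

text \<open>The solution is weak, so a moment is differentiable only once and its equation is known
  only in integrated form, with an accumulated source that is merely monotone. The differential
  inequalities are therefore all obtained from integral identities through integrating factors.
  Damping costs a factor exp of its integral, bounded through the total mass of the coefficient. The
  cutoffs depend on \<open>L\<close>, yet no constant may: the data enter through their integrals
  over the ball of radius \<open>R\<close>, where every weight used is at least 1.

  The exponent is a count of powers of L. A round from U to V and back to U gains L^(2+2p) from the
  time steps and loses L^(n(p-1)+n(q-1)p) to Hoelder; the starting value at L/2 is at least of order
  \<epsilon>^p L^(n+1-(n-1)p/2). The iteration stays bounded only if the round factor times the
  starting value to the power pq-1 is bounded, and this product is a multiple of (\<epsilon>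
  L^F)^(p(pq-1)) with F = F(n,q,p). The other exponent comes from exchanging the two equations,
  hence the maximum.\<close>

section \<open>Closure properties of smooth functions\<close>

lemma times_cont_diff_SucD: "times_cont_diff (Suc k) f \<Longrightarrow> times_cont_diff k f"
proof (induction k arbitrary: f)
  case 0
  then show ?case
    by (auto simp: continuous_on_eq_continuous_at differentiable_imp_continuous_within)
next
  case (Suc k)
  then show ?case by (metis times_cont_diff.simps(2))
qed

lemma smooth_imp_differentiable: "smooth f \<Longrightarrow> f differentiable (at x)"
  by (metis smooth_def times_cont_diff.simps(2))

lemma smooth_imp_continuous_on: "smooth f \<Longrightarrow> continuous_on A f"
  by (meson continuous_on_subset smooth_def subset_UNIV times_cont_diff.simps(1))

lemma smooth_frechet_derivative:
  "smooth f \<Longrightarrow> b \<in> Basis \<Longrightarrow> smooth (\<lambda>x. frechet_derivative f (at x) b)"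
  by (metis smooth_def times_cont_diff.simps(2))

lemma times_cont_diff_const: "times_cont_diff k (\<lambda>x::'a::euclidean_space. c)"
  by (induction k arbitrary: c) auto

lemma smooth_const: "smooth (\<lambda>x::'a::euclidean_space. c)"
  by (simp add: smooth_def times_cont_diff_const)

lemma smooth_linear:
  assumes "bounded_linear (f :: 'a::euclidean_space \<Rightarrow> real)"
  shows "smooth f"
proof -
  have d: "frechet_derivative f (at x) = f" for x
    by (metis assms bounded_linear_imp_has_derivative frechet_derivative_at)
  have "times_cont_diff k f" for k
    using assms by (cases k) (auto simp: d times_cont_diff_const bounded_linear_imp_differentiable
        linear_continuous_on)
  then show ?thesis by (simp add: smooth_def)
qed

lemma times_cont_diff_add:
  "times_cont_diff k f \<Longrightarrow> times_cont_diff k g \<Longrightarrow> times_cont_diff k (\<lambda>x. f x + g x)"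
proof (induction k arbitrary: f g)
  case 0
  then show ?case by (auto intro: continuous_intros)
next
  case (Suc k)
  have "((\<lambda>x. f x + g x) has_derivative
     (\<lambda>h. frechet_derivative f (at x) h + frechet_derivative g (at x) h)) (at x)" for x
    by (rule has_derivative_add) (use Suc.prems in \<open>auto simp: frechet_derivative_works\<close>)
  then have "frechet_derivative (\<lambda>x. f x + g x) (at x) b =
      frechet_derivative f (at x) b + frechet_derivative g (at x) b" for x b
    by (metis (no_types, lifting) frechet_derivative_at)
  with Suc show ?case by auto
qed

text \<open>The product rule pairs an undifferentiated factor with a derivative of the other one, so
  the induction at order \<open>k\<close> also needs the factors themselves, lowered from
  \<open>Suc k\<close> to \<open>k\<close> by \<open>times_cont_diff_SucD\<close>.\<close>

lemma times_cont_diff_mult: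
  "times_cont_diff k f \<Longrightarrow> times_cont_diff k g \<Longrightarrow> times_cont_diff k (\<lambda>x. f x * g x)"
proof (induction k arbitrary: f g)
  case 0
  then show ?case by (auto intro: continuous_intros)
next
  case (Suc k)
  have "((\<lambda>x. f x * g x) has_derivative
     (\<lambda>h. f x * frechet_derivative g (at x) h + frechet_derivative f (at x) h * g x)) (at x)" for x
    by (rule has_derivative_mult) (use Suc.prems in \<open>auto simp: frechet_derivative_works\<close>)
  then have *: "frechet_derivative (\<lambda>x. f x * g x) (at x) b =
      f x * frechet_derivative g (at x) b + frechet_derivative f (at x) b * g x" for x b
    by (metis (no_types, lifting) frechet_derivative_at)
  show ?case
    using Suc times_cont_diff_SucD[OF Suc.prems(1)] times_cont_diff_SucD[OF Suc.prems(2)]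
    by (auto simp: * intro!: times_cont_diff_add)
qed

lemma smooth_add: "smooth f \<Longrightarrow> smooth g \<Longrightarrow> smooth (\<lambda>x. f x + g x)"
  by (simp add: smooth_def times_cont_diff_add)

lemma smooth_mult: "smooth f \<Longrightarrow> smooth g \<Longrightarrow> smooth (\<lambda>x. f x * g x)"
  by (simp add: smooth_def times_cont_diff_mult)

lemma smooth_sum: "(\<And>i. i \<in> I \<Longrightarrow> smooth (f i)) \<Longrightarrow> smooth (\<lambda>x. \<Sum>i\<in>I. f i x)"
  by (induction I rule: infinite_finite_induct) (auto simp: smooth_const intro: smooth_add)

lemma frechet_derivative_real:
  "(f has_real_derivative D) (at x) \<Longrightarrow> frechet_derivative f (at x) h = D * h"
  by (metis frechet_derivative_at has_field_derivative_def)

lemma continuous_on_if_DERIV: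
  "(\<And>x. (f has_real_derivative f' x) (at x)) \<Longrightarrow> continuous_on A f"
  by (meson DERIV_isCont continuous_at_imp_continuous_on)

text \<open>Integration gains an order of differentiability; this makes the antiderivative behind
  the smooth step smooth.\<close>

lemma smooth_realI:
  assumes "\<And>x. (f has_real_derivative f' x) (at x)" "smooth f'"
  shows "smooth f"
proof -
  have "times_cont_diff k f" for k
  proof (cases k)
    case 0
    then show ?thesis
      using continuous_on_if_DERIV[OF assms(1)] by simp
  next
    case (Suc n)
    then show ?thesis
      using assms(2) frechet_derivative_real[OF assms(1)] differentiableI[OF has_field_derivative_imp_has_derivative[OF assms(1)]]
      by (simp add: smooth_def)
  qed
  then show ?thesis by (simp add: smooth_def)
qed

lemma smooth_real_has_derivative:
  assumes "smooth (f :: real \<Rightarrow> real)"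
  shows "(f has_real_derivative deriv f x) (at x)"
  using smooth_imp_differentiable[OF assms, of x]
  by (metis DERIV_imp_deriv real_differentiable_def)

lemma smooth_deriv:
  assumes "smooth (f :: real \<Rightarrow> real)"
  shows "smooth (deriv f)"
proof -
  have "(\<lambda>x. frechet_derivative f (at x) 1) = deriv f"
    using frechet_derivative_real[OF smooth_real_has_derivative[OF assms]] by auto
  then show ?thesis
    using smooth_frechet_derivative[OF assms, of 1] by simp
qed

lemma smooth_compose_has_derivative:
  assumes g: "smooth (g :: real \<Rightarrow> real)" and f: "f differentiable (at x)"
  shows "((\<lambda>x. g (f x)) has_derivative (\<lambda>h. deriv g (f x) * frechet_derivative f (at x) h)) (at x)"
proof -
  have "(g has_derivative (\<lambda>h. deriv g (f x) * h)) (at (f x))"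
    using smooth_real_has_derivative[OF g] by (simp add: has_field_derivative_def)
  with f show ?thesis
    unfolding frechet_derivative_works by (rule has_derivative_compose)
qed

lemma frechet_derivative_smooth_compose:
  assumes "smooth (g :: real \<Rightarrow> real)" and "f differentiable (at x)"
  shows "frechet_derivative (\<lambda>x. g (f x)) (at x) b = deriv g (f x) * frechet_derivative f (at x) b"
  using frechet_derivative_at[OF smooth_compose_has_derivative[OF assms]] by metis

text \<open>The partials of the composition are products of partials of \<open>f\<close> with a
  composition of the same kind whose outer function is \<open>deriv g\<close>; hence the induction
  on the order has to vary \<open>g\<close>.\<close>

lemma smooth_compose:
  assumes "smooth (g :: real \<Rightarrow> real)" "smooth f"
  shows "smooth (\<lambda>x. g (f x))"
proof -
  have "times_cont_diff k (\<lambda>x. g (f x))" for k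
    using assms
  proof (induction k arbitrary: g)
    case 0
    then show ?case
      by (auto intro: continuous_on_compose2[OF smooth_imp_continuous_on smooth_imp_continuous_on])
  next
    case (Suc k)
    have "times_cont_diff k (\<lambda>x. frechet_derivative f (at x) b)" if "b \<in> Basis" for b
      using smooth_frechet_derivative[OF Suc.prems(2) that] by (simp add: smooth_def)
    moreover have "(\<lambda>x. g (f x)) differentiable (at x)" for x
      using smooth_compose_has_derivative[OF Suc.prems(1) smooth_imp_differentiable[OF Suc.prems(2)]]
      by (rule differentiableI)
    ultimately show ?case
      using Suc smooth_imp_differentiable[OF Suc.prems(2)]
      by (auto simp: frechet_derivative_smooth_compose smooth_deriv intro!: times_cont_diff_mult)
  qed
  then show ?thesis by (simp add: smooth_def)
qed

text \<open>Differentiation acts as a shift on the whole sequence, so all members are treated at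
  once; meant for the successive derivatives of a power series.\<close>

lemma smooth_real_sequence:
  assumes "\<And>k x. (D k has_real_derivative D (Suc k) x) (at x)"
  shows "smooth (D 0 :: real \<Rightarrow> real)"
proof -
  have "times_cont_diff n (D k)" for n k
  proof (induction n arbitrary: k)
    case 0
    then show ?case
      using continuous_on_if_DERIV[OF assms] by simp
  next
    case (Suc n)
    then show ?case
      using frechet_derivative_real[OF assms] differentiableI[OF has_field_derivative_imp_has_derivative[OF assms]] by simp
  qed
  then show ?thesis by (simp add: smooth_def)
qed

subsection \<open>Cutoff functions\<close>

text \<open>The powers of 1/x make the span of the family closed under differentiation: a derivative
  raises \<open>k\<close> by one or two. \<open>flat 0\<close> is the classical smooth function that
  vanishes on the left half-line without being zero.\<close>

definition flat :: "nat \<Rightarrow> real \<Rightarrow> real" where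
  "flat k x = (if 0 < x then (inverse x) ^ k * exp (- inverse x) else 0)"

lemma flat_tendsto_0: "(flat k \<longlongrightarrow> 0) (at_right 0)"
proof -
  have "((\<lambda>x::real. (inverse x) ^ k / exp (inverse x)) \<longlongrightarrow> 0) (at_right 0)"
    using filterlim_compose[OF tendsto_power_div_exp_0 filterlim_inverse_at_top_right] .
  moreover have "\<forall>\<^sub>F x in at_right 0. (inverse x) ^ k / exp (inverse x) = flat k x"
    by (auto simp: eventually_at_right_field flat_def exp_minus field_simps intro: exI[of _ 1])
  ultimately show ?thesis
    by (rule Lim_transform_eventually)
qed

lemma flat_has_derivative:
  "(flat k has_real_derivative (flat (k + 2) x - real k * flat (k + 1) x)) (at x)"
proof -
  consider "x < 0" | "x = 0" | "x > 0" by linarith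
  then show ?thesis
  proof cases
    case 1
    have "((\<lambda>_. 0) has_real_derivative 0) (at x)" by simp
    then have "(flat k has_real_derivative 0) (at x)"
      by (rule has_field_derivative_transform_within[where S=UNIV and d="-x"]) (use 1 in \<open>auto simp: flat_def dist_real_def\<close>)
    with 1 show ?thesis by (simp add: flat_def)
  next
    \<comment> \<open>At the junction the left difference quotient is 0 and the right one is
      \<open>flat (k + 1)\<close> itself, which tends to 0.\<close>
    case 2
    have l: "((\<lambda>y. (flat k y - flat k 0) / (y - 0)) \<longlongrightarrow> 0) (at_left 0)"
      by (rule tendsto_eventually) (auto simp: eventually_at_left_field flat_def intro: exI[of _ "-1"])
    have "\<forall>\<^sub>F y in at_right 0. flat (k + 1) y = (flat k y - flat k 0) / (y - 0)"
      by (auto simp: eventually_at_right_field flat_def divide_inverse intro: exI[of _ 1])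
    then have r: "((\<lambda>y. (flat k y - flat k 0) / (y - 0)) \<longlongrightarrow> 0) (at_right 0)"
      using flat_tendsto_0 by (rule Lim_transform_eventually[rotated])
    have "(flat k has_real_derivative 0) (at 0)"
      using l r by (simp add: has_field_derivative_iff filterlim_at_split)
    with 2 show ?thesis by (simp add: flat_def)
  next
    case 3
    have "((\<lambda>x. (inverse x) ^ k * exp (- inverse x)) has_real_derivative
        (flat (k + 2) x - real k * flat (k + 1) x)) (at x)"
    proof -
      have i: "(inverse has_real_derivative - (inverse x * inverse x)) (at x)"
        using DERIV_inverse[of x UNIV] 3 by (simp add: power2_eq_square)
      have e: "((\<lambda>x. exp (- inverse x)) has_real_derivative
          exp (- inverse x) * (inverse x * inverse x)) (at x)"
        using DERIV_chain2[OF DERIV_exp DERIV_minus[OF i]] by simp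
      have p: "((\<lambda>x. inverse x ^ k) has_real_derivative
          real k * (- (inverse x * inverse x) * inverse x ^ (k - Suc 0))) (at x)"
        using DERIV_power[OF i] by simp
      have "real k * (- (y * y) * y ^ (k - Suc 0)) * E + E * (y * y) * y ^ k =
          y ^ (k + 2) * E - real k * (y ^ (k + 1) * E)" for y E :: real
        by (cases k) (simp_all add: algebra_simps)
      from DERIV_mult[OF p e, unfolded this] show ?thesis
        using 3 by (simp add: flat_def)
    qed
    then show ?thesis
      by (rule has_field_derivative_transform_within[where S=UNIV and d=x]) (use 3 in \<open>auto simp: flat_def dist_real_def\<close>)
  qed
qed

lemma smooth_flat: "smooth (flat k)"
proof -
  have "times_cont_diff n (flat k)" for n
  proof (induction n arbitrary: k)
    case 0
    then show ?case
      using continuous_on_if_DERIV[OF flat_has_derivative] by simp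
  next
    case (Suc n)
    have "times_cont_diff n (\<lambda>x. flat (k + 2) x + (- real k) * flat (k + 1) x)"
      by (intro times_cont_diff_add times_cont_diff_mult times_cont_diff_const Suc)
    then show ?case
      using frechet_derivative_real[OF flat_has_derivative] differentiableI[OF has_field_derivative_imp_has_derivative[OF flat_has_derivative]]
      by simp
  qed
  then show ?thesis by (simp add: smooth_def)
qed

text \<open>Normalised antiderivative of a bump that lives on [0,1], namely the product of
  \<open>flat 0\<close> with its reflection about 1/2.\<close>

lemma smooth_step_exists:
  "\<exists>\<sigma>::real \<Rightarrow> real. smooth \<sigma> \<and> (\<forall>x\<le>0. \<sigma> x = 0) \<and> (\<forall>x\<ge>1. \<sigma> x = 1) \<and> (\<forall>x. 0 \<le> \<sigma> x \<and> \<sigma> x \<le> 1)"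
proof -
  define k where "k x = flat 0 x * flat 0 (1 - x)" for x
  have sm: "smooth k"
    unfolding k_def
    by (intro smooth_mult smooth_flat smooth_compose[OF smooth_flat])
       (use smooth_add[OF smooth_const[of 1] smooth_linear[of "\<lambda>x. - x"]] in
         \<open>simp add: bounded_linear_minus bounded_linear_ident\<close>)
  have cont: "continuous_on A k" for A by (rule smooth_imp_continuous_on[OF sm])
  have k0: "k x = 0" if "x \<le> 0 \<or> 1 \<le> x" for x using that by (auto simp: k_def flat_def)
  have knn: "0 \<le> k x" for x by (auto simp: k_def flat_def)
  define S where "S x = integral {0..x} k" for x
  have der: "(S has_real_derivative k x) (at x)" for x
  proof (cases "x < 0")
    case True
    have "((\<lambda>_. 0) has_real_derivative 0) (at x)" by simp
    then have "(S has_real_derivative 0) (at x)"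
      by (rule has_field_derivative_transform_within[where S=UNIV and d="-x"]) (use True in \<open>auto simp: S_def dist_real_def\<close>)
    with True k0 show ?thesis by simp
  next
    case False
    \<comment> \<open>The base point moves from 0 to -1 so that \<open>x = 0\<close> becomes
      interior and the derivative two-sided; the added stretch contributes nothing to the
      integral.\<close>
    have "((\<lambda>u. integral {-1..u} k) has_real_derivative k x) (at x within {-1..x+1})"
      by (rule integral_has_real_derivative[OF cont]) (use False in auto)
    then have 1: "((\<lambda>u. integral {-1..u} k) has_real_derivative k x) (at x)"
      using False by (subst (asm) at_within_Icc_at) auto
    have S_eq: "integral {-1..u} k = S u" if "u > -1" for u
    proof -
      have z: "integral {-1..c} k = 0" if "c \<le> 0" for c
        using that k0 by (subst integral_cong[where g="\<lambda>_. 0"]) auto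
      show ?thesis
      proof (cases "u < 0")
        case True
        then show ?thesis using z by (simp add: S_def)
      next
        case False
        then show ?thesis
          using Henstock_Kurzweil_Integration.integral_combine[of "-1" 0 u k]
            integrable_continuous_real[OF cont] z[of 0] by (simp add: S_def)
      qed
    qed
    from 1 show ?thesis
      by (rule has_field_derivative_transform_within[where S=UNIV and d=1]) (use False S_eq in \<open>auto simp: dist_real_def\<close>)
  qed
  have S0: "S x = 0" if "x \<le> 0" for x using that by (cases "x = 0") (auto simp: S_def)
  have S1: "S x = S 1" if "x \<ge> 1" for x
  proof -
    have "S x = S 1 + integral {1..x} k"
      using Henstock_Kurzweil_Integration.integral_combine[of 0 1 x k] that
        integrable_continuous_real[OF cont] by (simp add: S_def)
    also have "integral {1..x} k = 0"
      using k0 by (subst integral_cong[where g="\<lambda>_. 0"]) auto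
    finally show ?thesis by simp
  qed
  have mono: "S x \<le> S y" if "x \<le> y" for x y
    by (rule DERIV_nonneg_imp_nondecreasing[OF that]) (use der knn in blast)
  have "S 1 \<noteq> 0"
  proof
    assume 0: "S 1 = 0"
    have "k (1/2) = 0"
      by (rule integral_eq_0_iff[THEN iffD1, rule_format, of 0 1 k])
         (use 0 cont knn in \<open>auto simp: S_def\<close>)
    then show False by (simp add: k_def flat_def)
  qed
  with mono[of 0 1] S0[of 0] have pos: "S 1 > 0" by simp
  have smS: "smooth S" by (rule smooth_realI[OF der sm])
  define \<sigma> where "\<sigma> x = inverse (S 1) * S x" for x
  have "smooth \<sigma>" unfolding \<sigma>_def by (intro smooth_mult smooth_const smS)
  moreover
  have "0 \<le> S x \<and> S x \<le> S 1" for x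
    using mono[of 0 x] mono[of x 1] S0[of 0] S0[of x] S1[of x] pos by (cases "x \<le> 0"; cases "x \<ge> 1") auto
  then have "0 \<le> \<sigma> x \<and> \<sigma> x \<le> 1" for x
    unfolding \<sigma>_def using pos by (simp add: inverse_eq_divide)
  moreover have "\<sigma> x = 1" if "x \<ge> 1" for x
    unfolding \<sigma>_def S1[OF that] using pos by simp
  moreover have "\<sigma> x = 0" if "x \<le> 0" for x
    unfolding \<sigma>_def S0[OF that] by simp
  ultimately show ?thesis by blast
qed

lemma smooth_affine: "smooth (\<lambda>x::real. a * x + c)"
  by (rule smooth_add[OF smooth_linear[OF bounded_linear_mult_right] smooth_const])

lemma smooth_cutoff_below:
  assumes "a < (b::real)"
  obtains f where "smooth f" "\<And>x. x \<le> a \<Longrightarrow> f x = 1" "\<And>x. x \<ge> b \<Longrightarrow> f x = 0"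
    "\<And>x. 0 \<le> f x" "\<And>x. f x \<le> 1"
proof -
  obtain \<sigma> :: "real \<Rightarrow> real" where s: "smooth \<sigma>" "\<forall>x\<le>0. \<sigma> x = 0" "\<forall>x\<ge>1. \<sigma> x = 1"
    "\<forall>x. 0 \<le> \<sigma> x \<and> \<sigma> x \<le> 1"
    using smooth_step_exists by blast
  define l where "l x = (- inverse (b - a)) * x + b * inverse (b - a)" for x
  have l: "l x = (b - x) / (b - a)" for x by (simp add: l_def left_diff_distrib divide_inverse)
  show ?thesis
  proof (rule that)
    show "smooth (\<lambda>x. \<sigma> (l x))" unfolding l_def by (rule smooth_compose[OF s(1) smooth_affine])
  qed (use s assms in \<open>auto simp: l field_simps\<close>)
qed

lemma smooth_cutoff_interval:
  assumes "a' < a" "a \<le> b" "b < (b'::real)"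
  obtains \<eta> where "smooth \<eta>" "\<And>x. a \<le> x \<Longrightarrow> x \<le> b \<Longrightarrow> \<eta> x = 1" "\<And>x. x \<le> a' \<or> b' \<le> x \<Longrightarrow> \<eta> x = 0"
proof -
  obtain f where f: "smooth f" "\<And>x. x \<le> b \<Longrightarrow> f x = 1" "\<And>x. x \<ge> b' \<Longrightarrow> f x = 0"
    using smooth_cutoff_below[OF assms(3)] by metis
  have "- a < - a'" using assms by simp
  then obtain g where g: "smooth g" "\<And>x. x \<le> - a \<Longrightarrow> g x = 1" "\<And>x. x \<ge> - a' \<Longrightarrow> g x = 0"
    using smooth_cutoff_below by metis
  show ?thesis
  proof (rule that)
    show "smooth (\<lambda>x. f x * g (- x))"
      by (intro smooth_mult f smooth_compose[OF g(1)] smooth_linear)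
         (simp add: bounded_linear_minus bounded_linear_ident)
  qed (use f g in auto)
qed

subsection \<open>Radial test functions\<close>

text \<open>Radial weights are composed with the squared norm, a polynomial, instead of the norm,
  which is not differentiable at the origin.\<close>

lemma smooth_inner_self: "smooth (\<lambda>x::'a::euclidean_space. x \<bullet> x)"
proof -
  have "smooth (\<lambda>x::'a. \<Sum>b\<in>Basis. (x \<bullet> b) * (x \<bullet> b))"
    by (intro smooth_sum smooth_mult smooth_linear bounded_linear_inner_left)
  then show ?thesis by (simp add: euclidean_inner[symmetric])
qed

lemma frechet_derivative_radial:
  assumes "smooth \<theta>"
  shows "frechet_derivative (\<lambda>x::'a::euclidean_space. \<theta> (x \<bullet> x)) (at x) b = 2 * deriv \<theta> (x \<bullet> x) * (x \<bullet> b)"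
proof -
  have "((\<lambda>x::'a. x \<bullet> x) has_derivative (\<lambda>h. x \<bullet> h + h \<bullet> x)) (at x)"
    by (auto intro!: derivative_eq_intros)
  from frechet_derivative_at[OF this, symmetric]
  have "frechet_derivative (\<lambda>x::'a. x \<bullet> x) (at x) b = 2 * (x \<bullet> b)"
    by (simp add: inner_commute)
  then show ?thesis
    by (simp add: frechet_derivative_smooth_compose[OF assms smooth_imp_differentiable[OF smooth_inner_self]])
qed

lemma frechet_derivative_radial_2:
  assumes "smooth \<theta>" "norm b = 1"
  shows "frechet_derivative (\<lambda>x::'a::euclidean_space. 2 * deriv \<theta> (x \<bullet> x) * (x \<bullet> b)) (at x) b =
    2 * deriv \<theta> (x \<bullet> x) + 4 * deriv (deriv \<theta>) (x \<bullet> x) * (x \<bullet> b)\<^sup>2"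
proof -
  have 1: "((\<lambda>x::'a. deriv \<theta> (x \<bullet> x)) has_derivative
      (\<lambda>h. 2 * deriv (deriv \<theta>) (x \<bullet> x) * (x \<bullet> h))) (at x)"
    using frechet_derivative_works[THEN iffD1, OF smooth_imp_differentiable[OF smooth_compose[OF smooth_deriv[OF assms(1)] smooth_inner_self]]]
    by (simp add: frechet_derivative_radial[OF smooth_deriv[OF assms(1)], abs_def])
  have "((\<lambda>x::'a. 2 * deriv \<theta> (x \<bullet> x) * (x \<bullet> b)) has_derivative
      (\<lambda>h. 2 * deriv \<theta> (x \<bullet> x) * (h \<bullet> b) + 2 * (2 * deriv (deriv \<theta>) (x \<bullet> x) * (x \<bullet> h)) * (x \<bullet> b))) (at x)"
    by (intro has_derivative_mult has_derivative_mult_right has_derivative_inner_left has_derivative_ident 1)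
  from frechet_derivative_at[OF this, symmetric] show ?thesis
    using assms(2) by (simp add: power2_eq_square dot_square_norm)
qed

text \<open>Every basis direction contributes the same first-order term and a multiple of
  \<open>(x \<bullet> b)\<^sup>2\<close>; the sum over the basis produces the dimension and
  \<open>x \<bullet> x\<close>. With z = |x|^2 the eigenvalue problem turns into the ordinary
  equation solved by \<open>bessel\<close>.\<close>

lemma laplacian_radial:
  assumes "smooth \<theta>"
  shows "(\<Sum>b\<in>Basis. frechet_derivative (\<lambda>y. frechet_derivative (\<lambda>x::'a::euclidean_space. \<theta> (x \<bullet> x)) (at y) b) (at x) b) =
    2 * real DIM('a) * deriv \<theta> (x \<bullet> x) + 4 * (x \<bullet> x) * deriv (deriv \<theta>) (x \<bullet> x)"
proof -
  have "(\<Sum>b\<in>Basis. frechet_derivative (\<lambda>y. frechet_derivative (\<lambda>x::'a. \<theta> (x \<bullet> x)) (at y) b) (at x) b) =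
    (\<Sum>b\<in>(Basis::'a set). 2 * deriv \<theta> (x \<bullet> x) + 4 * deriv (deriv \<theta>) (x \<bullet> x) * (x \<bullet> b)\<^sup>2)"
    by (simp add: frechet_derivative_radial[OF assms] frechet_derivative_radial_2[OF assms])
  also have "\<dots> = 2 * real DIM('a) * deriv \<theta> (x \<bullet> x) + 4 * (x \<bullet> x) * deriv (deriv \<theta>) (x \<bullet> x)"
    by (simp add: sum.distrib sum_distrib_left[symmetric] euclidean_inner[of x x] power2_eq_square)
  finally show ?thesis .
qed

lemma test_functionI:
  assumes "smooth \<phi>" "compact K" "K \<subseteq> U" "\<And>x. x \<notin> K \<Longrightarrow> \<phi> x = 0"
  shows "\<phi> \<in> test_functions U"
proof -
  have "closure {x. \<phi> x \<noteq> 0} \<subseteq> K"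
    using assms by (intro closure_minimal) (auto intro: compact_imp_closed)
  then show ?thesis
    using assms compact_Int_closed[OF assms(2) closed_closure, of "{x. \<phi> x \<noteq> 0}"]
    by (auto simp: test_functions_def Int_absorb1)
qed

lemma smooth_time_radial:
  assumes "smooth \<eta>" "smooth \<theta>"
  shows "smooth (\<lambda>z::real \<times> 'a::euclidean_space. \<eta> (fst z) * \<theta> (snd z \<bullet> snd z))"
proof -
  have "smooth (\<lambda>z::real \<times> 'a. \<Sum>b\<in>Basis. (snd z \<bullet> b) * (snd z \<bullet> b))"
    by (intro smooth_sum smooth_mult smooth_linear bounded_linear_compose[OF bounded_linear_inner_left bounded_linear_snd])
  then have "smooth (\<lambda>z::real \<times> 'a. snd z \<bullet> snd z)" by (simp add: euclidean_inner[symmetric])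
  then show ?thesis
    by (intro smooth_mult smooth_compose[OF assms(1)] smooth_compose[OF assms(2)]
        smooth_linear[OF bounded_linear_fst])
qed

section \<open>Growth of moments under integrable damping\<close>

lemma nondecreasing_within:
  fixes f :: "real \<Rightarrow> real"
  assumes "a \<le> b" "\<And>x. x \<in> {a..b} \<Longrightarrow> (f has_real_derivative f' x) (at x within {a..b})"
    and "\<And>x. x \<in> {a..b} \<Longrightarrow> 0 \<le> f' x"
  shows "f a \<le> f b"
proof (cases "a = b")
  case False
  with assms(1) have "a < b" by simp
  then obtain x where x: "x \<in> {a<..<b}" "f b - f a = f' x * (b - a)"
    using mvt_simple[of a b f "\<lambda>x. (*) (f' x)"] assms(2) by (auto simp: has_field_derivative_def)
  have "0 \<le> f' x * (b - a)"
    using assms(1,3) x(1) by (intro mult_nonneg_nonneg) auto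
  with x(2) show ?thesis by linarith
qed simp

lemma integral_deriv_within:
  fixes f :: "real \<Rightarrow> real"
  assumes "continuous_on {0..L} f" "t \<in> {0..L}"
  shows "((\<lambda>u. integral {0..u} f) has_real_derivative f t) (at t within {0..L})"
  using integral_has_real_derivative[OF assms] .

text \<open>Let m = exp of the integral of \<open>b\<close> and let D be the integral of b N. Then
  (m D)' = m' A \<le> m' A(L), so A(L) m - m D is nondecreasing; its end values are A(L) and m(L)
  N(L). That \<open>A\<close> is only compared with its final value suits a source known merely to
  be monotone.\<close>

lemma damped_lower_bound:
  fixes b N A :: "real \<Rightarrow> real"
  assumes b: "continuous_on {0..L} b" "\<And>s. s \<in> {0..L} \<Longrightarrow> 0 \<le> b s"
    and N: "continuous_on {0..L} N"
    and A: "\<And>s. s \<in> {0..L} \<Longrightarrow> A s \<le> A L"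
    and eq: "\<And>s. s \<in> {0..L} \<Longrightarrow> N s + integral {0..s} (\<lambda>r. b r * N r) = A s"
    and L: "0 \<le> L"
  shows "A L \<le> exp (integral {0..L} b) * N L"
proof -
  define m where "m s = exp (integral {0..s} b)" for s
  define D where "D s = integral {0..s} (\<lambda>r. b r * N r)" for s
  have dm: "(m has_real_derivative m s * b s) (at s within {0..L})" if "s \<in> {0..L}" for s
    unfolding m_def by (rule DERIV_chain2[OF DERIV_exp integral_deriv_within[OF b(1) that]])
  have dD: "(D has_real_derivative b s * N s) (at s within {0..L})" if "s \<in> {0..L}" for s
    unfolding D_def by (rule integral_deriv_within[OF continuous_on_mult[OF b(1) N] that])
  have "A L * m 0 - m 0 * D 0 \<le> A L * m L - m L * D L"
  proof (rule nondecreasing_within[OF L])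
    fix s assume s: "s \<in> {0..L}"
    show "((\<lambda>s. A L * m s - m s * D s) has_real_derivative m s * b s * (A L - A s)) (at s within {0..L})"
      by (rule derivative_eq_intros dm[OF s] dD[OF s] refl)+
         (use eq[OF s] in \<open>simp add: D_def algebra_simps flip: eq[OF s]\<close>)
    show "0 \<le> m s * b s * (A L - A s)"
      using b(2)[OF s] A[OF s] by (simp add: m_def)
  qed
  moreover have "D L = A L - N L" using eq[of L] L by (simp add: D_def)
  moreover have "m 0 = 1" "D 0 = 0" by (simp_all add: m_def D_def)
  ultimately have "A L \<le> A L * m L - m L * (A L - N L)" by simp
  then show ?thesis by (simp add: m_def left_diff_distrib right_diff_distrib mult.commute)
qed

text \<open>Integrated form of W'' + b W' - \<kappa> W = source, where \<open>P\<close> is W',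
  \<open>G\<close> the accumulated nonnegative source and \<open>a\<close> the moment of the initial
  velocity. The mass has \<kappa> = 0, the moment against the eigenfunction has \<kappa> =
  1.\<close>

locale damped_moment =
  fixes b W P G :: "real \<Rightarrow> real" and L a \<kappa> :: real
  assumes L: "0 \<le> L"
    and b: "continuous_on {0..L} b" "\<And>s. s \<in> {0..L} \<Longrightarrow> 0 \<le> b s"
    and W: "\<And>s. s \<in> {0..L} \<Longrightarrow> (W has_real_derivative P s) (at s within {0..L})"
    and P: "continuous_on {0..L} P"
    and G: "mono_on {0..L} G" "\<And>s. s \<in> {0..L} \<Longrightarrow> 0 \<le> G s"
    and a: "0 \<le> a" and W0: "0 \<le> W 0"
    and eq: "\<And>s. s \<in> {0..L} \<Longrightarrow>
      P s + integral {0..s} (\<lambda>r. b r * P r) = a + \<kappa> * integral {0..s} W + G s"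
begin

text \<open>The bounds below speak of the right endpoint \<open>L\<close>; this carries them over to
  every earlier time.\<close>

lemma restrict:
  assumes "0 \<le> t" "t \<le> L"
  shows "damped_moment b W P G t a \<kappa>"
proof
  show "(W has_real_derivative P s) (at s within {0..t})" if "s \<in> {0..t}" for s
    by (rule has_field_derivative_subset[OF W]) (use that assms in auto)
qed (use assms b P G a W0 eq in \<open>auto intro: continuous_on_subset mono_on_subset\<close>)

lemma contW: "continuous_on {0..L} W"
  using W by (rule DERIV_continuous_on)

lemma growth_free:
  assumes "\<kappa> = 0"
  shows "a + G L \<le> exp (integral {0..L} b) * P L"
  by (rule damped_lower_bound[OF b P _ _ L])
     (use G(1) L assms eq in \<open>auto simp: mono_on_def\<close>)

text \<open>As long as \<open>W\<close> is nonnegative, the zeroth-order term only adds a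
  nondecreasing quantity to the right-hand side, and \<open>damped_lower_bound\<close> applies to
  the sum.\<close>

lemma derivative_lower_bound:
  assumes "\<kappa> = 1" "\<And>s. s \<in> {0..L} \<Longrightarrow> 0 \<le> W s"
  shows "a \<le> exp (integral {0..L} b) * P L"
proof -
  have "a + integral {0..L} W + G L \<le> exp (integral {0..L} b) * P L"
  proof (rule damped_lower_bound[OF b P _ _ L])
    fix s assume s: "s \<in> {0..L}"
    have "integral {0..s} W \<le> integral {0..L} W"
      using s assms by (intro integral_subset_le integrable_continuous_real continuous_on_subset[OF contW]) auto
    then show "a + integral {0..s} W + G s \<le> a + integral {0..L} W + G L"
      using monotone_onD[OF G(1) s, of L] s by simp
    show "P s + integral {0..s} (\<lambda>r. b r * P r) = a + integral {0..s} W + G s"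
      using eq[OF s] assms(1) by simp
  qed
  moreover have "0 \<le> integral {0..L} W"
    using assms by (intro integral_nonneg integrable_continuous_real contW) auto
  ultimately show ?thesis using G(2)[of L] L by simp
qed

text \<open>Consider the infimum \<tau> of the times with negative \<open>W\<close>. Up to \<tau>
  the moment is nonnegative, hence nondecreasing by \<open>derivative_lower_bound\<close>. Just
  after \<tau> it is nonnegative still: by continuity if \<open>a = 0\<close>, for then
  \<open>W \<tau>\<close> is positive, and by a positive derivative if \<open>a\<close> is positive.
  This contradicts the choice of \<tau>.\<close>

lemma nonneg:
  assumes "\<kappa> = 1" "0 < W 0 + a" "s \<in> {0..L}"
  shows "0 \<le> W s"
proof (rule ccontr)
  assume neg: "\<not> 0 \<le> W s"
  define S where "S = {s\<in>{0..L}. W s < 0}"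
  define \<tau> where "\<tau> = Inf S"
  have ne: "S \<noteq> {}" and bdd: "bdd_below S"
    using neg assms(3) by (auto simp: S_def intro: bdd_belowI[of _ 0])
  have t0: "0 \<le> \<tau>" unfolding \<tau>_def by (rule cInf_greatest[OF ne]) (auto simp: S_def)
  have tL: "\<tau> \<le> L"
    using cInf_lower[OF _ bdd, of s] neg assms(3) by (auto simp: S_def \<tau>_def)
  have before: "0 \<le> W r" if "0 \<le> r" "r < \<tau>" for r
    using cInf_lower[OF _ bdd, of r] that tL by (force simp: S_def \<tau>_def)
  have near: "\<exists>d>0. \<forall>r\<in>{0..L}. \<bar>r - \<tau>\<bar> < d \<longrightarrow> \<bar>W r - W \<tau>\<bar> < e" if "e > 0" for e
    using contW that t0 tL unfolding continuous_on_iff dist_real_def by (metis atLeastAtMost_iff)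
  \<comment> \<open>The infimum might itself belong to \<open>S\<close>; but a negative value at a
    positive \<tau> would persist slightly to the left, where \<open>W\<close> is
    nonnegative.\<close>
  have Wt: "0 \<le> W \<tau>"
  proof (rule ccontr)
    assume n: "\<not> 0 \<le> W \<tau>"
    then have "\<tau> > 0" using W0 t0 by (cases "\<tau> = 0") auto
    obtain d where d: "d > 0" "\<forall>r\<in>{0..L}. \<bar>r - \<tau>\<bar> < d \<longrightarrow> \<bar>W r - W \<tau>\<bar> < - W \<tau>"
      using near[of "- W \<tau>"] n by auto
    define r where "r = max 0 (\<tau> - d / 2)"
    have "0 \<le> r" "r < \<tau>" "\<bar>r - \<tau>\<bar> < d" using d(1) \<open>\<tau> > 0\<close> by (auto simp: r_def)
    with d(2) before[of r] tL show False by force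
  qed
  interpret R: damped_moment b W P G \<tau> a \<kappa> by (rule restrict[OF t0 tL])
  have pos: "0 \<le> W r" if "r \<in> {0..\<tau>}" for r
    using that before[of r] Wt by (cases "r = \<tau>") auto
  have "a \<le> exp (integral {0..t} b) * P t" if "t \<in> {0..\<tau>}" for t
  proof -
    interpret Q: damped_moment b W P G t a \<kappa> by (rule restrict) (use that tL in auto)
    show ?thesis by (rule Q.derivative_lower_bound[OF assms(1)]) (use pos that in auto)
  qed note Pl = this
  have Pnn: "0 \<le> P t" if "t \<in> {0..\<tau>}" for t
    using order_trans[OF a Pl[OF that]] by (simp add: zero_le_mult_iff)
  have W0t: "W 0 \<le> W \<tau>"
    by (rule nondecreasing_within[OF t0 R.W Pnn])
  obtain d where d: "d > 0" "\<forall>r\<in>{0..L}. \<tau> < r \<and> r < \<tau> + d \<longrightarrow> 0 \<le> W r"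
  proof (cases "a = 0")
    case True
    then have "W \<tau> > 0" using W0t assms(2) by simp
    from near[OF this] obtain d where "d > 0" "\<forall>r\<in>{0..L}. \<bar>r - \<tau>\<bar> < d \<longrightarrow> \<bar>W r - W \<tau>\<bar> < W \<tau>" by auto
    then have "0 \<le> W r" if "r \<in> {0..L}" "\<tau> < r \<and> r < \<tau> + d" for r
      using that by (smt (verit, best))
    with \<open>d > 0\<close> show ?thesis by (intro that[of d]) auto
  next
    case False
    then have "0 < exp (integral {0..\<tau>} b) * P \<tau>" using Pl[of \<tau>] a t0 by simp
    then have "0 < P \<tau>" by (simp add: zero_less_mult_iff)
    from has_real_derivative_pos_inc_right[OF W this] t0 tL
    obtain d where d: "d > 0" "\<forall>h>0. \<tau> + h \<in> {0..L} \<longrightarrow> h < d \<longrightarrow> W \<tau> < W (\<tau> + h)" by auto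
    show ?thesis
    proof (rule that[OF d(1)], intro ballI impI)
      fix r assume "r \<in> {0..L}" "\<tau> < r \<and> r < \<tau> + d"
      then show "0 \<le> W r" using d(2)[rule_format, of "r - \<tau>"] Wt by auto
    qed
  qed
  obtain r where r: "r \<in> S" "r < \<tau> + d"
    using cInf_lessD[OF ne, of "\<tau> + d"] d(1) by (auto simp: \<tau>_def)
  have "\<tau> \<le> r" using cInf_lower[OF r(1) bdd] by (simp add: \<tau>_def)
  then show False
    using r d(2)[rule_format, of r] Wt by (cases "r = \<tau>") (auto simp: S_def)
qed

text \<open>The growing mode is $P + W$: after division by $e^t$ it satisfies an equation without
  zeroth-order term, with nondecreasing right-hand side because $W \<ge> 0$.\<close>
lemma exponential_lower_bound:
  assumes "\<kappa> = 1" "0 < W 0 + a" "integral {0..L} b \<le> \<beta>" "1 \<le> L"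
  shows "exp (- \<beta>) * (W 0 + a) / 4 * exp L \<le> W L"
proof -
  note Wnn = nonneg[OF assms(1,2)]
  define N where "N s = exp (- s) * (P s + W s)" for s
  \<comment> \<open>The equation reads P + W = Q + G, with \<open>Q\<close> differentiable and
    \<open>G\<close> only monotone. \<open>H\<close> is what remains of the equation for
    \<open>N\<close> once the term with \<open>G\<close> is split off; its derivative contains
    \<open>G\<close> but no derivative of \<open>G\<close>.\<close>
  define Q where "Q s = a + W s + integral {0..s} W - integral {0..s} (\<lambda>r. b r * P r)" for s
  define H where "H s = exp (- s) * Q s + integral {0..s} (\<lambda>r. b r * N r)" for s
  have contN: "continuous_on {0..L} N"
    unfolding N_def by (intro continuous_intros P contW)
  have PQ: "P s + W s = Q s + G s" if "s \<in> {0..L}" for s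
    using eq[OF that] assms(1) by (simp add: Q_def)
  have dQ: "(Q has_real_derivative P s + W s - b s * P s) (at s within {0..L})" if s: "s \<in> {0..L}" for s
    unfolding Q_def
    by (rule derivative_eq_intros W[OF s] integral_deriv_within[OF contW s]
        integral_deriv_within[OF continuous_on_mult[OF b(1) P] s] refl)+ simp
  have dH: "(H has_real_derivative exp (- s) * (G s + b s * W s)) (at s within {0..L})"
    if s: "s \<in> {0..L}" for s
    unfolding H_def
    by (rule derivative_eq_intros dQ[OF s] integral_deriv_within[OF continuous_on_mult[OF b(1) contN] s] refl)+
       (simp add: N_def algebra_simps eq_diff_eq[THEN iffD2, OF PQ[OF s, symmetric]])
  define A where "A s = exp (- s) * G s + H s" for s
  have A: "A s \<le> A t" if st: "0 \<le> s" "s \<le> t" "t \<le> L" for s t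
  proof -
    \<comment> \<open>Since \<open>G\<close> cannot be differentiated, it is frozen at its left-end
      value. The decay of the factor exp(-r) in front of it is compensated by the term exp(-r) G(r)
      in the derivative of \<open>H\<close>.\<close>
    have "H s + G s * exp (- s) \<le> H t + G s * exp (- t)"
    proof (rule nondecreasing_within[OF st(2)])
      fix r assume r: "r \<in> {s..t}"
      then have rL: "r \<in> {0..L}" using st by auto
      have 1: "(H has_real_derivative exp (- r) * (G r + b r * W r)) (at r within {s..t})"
        by (rule has_field_derivative_subset[OF dH[OF rL]]) (use st in auto)
      show "((\<lambda>r. H r + G s * exp (- r)) has_real_derivative exp (- r) * (G r - G s + b r * W r)) (at r within {s..t})"
        by (rule derivative_eq_intros 1 refl)+ (simp add: algebra_simps)
      have "G s \<le> G r" using monotone_onD[OF G(1), of s r] r rL st by auto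
      then show "0 \<le> exp (- r) * (G r - G s + b r * W r)"
        using b(2)[OF rL] Wnn[OF rL] by simp
    qed
    moreover have "exp (- t) * G s \<le> exp (- t) * G t"
      using monotone_onD[OF G(1), of s t] st by simp
    ultimately show ?thesis unfolding A_def mult.commute[of "exp _"] by linarith
  qed
  have eqN: "N s + integral {0..s} (\<lambda>r. b r * N r) = A s" if "s \<in> {0..L}" for s
    using PQ[OF that] by (simp add: A_def H_def N_def algebra_simps)
  have Nl: "exp (- \<beta>) * (W 0 + a) \<le> N t" if t: "t \<in> {0..L}" for t
  proof -
    have sub: "{0..t} \<subseteq> {0..L}" using t by auto
    have "A t \<le> exp (integral {0..t} b) * N t"
      by (rule damped_lower_bound[OF continuous_on_subset[OF b(1) sub] _ continuous_on_subset[OF contN sub]])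
         (use t A eqN b(2) in auto)
    moreover have "W 0 + a \<le> A 0" using G(2)[of 0] L by (simp add: A_def H_def Q_def)
    moreover have "A 0 \<le> A t" using A t by auto
    ultimately have 1: "W 0 + a \<le> exp (integral {0..t} b) * N t" by simp
    have "integral {0..t} b \<le> integral {0..L} b"
      using t b by (intro integral_subset_le integrable_continuous_real continuous_on_subset[OF b(1)]) auto
    then have "exp (integral {0..t} b) \<le> exp \<beta>" using assms(3) by simp
    moreover have "0 \<le> N t" using less_le_trans[OF assms(2) 1] by (simp add: zero_less_mult_iff)
    ultimately have "W 0 + a \<le> exp \<beta> * N t"
      using 1 by (meson mult_right_mono order_trans)
    then show ?thesis by (simp add: exp_minus field_simps)
  qed
  define k where "k = exp (- \<beta>) * (W 0 + a)"
  have k: "k > 0" using assms(2) by (simp add: k_def)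
  \<comment> \<open>\<open>W\<close> is recovered from the growing mode with the integrating factor
    exp(s): the derivative of \<open>exp s * W s\<close> is \<open>exp (2 * s) * N s\<close>, which
    is at least k exp(2s).\<close>
  have "exp 0 * W 0 - k / 2 * exp (2 * 0) \<le> exp L * W L - k / 2 * exp (2 * L)"
  proof (rule nondecreasing_within[OF L])
    fix s assume s: "s \<in> {0..L}"
    show "((\<lambda>s. exp s * W s - k / 2 * exp (2 * s)) has_real_derivative
        exp (2 * s) * (N s - k)) (at s within {0..L})"
      by (rule derivative_eq_intros W[OF s] refl)+
         (simp add: N_def algebra_simps mult_exp_exp)
    show "0 \<le> exp (2 * s) * (N s - k)" using Nl[OF s] by (simp add: k_def)
  qed
  then have "k / 2 * (exp L * exp L - 1) \<le> exp L * W L"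
    using W0 by (simp add: mult_exp_exp algebra_simps)
  \<comment> \<open>As \<open>1 \<le> L\<close> gives exp(L) \<ge> 2, half of exp(2L) absorbs the
    subtracted 1; this turns the factor 1/2 into 1/4.\<close>
  moreover have "k / 4 * (exp L * exp L) \<le> k / 2 * (exp L * exp L - 1)"
  proof -
    have "2 \<le> exp L" using exp_ge_add_one_self[of L] assms(4) by linarith
    then have "2 * 2 \<le> exp L * exp L" by (intro mult_mono) auto
    then have "0 \<le> k * (exp L * exp L - 2)" using k by simp
    then show ?thesis by (simp add: algebra_simps)
  qed
  ultimately have "k / 4 * (exp L * exp L) \<le> exp L * W L" by (rule order_trans[rotated])
  then have "exp L * (k / 4 * exp L) \<le> exp L * W L" by (simp only: ac_simps)
  then have "k / 4 * exp L \<le> W L" by (simp only: mult_le_cancel_left_pos[OF exp_gt_zero])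
  then show ?thesis by (simp only: k_def)
qed

end

subsection \<open>The radial eigenfunction of the Laplacian\<close>

text \<open>For a dimension n, these are the Taylor coefficients in z = r^2 of Gamma(n/2)
  (r/2)^(1-n/2) I(r), with I the modified Bessel function of order n/2 - 1. For n = 1 the function
  is cosh r; in general it is the mean of exp(x . \<omega>) over unit vectors \<omega>, with r =
  |x|.\<close>

definition bessel_coeff :: "real \<Rightarrow> nat \<Rightarrow> real" where
  "bessel_coeff n k = inverse (fact k * (\<Prod>j<k. 4 * real j + 2 * n))"

text \<open>The index \<open>j\<close> counts derivatives in \<open>z\<close>, taken termwise by
  \<open>diffs\<close>, so that the family has the shape required by
  \<open>smooth_real_sequence\<close>.\<close>

definition bessel :: "real \<Rightarrow> nat \<Rightarrow> real \<Rightarrow> real" where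
  "bessel n j z = (\<Sum>k. (diffs ^^ j) (bessel_coeff n) k * z ^ k)"

context
  fixes n :: real
  assumes n: "1 \<le> n"
begin

lemma bessel_coeff_pos: "0 < bessel_coeff n k"
  using n by (auto simp: bessel_coeff_def intro!: mult_pos_pos prod_pos)

lemma bessel_coeff_Suc: "real (Suc k) * (4 * real k + 2 * n) * bessel_coeff n (Suc k) = bessel_coeff n k"
proof -
  have ring: "y * x * inverse (y * f * (p * x)) = inverse (f * p)" if "x \<noteq> 0" "y \<noteq> 0" for x y f p :: real
    using that by (simp add: divide_simps inverse_eq_divide)
  have "4 * real k + 2 * n \<noteq> 0" "real (Suc k) \<noteq> 0" using n by auto
  then show ?thesis
    unfolding bessel_coeff_def fact_Suc prod.lessThan_Suc by (rule ring)
qed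

text \<open>Every factor 4j + 2n is at least 1, so the coefficients are dominated by those of exp;
  termwise differentiation preserves convergence everywhere.\<close>

lemma bessel_summable: "summable (\<lambda>k. (diffs ^^ j) (bessel_coeff n) k * z ^ k)"
proof (induction j arbitrary: z)
  case 0
  have "1 \<le> 4 * real j + 2 * n" for j
    using n by linarith
  then have "1 \<le> (\<Prod>j<k. 4 * real j + 2 * n)" for k
    by (intro prod_ge_1)
  then have le: "bessel_coeff n k \<le> inverse (fact k)" for k
    by (simp add: bessel_coeff_def mult_le_cancel_left1 inverse_le_1_iff)
  have "summable (\<lambda>k. inverse (fact k) * \<bar>z\<bar> ^ k)" by (rule summable_exp)
  then show ?case
  proof (rule summable_comparison_test'[where N=0])
    fix k
    show "norm ((diffs ^^ 0) (bessel_coeff n) k * z ^ k) \<le> inverse (fact k) * \<bar>z\<bar> ^ k"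
      using bessel_coeff_pos[of k] le[of k]
      by (auto simp: abs_mult power_abs intro!: mult_right_mono)
  qed
next
  case (Suc j)
  show ?case
    using termdiff_converges_all[OF Suc.IH] by simp
qed

lemma bessel_deriv: "(bessel n j has_real_derivative bessel n (Suc j) z) (at z)"
  unfolding bessel_def[abs_def]
  using termdiffs_strong_converges_everywhere[OF bessel_summable] by simp

lemma diffs_funpow_bessel_nonneg: "0 \<le> (diffs ^^ j) (bessel_coeff n) k"
  by (induction j arbitrary: k) (auto simp: diffs_def less_imp_le[OF bessel_coeff_pos])

lemma bessel_nonneg: "0 \<le> z \<Longrightarrow> 0 \<le> bessel n j z"
  unfolding bessel_def by (intro suminf_nonneg bessel_summable) (simp add: diffs_funpow_bessel_nonneg)

lemma bessel_ge_1: "0 \<le> z \<Longrightarrow> 1 \<le> bessel n 0 z"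
  using sum_le_suminf[OF bessel_summable[of 0 z], of "{0}"]
  by (simp add: bessel_def bessel_coeff_pos less_imp_le) (simp add: bessel_coeff_def)

text \<open>This is the recursion \<open>bessel_coeff_Suc\<close> read coefficient by coefficient.
  Multiplication of the second derivative by \<open>z\<close> shifts its series by one place, and
  the term thereby added at k = 0 is zero.\<close>

lemma bessel_ode: "4 * z * bessel n 2 z + 2 * n * bessel n 1 z = bessel n 0 z"
proof -
  let ?c = "bessel_coeff n"
  have s1: "(\<lambda>k. real (Suc k) * ?c (Suc k) * z ^ k) sums bessel n 1 z"
    using summable_sums[OF bessel_summable[of 1 z]] by (simp add: bessel_def diffs_def)
  have "(\<lambda>k. real (Suc k) * (real (Suc (Suc k)) * ?c (Suc (Suc k))) * z ^ k) sums bessel n 2 z"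
    using summable_sums[OF bessel_summable[of 2 z]] by (simp add: bessel_def diffs_def numeral_2_eq_2)
  then have "(\<lambda>k. real (Suc k) * (real (Suc (Suc k)) * ?c (Suc (Suc k))) * z ^ Suc k) sums (z * bessel n 2 z)"
    by (drule_tac sums_mult[where c=z]) (simp add: mult_ac)
  then have s2: "(\<lambda>k. real k * (real (Suc k) * ?c (Suc k)) * z ^ k) sums (z * bessel n 2 z)"
    using sums_Suc_iff[of "\<lambda>k. real k * (real (Suc k) * ?c (Suc k)) * z ^ k"] by simp
  have "(\<lambda>k. 4 * (real k * (real (Suc k) * ?c (Suc k)) * z ^ k) + 2 * n * (real (Suc k) * ?c (Suc k) * z ^ k))
      sums (4 * (z * bessel n 2 z) + 2 * n * bessel n 1 z)"
    by (intro sums_add sums_mult s1 s2)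
  moreover have "4 * (real k * (real (Suc k) * ?c (Suc k)) * z ^ k) + 2 * n * (real (Suc k) * ?c (Suc k) * z ^ k)
      = ?c k * z ^ k" for k
    by (subst bessel_coeff_Suc[of k, symmetric]) (simp add: algebra_simps)
  ultimately have "(\<lambda>k. ?c k * z ^ k) sums (4 * (z * bessel n 2 z) + 2 * n * bessel n 1 z)"
    by simp
  then show ?thesis by (simp add: bessel_def sums_iff)
qed

text \<open>With $g(r) = F(r^2)$ and $s = (n-1)/2$, the function $w = r^s g$ solves
  $w'' = (1 + s(s-1)/r^2) w$; the proof bounds $e^{-r}(w + w')$.\<close>
lemma bessel_upper_bound:
  "\<exists>C>0. \<forall>r\<ge>0. bessel n 0 (r\<^sup>2) \<le> C * (1 + r) powr (- ((n - 1) / 2)) * exp r"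
proof -
  define s where "s = (n - 1) / 2"
  have s: "0 \<le> s" using n by (simp add: s_def)
  define c where "c = \<bar>s * (s - 1)\<bar>"
  define g where "g r = bessel n 0 (r\<^sup>2)" for r
  define g' where "g' r = 2 * r * bessel n 1 (r\<^sup>2)" for r
  have gnn: "1 \<le> g r" "0 \<le> r \<Longrightarrow> 0 \<le> g' r" for r
    by (auto simp: g_def g'_def bessel_ge_1 bessel_nonneg)
  have sq: "((\<lambda>r. r\<^sup>2) has_real_derivative 2 * r) (at r)" for r :: real
    using DERIV_pow[of 2 r] by simp
  note db = DERIV_chain2[OF bessel_deriv sq]
  have dg: "(g has_real_derivative g' r) (at r)" for r
    unfolding g_def g'_def using db[of 0] by (simp add: mult.commute)
  have dg': "(g' has_real_derivative g r - 2 * s / r * g' r) (at r)" if "r > 0" for r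
  proof -
    have "(g' has_real_derivative 2 * bessel n 1 (r\<^sup>2) + 2 * r * (bessel n (Suc 1) (r\<^sup>2) * (2 * r))) (at r)"
      unfolding g'_def by (rule derivative_eq_intros db refl)+ simp
    moreover have "2 * bessel n 1 (r\<^sup>2) + 2 * r * (bessel n (Suc 1) (r\<^sup>2) * (2 * r)) = g r - 2 * s / r * g' r"
    proof -
      have "2 * s / r * g' r = 2 * (n - 1) * bessel n 1 (r\<^sup>2)"
        using that by (simp add: g'_def s_def)
      then show ?thesis
        using bessel_ode[of "r\<^sup>2"] by (simp add: g_def power2_eq_square numeral_2_eq_2 algebra_simps)
    qed
    ultimately show ?thesis by simp
  qed
  \<comment> \<open>The quantity exp(-r) (w + w') has derivative exp(-r) w s(s-1)/r^2, whose sign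
    depends on s. The factor \<open>exp (c / r)\<close> with c = |s(s-1)| adds -c/r^2 times the
    quantity itself, and as w and w' are nonnegative the total becomes nonpositive.\<close>
  define H where "H r = exp (- r) * r powr s * ((1 + s / r) * g r + g' r) * exp (c / r)" for r
  have dH: "(H has_real_derivative exp (- r) * r powr s * exp (c / r) / r\<^sup>2 *
      ((s * (s - 1) - c) * g r - c * (s / r * g r + g' r))) (at r)" if r: "r > 0" for r
  proof -
    define i where "i = inverse r"
    define E where "E r = exp (- r) * r powr s * exp (c * inverse r)" for r
    define K where "K r = (1 + s * inverse r) * g r + g' r" for r
    have di: "(inverse has_real_derivative - (i * i)) (at r)"
      using DERIV_inverse[of r UNIV] r by (simp add: power2_eq_square i_def)
    have dp: "((\<lambda>r. r powr s) has_real_derivative s * i * r powr s) (at r)"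
      using has_real_derivative_powr[OF r, of s] r by (simp add: powr_diff i_def divide_inverse ac_simps)
    have dE: "(E has_real_derivative E r * (s * i - 1 - c * (i * i))) (at r)"
      unfolding E_def
      by (rule derivative_eq_intros di dp refl)+ (simp add: i_def[symmetric] algebra_simps)
    have dK: "(K has_real_derivative - s * (i * i) * g r + (1 + s * i) * g' r + (g r - 2 * s * i * g' r)) (at r)"
      unfolding K_def
      by (rule derivative_eq_intros di dg dg'[OF r] refl)+
        (simp add: i_def[symmetric] divide_inverse algebra_simps)
    have "(H has_real_derivative E r * (s * i - 1 - c * (i * i)) * K r +
        (- s * (i * i) * g r + (1 + s * i) * g' r + (g r - 2 * s * i * g' r)) * E r) (at r)"
      using DERIV_mult[OF dE dK] by (simp add: H_def[abs_def] E_def K_def divide_inverse ac_simps)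
    moreover have "E r * (s * i - 1 - c * (i * i)) * K r +
        (- s * (i * i) * g r + (1 + s * i) * g' r + (g r - 2 * s * i * g' r)) * E r =
        E r * (i * i) * ((s * (s - 1) - c) * g r - c * (s * i * g r + g' r))"
      unfolding K_def i_def[symmetric] by algebra
    ultimately show ?thesis
      by (simp add: E_def i_def divide_inverse power2_eq_square)
  qed
  have mono: "H r \<le> H 1" if "1 \<le> r" for r
  proof (rule DERIV_nonpos_imp_nonincreasing[OF that])
    fix x assume x: "1 \<le> x" "x \<le> r"
    have "(s * (s - 1) - c) * g x \<le> 0"
      using gnn(1)[of x] by (intro mult_nonpos_nonneg) (auto simp: c_def)
    moreover have "0 \<le> c * (s / x * g x + g' x)"
      using gnn[of x] x s by (intro mult_nonneg_nonneg add_nonneg_nonneg) (auto simp: c_def)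
    ultimately have "exp (- x) * x powr s * exp (c / x) / x\<^sup>2 *
      ((s * (s - 1) - c) * g x - c * (s / x * g x + g' x)) \<le> 0"
      by (intro mult_nonneg_nonpos) auto
    then show "\<exists>y. (H has_real_derivative y) (at x) \<and> y \<le> 0"
      using dH[of x] x by auto
  qed
  have large: "g r \<le> H 1 * r powr (- s) * exp r" if r: "1 \<le> r" for r
  proof -
    have "g r \<le> ((1 + s / r) * g r + g' r) * 1"
      using gnn[of r] s r by (simp add: algebra_simps)
    also have "\<dots> \<le> ((1 + s / r) * g r + g' r) * exp (c / r)"
      using gnn[of r] s r by (intro mult_left_mono add_nonneg_nonneg mult_nonneg_nonneg) (auto simp: c_def)
    also have "((1 + s / r) * g r + g' r) * exp (c / r) = H r * r powr (- s) * exp r"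
    proof -
      have "exp (- r) * r powr s * r powr (- s) * exp r = 1"
        using r by (simp add: powr_add[symmetric] mult.assoc mult_exp_exp exp_minus)
      then have "x = exp (- r) * r powr s * y * z * r powr (- s) * exp r" if "x = y * z" for x y z
        unfolding that by algebra
      then show ?thesis by (auto simp: H_def)
    qed
    also have "\<dots> \<le> H 1 * r powr (- s) * exp r"
      using mono[OF r] by (intro mult_right_mono) auto
    finally show ?thesis .
  qed
  have H1: "0 \<le> H 1" using gnn[of 1] s by (simp add: H_def)
  have small: "g r \<le> g 1" if "0 \<le> r" "r \<le> 1" for r
    by (rule DERIV_nonneg_imp_nondecreasing[OF that(2)]) (use dg gnn that in \<open>meson order_trans\<close>)
  \<comment> \<open>\<open>2 powr s\<close> pays for replacing r by 1 + r: one has 1 + r \<le> 2r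
    for r \<ge> 1, and 1 + r \<le> 2 on [0,1], where \<open>g\<close> is at most
    \<open>g 1\<close>.\<close>
  define C where "C = (g 1 + H 1) * 2 powr s"
  have "g r \<le> C * (1 + r) powr (- s) * exp r" if r: "0 \<le> r" for r
  proof (cases "r \<le> 1")
    case True
    have "1 \<le> 2 powr s * (1 + r) powr (- s)"
      using True r s powr_mono2[OF s, of "1 + r" 2] by (simp add: powr_minus divide_simps)
    then have "1 * 1 \<le> (2 powr s * (1 + r) powr (- s)) * exp r"
      using r by (intro mult_mono) auto
    then have "(g 1 + H 1) * 1 \<le> (g 1 + H 1) * ((2 powr s * (1 + r) powr (- s)) * exp r)"
      using gnn[of 1] H1 by (intro mult_left_mono) auto
    then show ?thesis using small[OF r True] H1 by (simp add: C_def mult.assoc)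
  next
    case False
    have "(1 + r) powr s \<le> (2 * r) powr s"
      using False s by (intro powr_mono2) auto
    then have "r powr (- s) \<le> 2 powr s * (1 + r) powr (- s)"
      using False by (simp add: powr_minus powr_mult divide_simps)
    then have "H 1 * r powr (- s) * exp r \<le> (g 1 + H 1) * (2 powr s * (1 + r) powr (- s)) * exp r"
      using H1 gnn[of 1] by (intro mult_right_mono mult_mono) auto
    then have "g r \<le> (g 1 + H 1) * (2 powr s * (1 + r) powr (- s)) * exp r"
      using False by (intro order_trans[OF large]) auto
    then show ?thesis by (simp only: C_def mult.assoc)
  qed
  moreover have "C > 0" using gnn[of 1] H1 by (simp add: C_def)
  ultimately show ?thesis unfolding g_def s_def by blast
qed

end

text \<open>Exponential growth lets the last terms dominate: counted by the distance K - k from the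
  end, a term is at most the last one times f(K - k), and \<open>f\<close> is summable and
  independent of \<open>K\<close>.\<close>

lemma exp_weighted_sum_bound:
  fixes a q :: real
  assumes q: "0 < q"
  shows "\<exists>C>0. \<forall>K. (\<Sum>k\<le>K. (1 + real k) powr a * exp (q * k)) \<le> C * (1 + real K) powr a * exp (q * K)"
proof -
  define f where "f j = (1 + real j) powr \<bar>a\<bar> * exp (- q * real j)" for j
  have "f \<in> O(\<lambda>j. 1 / real j ^ 2)"
    unfolding f_def using q by real_asymp
  moreover have "summable (\<lambda>j. norm (1 / real j ^ 2))"
    using inverse_power_summable[of 2, where 'a=real] by (simp add: inverse_eq_divide)
  ultimately have sf: "summable f"
    by (rule summable_comparison_test_bigo[rotated])
  \<comment> \<open>Two weights differ by at most a power of the distance of their places; for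
    negative \<open>a\<close> this rests on 1 + K \<le> (1 + k)(1 + K - k).\<close>
  have pt: "(1 + real k) powr a \<le> (1 + real K) powr a * (1 + real (K - k)) powr \<bar>a\<bar>" if k: "k \<le> K" for k K
  proof (cases "0 \<le> a")
    case True
    have "(1 + real k) powr a * 1 \<le> (1 + real K) powr a * (1 + real (K - k)) powr \<bar>a\<bar>"
      using True k by (intro mult_mono powr_mono2 ge_one_powr_ge_zero) auto
    then show ?thesis by simp
  next
    case False
    obtain d where "K = k + d" using k le_Suc_ex by blast
    then have "1 + real K \<le> (1 + real k) * (1 + real (K - k))"
      by (simp add: algebra_simps)
    then have "(1 + real K) powr (- a) \<le> ((1 + real k) * (1 + real (K - k))) powr (- a)"
      using False by (intro powr_mono2) auto
    also have "\<dots> = (1 + real k) powr (- a) * (1 + real (K - k)) powr (- a)"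
      by (simp add: powr_mult)
    finally show ?thesis
      using False by (simp add: powr_minus divide_simps abs_if mult.commute)
  qed
  define C where "C = suminf f + 1"
  have fnn: "0 \<le> f j" for j by (simp add: f_def)
  have C: "C > 0" using suminf_nonneg[OF sf fnn] by (simp add: C_def)
  have "(\<Sum>k\<le>K. (1 + real k) powr a * exp (q * k)) \<le> C * (1 + real K) powr a * exp (q * K)" for K
  proof -
    have "(\<Sum>k\<le>K. (1 + real k) powr a * exp (q * k)) \<le>
        (\<Sum>k\<le>K. (1 + real K) powr a * exp (q * K) * f (K - k))"
    proof (rule sum_mono)
      fix k assume k: "k \<in> {..K}"
      have "exp (q * k) = exp (q * K) * exp (- q * real (K - k))"
        using k by (simp add: mult_exp_exp of_nat_diff algebra_simps)
      then show "(1 + real k) powr a * exp (q * k) \<le> (1 + real K) powr a * exp (q * K) * f (K - k)"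
        using mult_right_mono[OF pt[of k K], of "exp (q * k)"] k by (simp add: f_def algebra_simps)
    qed
    also have "\<dots> = (1 + real K) powr a * exp (q * K) * (\<Sum>k\<le>K. f (K - k))"
      by (rule sum_distrib_left[symmetric])
    also have "(\<Sum>k\<le>K. f (K - k)) = (\<Sum>k\<le>K. f k)"
      using sum.nat_diff_reindex[of f "Suc K"] by (simp only: lessThan_Suc_atMost diff_Suc_Suc)
    finally have 1: "(\<Sum>k\<le>K. (1 + real k) powr a * exp (q * k)) \<le>
      (1 + real K) powr a * exp (q * K) * (\<Sum>k\<le>K. f k)" .
    have "sum f {..K} \<le> suminf f" by (rule sum_le_suminf[OF sf]) (simp_all add: fnn)
    then have "sum f {..K} \<le> C" unfolding C_def by linarith
    then have "(1 + real K) powr a * exp (q * K) * (\<Sum>k\<le>K. f k) \<le> (1 + real K) powr a * exp (q * K) * C"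
      by (rule mult_left_mono) simp
    from order_trans[OF 1 this] show ?thesis by (simp only: mult.commute mult.left_commute)
  qed
  with C show ?thesis by blast
qed


subsection \<open>The coupled system of integral inequalities\<close>

lemma power_powr: "0 < x \<Longrightarrow> (x ^ k) powr a = (x powr a) ^ k" for x a :: real
  by (simp add: powr_powr mult.commute flip: powr_realpow)

text \<open>Let \<sigma> be the right-hand maximum, so \<sigma> \<ge> 2 and \<sigma>^(r-1) \<ge> D,
  and suppose K a(0)^(r-1) \<ge> \<sigma>. Then a(k) \<ge> a(0) \<sigma>^k by induction: the
  assumption supplies the new factor \<sigma>, while \<sigma>^(k(r-1)) outweighs the loss D^k.
  Geometric growth contradicts the bound \<open>B\<close>.\<close>

lemma superlinear_recursion_bounded:
  fixes a :: "nat \<Rightarrow> real"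
  assumes r: "1 < r" and D: "1 \<le> D" and K: "0 < K" and a0: "0 < a 0"
    and step: "\<And>k. K / D ^ k * a k powr r \<le> a (Suc k)" and bound: "\<And>k. a k \<le> B"
  shows "K * a 0 powr (r - 1) < max 2 (D powr (1 / (r - 1)))"
proof (rule ccontr)
  define \<sigma> where "\<sigma> = max 2 (D powr (1 / (r - 1)))"
  assume "\<not> ?thesis"
  then have large: "\<sigma> \<le> K * a 0 powr (r - 1)" by (simp only: \<sigma>_def not_less)
  have \<sigma>: "2 \<le> \<sigma>" "D powr (1 / (r - 1)) \<le> \<sigma>" by (auto simp: \<sigma>_def)
  have D\<sigma>: "D \<le> \<sigma> powr (r - 1)"
  proof -
    have "D = (D powr (1 / (r - 1))) powr (r - 1)" using r D by (simp add: powr_powr)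
    also have "\<dots> \<le> \<sigma> powr (r - 1)" using r \<sigma> by (intro powr_mono2) auto
    finally show ?thesis .
  qed
  have grow: "a 0 * \<sigma> ^ k \<le> a k" for k
  proof (induction k)
    case (Suc k)
    have "1 \<le> (\<sigma> powr (r - 1)) ^ k / D ^ k"
      using power_mono[OF D\<sigma>, of k] D by simp
    moreover have "(\<sigma> powr (r - 1)) ^ k = (\<sigma> ^ k) powr (r - 1)"
      using \<sigma>(1) by (simp add: power_powr)
    ultimately have 1: "1 \<le> (\<sigma> ^ k) powr (r - 1) / D ^ k" by simp
    have "a 0 * \<sigma> ^ Suc k = (\<sigma> * 1) * (a 0 * \<sigma> ^ k)" by simp
    also have "\<dots> \<le> (K * a 0 powr (r - 1) * ((\<sigma> ^ k) powr (r - 1) / D ^ k)) * (a 0 * \<sigma> ^ k)"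
      using large 1 a0 \<sigma>(1) K by (intro mult_right_mono mult_mono) auto
    also have "\<dots> = K / D ^ k * (a 0 * \<sigma> ^ k) powr r"
      using a0 \<sigma>(1) by (simp add: powr_diff powr_mult)
    also have "\<dots> \<le> K / D ^ k * a k powr r"
      using Suc a0 \<sigma>(1) K D r by (intro mult_left_mono powr_mono2) auto
    also have "\<dots> \<le> a (Suc k)" by (rule step)
    finally show ?case .
  qed simp
  obtain k where k: "B / a 0 < 2 ^ k" using real_arch_pow[of 2] by auto
  have "(2::real) ^ k \<le> \<sigma> ^ k" using \<sigma>(1) by (intro power_mono) auto
  then have "a 0 * 2 ^ k \<le> a 0 * \<sigma> ^ k" using a0 by simp
  also have "\<dots> \<le> B" using grow bound order_trans by blast
  finally show False using k a0 by (simp add: field_simps)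
qed

text \<open>The times start at L/2 and increase to L, so infinitely many steps fit before L; their
  shrinking gaps cost only a geometric factor, which a superlinear recursion can afford.\<close>

lemma coupled_iteration:
  fixes U V :: "real \<Rightarrow> real"
  assumes pq: "1 < p" "1 < q" and L: "0 < L" and c: "0 < c1" "0 < c2"
    and U: "\<And>s t. L / 2 \<le> s \<Longrightarrow> s < t \<Longrightarrow> t \<le> L \<Longrightarrow> c1 * (t - s)\<^sup>2 * V s powr p \<le> U t"
    and V: "\<And>s t. L / 2 \<le> s \<Longrightarrow> s < t \<Longrightarrow> t \<le> L \<Longrightarrow> c2 * (t - s)\<^sup>2 * U s powr q \<le> V t"
    and U0: "0 < U (L / 2)" and B: "\<And>t. L / 2 \<le> t \<Longrightarrow> t \<le> L \<Longrightarrow> U t \<le> B"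
  shows "c1 * c2 powr p * L powr (2 + 2 * p) / 2 powr (6 + 4 * p) * U (L / 2) powr (p * q - 1)
    < max 2 ((16 * 16 powr p) powr (1 / (p * q - 1)))"
proof -
  define t where "t k = L * (1 - 1 / 2 ^ Suc k)" for k :: nat
  have t: "L / 2 \<le> t k" "t k < t (Suc k)" "t k \<le> L" for k
  proof -
    have "(1::real) / 2 ^ Suc k \<le> 1 / 2" by (simp add: field_simps)
    then have "L * (1 / 2) \<le> L * (1 - 1 / 2 ^ Suc k)" using L by (intro mult_left_mono) auto
    then show "L / 2 \<le> t k" by (simp add: t_def)
    show "t k < t (Suc k)" unfolding t_def using L by (intro mult_strict_left_mono) (auto simp: field_simps)
    have "L * (1 - 1 / 2 ^ Suc k) \<le> L * 1" using L by (intro mult_left_mono) auto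
    then show "t k \<le> L" by (simp add: t_def)
  qed
  have dt: "t (Suc k) - t k = L / 2 ^ (k + 2)" for k
    by (simp add: t_def field_simps)
  \<comment> \<open>One round leads from \<open>U\<close> at an even time to \<open>V\<close> at the
    next odd time and back to \<open>U\<close>. The squared gaps are L^2 / (16 x) and L^2 / (64 x)
    with x = 16^k, and the first is raised to the power p; this produces 64 16^p = 2^(6+4p) in
    \<open>K\<close> and the loss 16 16^p per round in \<open>D\<close>.\<close>
  define a where "a k = U (t (2 * k))" for k
  have a0: "a 0 = U (L / 2)" by (simp add: a_def t_def)
  define K where "K = c1 * c2 powr p * L powr (2 + 2 * p) / 2 powr (6 + 4 * p)"
  define D where "D = 16 * 16 powr p"
  have D1: "1 \<le> D" using pq ge_one_powr_ge_zero[of 16 p] by (simp add: D_def)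
  have "K * a 0 powr (p * q - 1) < max 2 (D powr (1 / (p * q - 1)))"
  proof (rule superlinear_recursion_bounded)
    show "1 < p * q" using pq by (metis less_1_mult)
    show "0 < K" using c L by (simp add: K_def)
    show "a k \<le> B" for k unfolding a_def by (intro B t)
    fix k
    define x where "x = (16::real) ^ k"
    have x: "x > 0" by (simp add: x_def)
    have p4: "((2::real) ^ (2 * k + j))\<^sup>2 = 4 ^ j * x" for j
    proof -
      have "((2::real) ^ i)\<^sup>2 = 4 ^ i" for i
        by (simp add: power2_eq_square flip: power_mult_distrib)
      then show ?thesis unfolding x_def by (simp only:) (simp add: power_add power_mult)
    qed
    have sq: "(L / 2 ^ (2 * k + j))\<^sup>2 = L\<^sup>2 / (4 ^ j * x)" for j
      by (simp only: power_divide p4)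
    have v: "c2 * (L\<^sup>2 / (16 * x)) * a k powr q \<le> V (t (Suc (2 * k)))"
      using V[OF t(1,2,3), of "2 * k"] sq[of 2] by (simp add: a_def dt)
    have u: "c1 * (L\<^sup>2 / (64 * x)) * V (t (Suc (2 * k))) powr p \<le> a (Suc k)"
    proof -
      have e: "Suc (2 * k) + 2 = 2 * k + 3" "2 * Suc k = Suc (Suc (2 * k))" by simp_all
      have "(4::real) ^ 3 = 64" by simp
      then show ?thesis
        using U[OF t(1,2,3), of "Suc (2 * k)"] by (simp only: dt a_def e sq)
    qed
    have Dk: "D ^ k = x * x powr p"
      by (simp add: D_def x_def power_mult_distrib power_powr)
    have L2: "L powr (2 + 2 * p) = L\<^sup>2 * (L\<^sup>2) powr p"
      using L by (simp add: powr_add powr_powr flip: powr_numeral)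
    have two: "2 powr (6 + 4 * p) = 64 * (16::real) powr p"
    proof -
      have "(2::real) powr (6 + 4 * p) = 2 powr 6 * (2 powr 4) powr p"
        by (simp only: powr_add powr_powr)
      then show ?thesis by (simp only: powr_numeral) simp
    qed
    have "(c2 * (L\<^sup>2 / (16 * x)) * a k powr q) powr p =
        c2 powr p * ((L\<^sup>2) powr p / (16 powr p * x powr p)) * a k powr (p * q)"
      using c x by (simp only: powr_mult powr_divide powr_powr mult.commute[of q p])
    then have "K / D ^ k * a k powr (p * q) = c1 * (L\<^sup>2 / (64 * x)) * (c2 * (L\<^sup>2 / (16 * x)) * a k powr q) powr p"
      unfolding K_def Dk two L2 by (simp only: divide_inverse inverse_mult_distrib ac_simps)
    also have "\<dots> \<le> c1 * (L\<^sup>2 / (64 * x)) * V (t (Suc (2 * k))) powr p"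
      using v c x pq by (intro mult_left_mono powr_mono2) auto
    finally show "K / D ^ k * a k powr (p * q) \<le> a (Suc k)" using u by linarith
  qed (use D1 U0 a0 in auto)
  then show ?thesis by (simp add: K_def D_def a0)
qed

text \<open>The left-hand side of the iteration criterion is a constant times (\<epsilon>
  L^F)^\<theta> with \<theta> = p(pq-1). Both roots needed to isolate \<open>L\<close> are available
  because \<theta> and \<open>F\<close> are positive.\<close>

lemma lifespan_bound_numeric:
  fixes p q n F c1 c2 c3 \<sigma> :: real
  assumes pq: "1 < p" "1 < q" and c: "0 < c1" "0 < c2" "0 < c3" and \<sigma>: "0 < \<sigma>"
    and F: "F = (q + 2 + inverse p) / (p * q - 1) - (n - 1) / 2" "0 < F"
  shows "\<exists>C>0. \<forall>\<epsilon>>0. \<forall>L>0.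
    (c1 * L powr (- n * (p - 1))) * (c2 * L powr (- n * (q - 1))) powr p * L powr (2 + 2 * p) / 2 powr (6 + 4 * p)
      * (c3 * \<epsilon> powr p * L powr (n + 1 - (n - 1) * p / 2)) powr (p * q - 1) < \<sigma>
    \<longrightarrow> L \<le> C * \<epsilon> powr (- inverse F)"
proof -
  define \<theta> where "\<theta> = p * (p * q - 1)"
  have pq1: "1 < p * q" using pq by (metis less_1_mult)
  then have \<theta>: "0 < \<theta>" using pq by (simp add: \<theta>_def)
  define c4 where "c4 = c1 * c2 powr p / 2 powr (6 + 4 * p) * c3 powr (p * q - 1)"
  have c4: "0 < c4" using c by (simp add: c4_def)
  define C where "C = ((\<sigma> / c4) powr (1 / \<theta>)) powr (1 / F)"
  \<comment> \<open>The summands are, in order: the Hoelder loss for \<open>U\<close>, that for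
    \<open>V\<close> raised to \<open>p\<close>, the two squared time gaps, and the starting value
    raised to pq-1.\<close>
  have ex: "- n * (p - 1) + (- n * (q - 1)) * p + (2 + 2 * p) + (n + 1 - (n - 1) * p / 2) * (p * q - 1) = F * \<theta>"
  proof -
    have "F * \<theta> = p * (q + 2 + inverse p) - (n - 1) / 2 * \<theta>"
      using pq1 by (simp add: F(1) \<theta>_def left_diff_distrib)
    also have "p * (q + 2 + inverse p) = p * q + 2 * p + 1" using pq by (simp add: algebra_simps)
    finally show ?thesis unfolding \<theta>_def by (simp add: algebra_simps)
  qed
  have "L \<le> C * \<epsilon> powr (- inverse F)" if \<epsilon>: "\<epsilon> > 0" and L: "L > 0" and less:
    "(c1 * L powr (- n * (p - 1))) * (c2 * L powr (- n * (q - 1))) powr p * L powr (2 + 2 * p) / 2 powr (6 + 4 * p)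
      * (c3 * \<epsilon> powr p * L powr (n + 1 - (n - 1) * p / 2)) powr (p * q - 1) < \<sigma>" for \<epsilon> L
  proof -
    have "(c1 * L powr (- n * (p - 1))) * (c2 * L powr (- n * (q - 1))) powr p * L powr (2 + 2 * p) / 2 powr (6 + 4 * p)
      * (c3 * \<epsilon> powr p * L powr (n + 1 - (n - 1) * p / 2)) powr (p * q - 1)
      = (c1 * L powr (- n * (p - 1))) * (c2 powr p * L powr ((- n * (q - 1)) * p)) * L powr (2 + 2 * p) / 2 powr (6 + 4 * p)
      * (c3 powr (p * q - 1) * \<epsilon> powr \<theta> * L powr ((n + 1 - (n - 1) * p / 2) * (p * q - 1)))"
      using c by (simp only: powr_mult powr_powr \<theta>_def)
    also have "\<dots> = c4 * \<epsilon> powr \<theta> * (L powr (- n * (p - 1)) * L powr ((- n * (q - 1)) * p) * L powr (2 + 2 * p)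
        * L powr ((n + 1 - (n - 1) * p / 2) * (p * q - 1)))"
      unfolding c4_def by (simp only: divide_inverse ac_simps)
    also have "\<dots> = c4 * \<epsilon> powr \<theta> * L powr (F * \<theta>)"
      by (simp only: ex powr_add[symmetric])
    also have "\<dots> = c4 * (\<epsilon> * L powr F) powr \<theta>"
      using \<epsilon> L by (simp add: powr_mult powr_powr)
    finally have "(\<epsilon> * L powr F) powr \<theta> < \<sigma> / c4" using less c4 by (simp add: field_simps)
    then have "((\<epsilon> * L powr F) powr \<theta>) powr (1 / \<theta>) \<le> (\<sigma> / c4) powr (1 / \<theta>)"
      using \<theta> by (intro powr_mono2) auto
    then have "L powr F \<le> (\<sigma> / c4) powr (1 / \<theta>) / \<epsilon>"
      using \<theta> \<epsilon> L by (simp add: powr_powr field_simps)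
    then have "(L powr F) powr (1 / F) \<le> ((\<sigma> / c4) powr (1 / \<theta>) / \<epsilon>) powr (1 / F)"
      using F(2) by (intro powr_mono2) auto
    moreover have "(A / \<epsilon>) powr (1 / F) = A powr (1 / F) * \<epsilon> powr (- inverse F)" for A
      by (simp only: divide_inverse powr_mult inverse_powr powr_minus mult_1_left)
    moreover have "(L powr F) powr (1 / F) = L" using F(2) L by (simp add: powr_powr)
    ultimately show ?thesis by (simp only: C_def)
  qed
  moreover have "C > 0" using c4 \<sigma> by (simp add: C_def)
  ultimately show ?thesis by blast
qed

section \<open>Functions driven by an accumulated source\<close>

text \<open>What is left of the equation for a mass after the damping has been absorbed into
  \<open>c\<close>. The derivative stays anonymous, since only the growth of \<open>U\<close> is
  used afterwards.\<close>

definition driven :: "real \<Rightarrow> real \<Rightarrow> (real \<Rightarrow> real) \<Rightarrow> (real \<Rightarrow> real) \<Rightarrow> bool" where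
  "driven L c U g \<longleftrightarrow> 0 \<le> U 0 \<and> g integrable_on {0..L} \<and> (\<forall>s. 0 \<le> g s) \<and>
     (\<exists>P. \<forall>t\<in>{0..L}. (U has_real_derivative P t) (at t within {0..L}) \<and> c * integral {0..t} g \<le> P t)"

text \<open>Two integrations: a source of size \<gamma> from time \<open>s\<close> on makes the
  derivative at least c \<gamma> (r - s). The lower bound is allowed to fail on a null set because
  the nonlinear terms are controlled only at almost every time.\<close>

lemma driven_quadratic_growth:
  assumes U: "driven L c U g" and c: "0 < c" and t: "0 \<le> s" "s \<le> t" "t \<le> L"
    and \<gamma>: "AE r in lebesgue. r \<in> {s..t} \<longrightarrow> \<gamma> \<le> g r"
  shows "U s + c * \<gamma> / 2 * (t - s)\<^sup>2 \<le> U t"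
proof -
  obtain P where g: "g integrable_on {0..L}" "\<And>s. 0 \<le> g s"
    and P: "\<And>t. t \<in> {0..L} \<Longrightarrow> (U has_real_derivative P t) (at t within {0..L})"
      "\<And>t. t \<in> {0..L} \<Longrightarrow> c * integral {0..t} g \<le> P t"
    using U unfolding driven_def by blast
  have int: "g integrable_on {a..b}" if "0 \<le> a" "b \<le> L" for a b
    using integrable_on_subinterval[OF g(1)] that by auto
  obtain N where N: "\<And>r. r \<in> space lebesgue - N \<Longrightarrow> r \<in> {s..t} \<longrightarrow> \<gamma> \<le> g r" "N \<in> null_sets lebesgue"
    using AE_E3[OF \<gamma>] by blast
  have neg: "negligible N" using N(2) by (simp add: negligible_iff_null_sets)
  have low: "\<gamma> * (r - s) \<le> integral {0..r} g" if r: "r \<in> {s..t}" for r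
  proof -
    \<comment> \<open>The source is altered on the exceptional null set, so that the lower bound
      holds everywhere while the integrals stay the same.\<close>
    define g' where "g' x = (if x \<in> N then \<gamma> else g x)" for x
    have "integral {s..r} (\<lambda>_. \<gamma>) \<le> integral {s..r} g'"
    proof (rule integral_le)
      show "g' integrable_on {s..r}"
        by (rule integrable_spike[OF int neg]) (use t r in \<open>auto simp: g'_def\<close>)
      show "\<gamma> \<le> g' x" if "x \<in> {s..r}" for x
        using that r N(1) by (auto simp: g'_def)
    qed (rule integrable_const_ivl)
    also have "integral {s..r} g' = integral {s..r} g"
      by (rule integral_spike[OF neg]) (auto simp: g'_def)
    also have "\<dots> \<le> integral {0..r} g"
      by (rule integral_subset_le) (use t r int g in auto)
    finally show ?thesis using r by (simp add: mult.commute)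
  qed
  have "U s - c * \<gamma> / 2 * (s - s)\<^sup>2 \<le> U t - c * \<gamma> / 2 * (t - s)\<^sup>2"
  proof (rule nondecreasing_within[OF t(2)])
    fix r assume r: "r \<in> {s..t}"
    then have rL: "r \<in> {0..L}" using t by auto
    have 1: "(U has_real_derivative P r) (at r within {s..t})"
      by (rule has_field_derivative_subset[OF P(1)[OF rL]]) (use t in auto)
    show "((\<lambda>r. U r - c * \<gamma> / 2 * (r - s)\<^sup>2) has_real_derivative P r - c * (\<gamma> * (r - s))) (at r within {s..t})"
      by (rule derivative_eq_intros 1 refl)+ simp
    have "c * (\<gamma> * (r - s)) \<le> c * integral {0..r} g" using low[OF r] c by simp
    then show "0 \<le> P r - c * (\<gamma> * (r - s))" using P(2)[OF rL] by linarith
  qed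
  then show ?thesis by simp
qed

lemma driven_mono:
  assumes "driven L c U g" "0 < c" "0 \<le> s" "s \<le> t" "t \<le> L"
  shows "U s \<le> U t"
  using driven_quadratic_growth[OF assms, of 0] assms(1) by (simp add: driven_def)

lemma driven_nonneg:
  assumes "driven L c U g" "0 < c" "0 \<le> t" "t \<le> L"
  shows "0 \<le> U t"
  using driven_mono[OF assms(1,2) _ assms(3,4)] assms(1) unfolding driven_def by auto

text \<open>On [s,t] the weight is bounded below by putting 2L for 1 + r, and \<open>V\<close> by
  its value at \<open>s\<close>, since \<open>V\<close> is nondecreasing; the source thus exceeds a
  constant.\<close>

lemma driven_coupling:
  assumes U: "driven L c U g" and V: "driven L c V h" and c: "0 < c" and n: "0 \<le> n" and p: "1 < p"
    and g: "AE r in lebesgue. r \<in> {0..L} \<longrightarrow> c * (1 + r) powr (- n * (p - 1)) * V r powr p \<le> g r"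
    and L: "1 \<le> L" and st: "0 \<le> s" "s < t" "t \<le> L"
  shows "c * c * 2 powr (- n * (p - 1)) / 2 * L powr (- n * (p - 1)) * (t - s)\<^sup>2 * V s powr p \<le> U t"
proof -
  define \<gamma> where "\<gamma> = c * (2 powr (- n * (p - 1)) * L powr (- n * (p - 1))) * V s powr p"
  have "AE r in lebesgue. r \<in> {s..t} \<longrightarrow> \<gamma> \<le> g r"
    using g
  proof eventually_elim
    case (elim r)
    show ?case
    proof
      assume r: "r \<in> {s..t}"
      have "(2 * L) powr (- n * (p - 1)) \<le> (1 + r) powr (- n * (p - 1))"
        using r st L n p by (intro powr_mono2') (auto simp: mult_nonneg_nonneg)
      then have "2 powr (- n * (p - 1)) * L powr (- n * (p - 1)) \<le> (1 + r) powr (- n * (p - 1))"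
        using L by (simp add: powr_mult)
      moreover have "V s powr p \<le> V r powr p"
        using driven_mono[OF V c, of s r] driven_nonneg[OF V c, of s] r st p by (intro powr_mono2) auto
      ultimately have "\<gamma> \<le> c * (1 + r) powr (- n * (p - 1)) * V r powr p"
        unfolding \<gamma>_def using c by (intro mult_mono) auto
      also have "\<dots> \<le> g r" using elim r st by auto
      finally show "\<gamma> \<le> g r" .
    qed
  qed
  from driven_quadratic_growth[OF U c _ _ _ this] st
  have "U s + c * \<gamma> / 2 * (t - s)\<^sup>2 \<le> U t" by simp
  moreover have "0 \<le> U s" using driven_nonneg[OF U c, of s] st by auto
  moreover have "c * \<gamma> / 2 * (t - s)\<^sup>2 =
      c * c * 2 powr (- n * (p - 1)) / 2 * L powr (- n * (p - 1)) * (t - s)\<^sup>2 * V s powr p"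
    by (simp add: \<gamma>_def)
  ultimately show ?thesis by linarith
qed

text \<open>The window [L/4, L/2] begins after time 1, and on it 1 + r lies between L/4 and 4L;
  \<open>4 powr (- \<bar>\<beta>\<bar>)\<close> covers both signs of \<beta>. The 32 is twice the 16
  from the squared window length.\<close>

lemma driven_initial_growth:
  assumes U: "driven L c U g" and c: "0 < c" "0 < \<epsilon>" and L: "4 \<le> L"
    and g: "AE r in lebesgue. r \<in> {1..L} \<longrightarrow> c * \<epsilon> powr p * (1 + r) powr \<beta> \<le> g r"
  shows "c * c * 4 powr (- \<bar>\<beta>\<bar>) / 32 * \<epsilon> powr p * L powr (\<beta> + 2) \<le> U (L / 2)"
proof -
  define \<gamma> where "\<gamma> = c * \<epsilon> powr p * (4 powr (- \<bar>\<beta>\<bar>) * L powr \<beta>)"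
  have "AE r in lebesgue. r \<in> {L / 4..L / 2} \<longrightarrow> \<gamma> \<le> g r"
    using g
  proof eventually_elim
    case (elim r)
    show ?case
    proof
      assume r: "r \<in> {L / 4..L / 2}"
      have "4 powr (- \<bar>\<beta>\<bar>) * L powr \<beta> \<le> (1 + r) powr \<beta>"
      proof (cases "0 \<le> \<beta>")
        case True
        then have "(L / 4) powr \<beta> \<le> (1 + r) powr \<beta>" using r L by (intro powr_mono2) auto
        moreover have "(L / 4) powr \<beta> = L powr \<beta> * 4 powr (- \<beta>)"
          by (simp only: divide_inverse powr_mult inverse_powr powr_minus)
        ultimately show ?thesis using True by (simp add: mult.commute)
      next
        case False
        then have "(4 * L) powr \<beta> \<le> (1 + r) powr \<beta>" using r L by (intro powr_mono2') auto
        then show ?thesis using False L by (simp add: powr_mult)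
      qed
      then have "\<gamma> \<le> c * \<epsilon> powr p * (1 + r) powr \<beta>"
        unfolding \<gamma>_def using c by (intro mult_left_mono) auto
      also have "\<dots> \<le> g r" using elim r L by auto
      finally show "\<gamma> \<le> g r" .
    qed
  qed
  from driven_quadratic_growth[OF U c(1) _ _ _ this] L
  have "U (L / 4) + c * \<gamma> / 2 * (L / 2 - L / 4)\<^sup>2 \<le> U (L / 2)" by simp
  moreover have "0 \<le> U (L / 4)" using driven_nonneg[OF U c(1), of "L / 4"] L by auto
  moreover have "c * \<gamma> / 2 * (L / 2 - L / 4)\<^sup>2 = c * c * 4 powr (- \<bar>\<beta>\<bar>) / 32 * \<epsilon> powr p * L powr (\<beta> + 2)"
  proof -
    have "(L / 2 - L / 4)\<^sup>2 = L powr 2 / 16" using L by (simp add: power2_eq_square)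
    then show ?thesis by (simp add: \<gamma>_def powr_add)
  qed
  ultimately show ?thesis by linarith
qed

lemma coupled_lifespan_bound:
  fixes p q n c F :: real
  assumes pq: "1 < p" "1 < q" and c: "0 < c" and n: "1 \<le> n"
    and F: "F = (q + 2 + inverse p) / (p * q - 1) - (n - 1) / 2" "0 < F"
  shows "\<exists>C>0. \<forall>\<epsilon> L U V g h. 0 < \<epsilon> \<and> \<epsilon> \<le> 1 \<and> 0 \<le> L \<and> driven L c U g \<and> driven L c V h \<and>
      (AE r in lebesgue. r \<in> {0..L} \<longrightarrow> c * (1 + r) powr (- n * (p - 1)) * V r powr p \<le> g r) \<and>
      (AE r in lebesgue. r \<in> {0..L} \<longrightarrow> c * (1 + r) powr (- n * (q - 1)) * U r powr q \<le> h r) \<and>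
      (AE r in lebesgue. r \<in> {1..L} \<longrightarrow> c * \<epsilon> powr p * (1 + r) powr ((n - 1) * (1 - p / 2)) \<le> g r)
      \<longrightarrow> L \<le> C * \<epsilon> powr (- inverse F)"
proof -
  define \<beta> where "\<beta> = (n - 1) * (1 - p / 2)"
  define c1 where "c1 = c * c * 2 powr (- n * (p - 1)) / 2"
  define c2 where "c2 = c * c * 2 powr (- n * (q - 1)) / 2"
  define c3 where "c3 = c * c * 4 powr (- \<bar>\<beta>\<bar>) / 32"
  have cs: "0 < c1" "0 < c2" "0 < c3" using c by (auto simp: c1_def c2_def c3_def)
  define \<sigma> where "\<sigma> = max 2 ((16 * 16 powr p) powr (1 / (p * q - 1)))"
  have "0 < \<sigma>" by (simp add: \<sigma>_def less_max_iff_disj)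
  from lifespan_bound_numeric[OF pq cs this F] obtain C where C: "C > 0" and bound:
    "\<And>\<epsilon> L. \<epsilon> > 0 \<Longrightarrow> L > 0 \<Longrightarrow>
      (c1 * L powr (- n * (p - 1))) * (c2 * L powr (- n * (q - 1))) powr p * L powr (2 + 2 * p) / 2 powr (6 + 4 * p)
        * (c3 * \<epsilon> powr p * L powr (n + 1 - (n - 1) * p / 2)) powr (p * q - 1) < \<sigma>
      \<Longrightarrow> L \<le> C * \<epsilon> powr (- inverse F)" by blast
  have "L \<le> max C 4 * \<epsilon> powr (- inverse F)"
    if \<epsilon>: "0 < \<epsilon>" "\<epsilon> \<le> 1" and L0: "0 \<le> L" and U: "driven L c U g" and V: "driven L c V h"
      and g: "AE r in lebesgue. r \<in> {0..L} \<longrightarrow> c * (1 + r) powr (- n * (p - 1)) * V r powr p \<le> g r"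
      and h: "AE r in lebesgue. r \<in> {0..L} \<longrightarrow> c * (1 + r) powr (- n * (q - 1)) * U r powr q \<le> h r"
      and g1: "AE r in lebesgue. r \<in> {1..L} \<longrightarrow> c * \<epsilon> powr p * (1 + r) powr ((n - 1) * (1 - p / 2)) \<le> g r"
    for \<epsilon> L U V g h
  proof (cases "L \<le> 4")
    \<comment> \<open>Short times need no iteration: \<epsilon> \<le> 1 makes the power of
      \<epsilon> at least 1, so the constant 4 is enough.\<close>
    case True
    have "1 powr inverse F \<le> (inverse \<epsilon>) powr inverse F"
      using \<epsilon> F(2) by (intro powr_mono2) (auto simp: one_le_inverse_iff)
    then have "1 \<le> \<epsilon> powr (- inverse F)"
      using \<epsilon> by (simp add: powr_minus inverse_powr)
    then have "4 * 1 \<le> max C 4 * \<epsilon> powr (- inverse F)"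
      by (intro mult_mono) auto
    with True show ?thesis by simp
  next
    case False
    then have L: "4 \<le> L" by simp
    have low: "c3 * \<epsilon> powr p * L powr (\<beta> + 2) \<le> U (L / 2)"
      unfolding c3_def by (rule driven_initial_growth[OF U c \<epsilon>(1) L g1[folded \<beta>_def]])
    have pos: "0 < c3 * \<epsilon> powr p * L powr (\<beta> + 2)" using cs \<epsilon> L by simp
    have \<beta>: "\<beta> + 2 = n + 1 - (n - 1) * p / 2" by (simp add: \<beta>_def algebra_simps)
    have pq1: "1 < p * q" using pq by (metis less_1_mult)
    have "(c1 * L powr (- n * (p - 1))) * (c2 * L powr (- n * (q - 1))) powr p * L powr (2 + 2 * p) / 2 powr (6 + 4 * p)
        * (c3 * \<epsilon> powr p * L powr (\<beta> + 2)) powr (p * q - 1) \<le>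
      (c1 * L powr (- n * (p - 1))) * (c2 * L powr (- n * (q - 1))) powr p * L powr (2 + 2 * p) / 2 powr (6 + 4 * p)
        * U (L / 2) powr (p * q - 1)"
      using low pos cs pq1 by (intro mult_left_mono powr_mono2) auto
    also have "\<dots> < \<sigma>"
      unfolding \<sigma>_def
    \<comment> \<open>The upper bound that a large starting value would violate is the finite value
      of the nondecreasing \<open>U\<close> at \<open>L\<close>.\<close>
    proof (rule coupled_iteration[OF pq, where V=V and B="U L"])
      fix s t assume st: "L / 2 \<le> s" "s < t" "t \<le> L"
      show "c1 * L powr (- n * (p - 1)) * (t - s)\<^sup>2 * V s powr p \<le> U t"
        unfolding c1_def using n L st by (intro driven_coupling[OF U V c _ pq(1) g]) auto
      show "c2 * L powr (- n * (q - 1)) * (t - s)\<^sup>2 * U s powr q \<le> V t"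
        unfolding c2_def using n L st by (intro driven_coupling[OF V U c _ pq(2) h]) auto
    next
      show "U t \<le> U L" if "L / 2 \<le> t" "t \<le> L" for t
        using driven_mono[OF U c, of t L] that L by auto
    qed (use L cs low pos in auto)
    finally have "L \<le> C * \<epsilon> powr (- inverse F)" using bound[OF \<epsilon>(1), of L] L unfolding \<beta> by simp
    also have "\<dots> \<le> max C 4 * \<epsilon> powr (- inverse F)" by (intro mult_right_mono) auto
    finally show ?thesis .
  qed
  moreover have "max C 4 > 0" by simp
  ultimately show ?thesis by blast
qed

subsection \<open>Lebesgue integration\<close>

text \<open>Lebesgue measure is complete, so \<open>f\<close> inherits measurability from
  \<open>g\<close>. This suits slices that are determined only up to null sets.\<close>

lemma integrable_lebesgue_cong_AE:
  fixes f g :: "'a::euclidean_space \<Rightarrow> 'b::euclidean_space"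
  assumes "integrable lebesgue g" "AE x in lebesgue. f x = g x"
  shows "integrable lebesgue f" "integral\<^sup>L lebesgue f = integral\<^sup>L lebesgue g"
proof -
  obtain N where N: "\<And>x. x \<in> space lebesgue - N \<Longrightarrow> f x = g x" "N \<in> null_sets lebesgue"
    using AE_E3[OF assms(2)] by blast
  have "f absolutely_integrable_on UNIV"
    by (rule absolutely_integrable_spike[where f=g and T=UNIV and S=N])
       (use N assms(1) in \<open>auto simp: negligible_iff_null_sets set_integrable_def\<close>)
  then show f: "integrable lebesgue f" by (simp add: set_integrable_def)
  show "integral\<^sup>L lebesgue f = integral\<^sup>L lebesgue g"
    by (rule integral_cong_AE[OF borel_measurable_integrable[OF f] borel_measurable_integrable[OF assms(1)] assms(2)])
qed

text \<open>Lebesgue measure on a product is the completion of the Borel product, not the product of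
  the completions; null sets are therefore sliced at Borel level and the result is transferred
  back.\<close>

lemma AE_lebesgue_prodD:
  assumes "AE z in (lebesgue :: ('a::euclidean_space \<times> 'b::euclidean_space) measure). P z"
  shows "AE s in lebesgue. AE x in lebesgue. P (s, x)"
proof -
  have "AE z in (lborel \<Otimes>\<^sub>M lborel :: ('a \<times> 'b) measure). P z"
    using assms unfolding lborel_prod AE_completion_iff .
  from lborel_pair.AE_pair[OF this] show ?thesis
    by (simp add: AE_completion_iff)
qed

text \<open>Fubini is applied to a Borel representative. Its slices agree with those of
  \<open>f\<close> for almost every \<open>s\<close> only, which is why slices are integrable almost
  everywhere in \<open>s\<close>.\<close>

lemma lebesgue_Fubini_integrable:
  fixes f :: "'a::euclidean_space \<times> 'b::euclidean_space \<Rightarrow> real"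
  assumes f: "integrable lebesgue f"
  shows "AE s in lebesgue. integrable lebesgue (\<lambda>x. f (s, x))"
    and "integrable lebesgue (\<lambda>s. LINT x|lebesgue. f (s, x))"
proof -
  obtain f' where f': "f' \<in> borel_measurable lborel" "AE z in lborel. f z = f' z"
    using completion_ex_borel_measurable_real[OF borel_measurable_integrable[OF f]] by blast
  have eq: "AE s in lebesgue. AE x in lebesgue. f (s, x) = f' (s, x)"
    by (rule AE_lebesgue_prodD) (use f'(2) in \<open>simp add: AE_completion_iff\<close>)
  have "integrable lebesgue f'"
    by (rule integrable_lebesgue_cong_AE(1)[OF f]) (use f'(2) in \<open>auto simp: AE_completion_iff\<close>)
  then have i: "integrable (lborel \<Otimes>\<^sub>M lborel) f'"
    using f'(1) by (simp add: integrable_completion lborel_prod)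
  have "AE s in lebesgue. integrable lborel (\<lambda>x. f' (s, x))"
    using lborel_pair.AE_integrable_fst'[OF i] by (simp add: AE_completion_iff)
  then have int': "AE s in lebesgue. integrable lebesgue (\<lambda>x. f' (s, x))"
    by eventually_elim (simp add: integrable_completion borel_measurable_integrable)
  show "AE s in lebesgue. integrable lebesgue (\<lambda>x. f (s, x))"
    using eq int' by eventually_elim (rule integrable_lebesgue_cong_AE(1))
  have m: "(\<lambda>x. f' (s, x)) \<in> borel_measurable lborel" for s
    using f'(1) by (simp add: lborel_prod[symmetric])
  have "integrable lborel (\<lambda>s. LINT x|lborel. f' (s, x))"
    by (rule lborel_pair.integrable_fst'[OF i])
  then have "integrable lebesgue (\<lambda>s. LINT x|lborel. f' (s, x))"
    by (simp add: integrable_completion borel_measurable_integrable)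
  then show "integrable lebesgue (\<lambda>s. LINT x|lebesgue. f (s, x))"
  proof (rule integrable_lebesgue_cong_AE(1))
    show "AE s in lebesgue. (LINT x|lebesgue. f (s, x)) = (LINT x|lborel. f' (s, x))"
      using eq int'
    proof eventually_elim
      case (elim s)
      then have "(LINT x|lebesgue. f (s, x)) = (LINT x|lebesgue. f' (s, x))"
        by (intro integrable_lebesgue_cong_AE(2))
      then show ?case using m by (simp add: integral_completion)
    qed
  qed
qed

subsection \<open>The space $L^2$\<close>

lemma L2_measurable: "f \<in> L2 \<Longrightarrow> f \<in> borel_measurable lebesgue"
  and L2_square_integrable: "f \<in> L2 \<Longrightarrow> integrable lebesgue (\<lambda>x. (norm (f x))\<^sup>2)"
  by (auto simp: L2_def)

lemma L2_mult_integrable: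
  fixes f g :: "'a::euclidean_space \<Rightarrow> real"
  assumes "f \<in> L2" "g \<in> L2"
  shows "integrable lebesgue (\<lambda>x. f x * g x)"
proof (rule Bochner_Integration.integrable_bound)
  show "integrable lebesgue (\<lambda>x. (norm (f x))\<^sup>2 + (norm (g x))\<^sup>2)"
    using assms by (intro Bochner_Integration.integrable_add L2_square_integrable)
  show "(\<lambda>x. f x * g x) \<in> borel_measurable lebesgue"
    using assms by (intro borel_measurable_times L2_measurable)
  have "\<bar>a * b\<bar> \<le> a\<^sup>2 + b\<^sup>2" for a b :: real
  proof -
    have "2 * \<bar>a * b\<bar> \<le> a\<^sup>2 + b\<^sup>2"
      using sum_squares_bound[of "\<bar>a\<bar>" "\<bar>b\<bar>"] by (simp add: abs_mult mult.assoc)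
    then show ?thesis using abs_ge_zero[of "a * b"] by linarith
  qed
  then show "AE x in lebesgue. norm (f x * g x) \<le> norm ((norm (f x))\<^sup>2 + (norm (g x))\<^sup>2)"
    by simp
qed

lemma L2_diff:
  fixes f g :: "'a::euclidean_space \<Rightarrow> real"
  assumes "f \<in> L2" "g \<in> L2"
  shows "(\<lambda>x. f x - g x) \<in> L2"
proof -
  have "integrable lebesgue (\<lambda>x. (norm (f x))\<^sup>2 + (norm (g x))\<^sup>2 - 2 * (f x * g x))"
    using assms by (intro Bochner_Integration.integrable_add Bochner_Integration.integrable_diff
        integrable_mult_right L2_square_integrable L2_mult_integrable)
  then have "integrable lebesgue (\<lambda>x. (norm (f x - g x))\<^sup>2)"
    by (simp add: power2_diff mult.assoc algebra_simps)
  then show ?thesis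
    using assms by (auto simp: L2_def)
qed

lemma L2_cmult:
  fixes f :: "'a::euclidean_space \<Rightarrow> real"
  assumes "f \<in> L2"
  shows "(\<lambda>x. c * f x) \<in> L2"
proof -
  have "integrable lebesgue (\<lambda>x. c\<^sup>2 * (norm (f x))\<^sup>2)"
    using assms by (intro integrable_mult_right L2_square_integrable)
  then show ?thesis using assms by (auto simp: L2_def power_mult_distrib)
qed

lemma L2_norm_nonneg: "0 \<le> L2_norm f"
  by (simp add: L2_norm_def)

lemma L2_norm_power2: "(L2_norm f)\<^sup>2 = (LINT x|lebesgue. (norm (f x))\<^sup>2)"
  by (simp add: L2_norm_def)

text \<open>With B the squared norm of \<open>g\<close> and b the pairing, integrating the square of
  B f - b g gives B (A B - b^2) \<ge> 0. If B = 0, the product vanishes almost everywhere.\<close>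

lemma L2_Cauchy_Schwarz:
  fixes f g :: "'a::euclidean_space \<Rightarrow> real"
  assumes f: "f \<in> L2" and g: "g \<in> L2"
  shows "\<bar>LINT x|lebesgue. f x * g x\<bar> \<le> L2_norm f * L2_norm g"
proof -
  define A where "A = (LINT x|lebesgue. (f x)\<^sup>2)"
  define B where "B = (LINT x|lebesgue. (g x)\<^sup>2)"
  define b where "b = (LINT x|lebesgue. f x * g x)"
  have iA: "integrable lebesgue (\<lambda>x. (f x)\<^sup>2)" and iB: "integrable lebesgue (\<lambda>x. (g x)\<^sup>2)"
    using L2_square_integrable[OF f] L2_square_integrable[OF g] by simp_all
  have ib: "integrable lebesgue (\<lambda>x. f x * g x)" by (rule L2_mult_integrable[OF f g])
  have nn: "0 \<le> A" "0 \<le> B" by (auto simp: A_def B_def)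
  have "b\<^sup>2 \<le> A * B"
  proof (cases "B = 0")
    case True
    have "AE x in lebesgue. (g x)\<^sup>2 = 0"
      using integral_nonneg_eq_0_iff_AE[OF iB] True by (simp add: B_def)
    then have "AE x in lebesgue. f x * g x = 0" by eventually_elim simp
    then have "b = 0" unfolding b_def by (rule integral_eq_zero_AE)
    then show ?thesis using nn by simp
  next
    case False
    have "0 \<le> (LINT x|lebesgue. (B * f x - b * g x)\<^sup>2)" by simp
    also have "(\<lambda>x. (B * f x - b * g x)\<^sup>2) = (\<lambda>x. B\<^sup>2 * (f x)\<^sup>2 - 2 * B * b * (f x * g x) + b\<^sup>2 * (g x)\<^sup>2)"
      by (auto simp: power2_eq_square algebra_simps)
    also have "(LINT x|lebesgue. B\<^sup>2 * (f x)\<^sup>2 - 2 * B * b * (f x * g x) + b\<^sup>2 * (g x)\<^sup>2)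
        = B\<^sup>2 * A - 2 * B * b * b + b\<^sup>2 * B"
      using iA iB ib by (simp add: A_def B_def b_def)
    also have "\<dots> = B * (A * B - b\<^sup>2)" by (simp add: power2_eq_square algebra_simps)
    finally show ?thesis using nn False by (simp add: zero_le_mult_iff)
  qed
  then have "sqrt (b\<^sup>2) \<le> sqrt (A * B)" by (rule real_sqrt_le_mono)
  then show ?thesis by (simp add: real_sqrt_mult L2_norm_def A_def B_def b_def)
qed

lemma L2_pairing_tendsto:
  fixes w :: "real \<Rightarrow> 'a::euclidean_space \<Rightarrow> real"
  assumes lim: "((\<lambda>s. L2_norm (\<lambda>x. w s x - f x)) \<longlongrightarrow> 0) F"
    and w: "\<forall>\<^sub>F s in F. w s \<in> L2" and f: "f \<in> L2" and \<theta>: "\<theta> \<in> L2"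
  shows "((\<lambda>s. LINT x|lebesgue. w s x * \<theta> x) \<longlongrightarrow> (LINT x|lebesgue. f x * \<theta> x)) F"
proof (rule LIM_zero_cancel, rule Lim_null_comparison)
  show "\<forall>\<^sub>F s in F. norm ((LINT x|lebesgue. w s x * \<theta> x) - (LINT x|lebesgue. f x * \<theta> x))
      \<le> L2_norm (\<lambda>x. w s x - f x) * L2_norm \<theta>"
    using w
  proof eventually_elim
    case (elim s)
    have "(LINT x|lebesgue. w s x * \<theta> x) - (LINT x|lebesgue. f x * \<theta> x) = (LINT x|lebesgue. (w s x - f x) * \<theta> x)"
      using elim f \<theta> by (simp add: L2_mult_integrable left_diff_distrib)
    then show ?case using L2_Cauchy_Schwarz[OF L2_diff[OF elim f] \<theta>] by simp
  qed
  show "((\<lambda>s. L2_norm (\<lambda>x. w s x - f x) * L2_norm \<theta>) \<longlongrightarrow> 0) F"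
    using tendsto_mult_right[OF lim] by simp
qed

text \<open>The integral of f^2 over \<open>A\<close> is at most the squared distance from
  \<open>f\<close> to any \<open>w s\<close> that vanishes on \<open>A\<close>. Such indices merely
  have to recur along the filter, and that is all an almost-everywhere statement in time can
  supply.\<close>

lemma L2_limit_vanishes:
  fixes w :: "real \<Rightarrow> 'a::euclidean_space \<Rightarrow> real"
  assumes lim: "((\<lambda>s. L2_norm (\<lambda>x. w s x - f x)) \<longlongrightarrow> 0) F"
    and w: "\<exists>\<^sub>F s in F. w s \<in> L2 \<and> (AE x in lebesgue. x \<in> A \<longrightarrow> w s x = 0)"
    and f: "f \<in> L2" and A: "A \<in> sets lebesgue"
  shows "AE x in lebesgue. x \<in> A \<longrightarrow> f x = 0"
proof -
  let ?h = "\<lambda>x. indicator A x * (f x)\<^sup>2"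
  have iA: "integrable lebesgue ?h"
    using integrable_mult_indicator[OF A L2_square_integrable[OF f]] by simp
  define c where "c = integral\<^sup>L lebesgue ?h"
  have le: "c \<le> (L2_norm (\<lambda>x. w s x - f x))\<^sup>2" if "w s \<in> L2" "AE x in lebesgue. x \<in> A \<longrightarrow> w s x = 0" for s
  proof -
    have "c \<le> (LINT x|lebesgue. (norm (w s x - f x))\<^sup>2)"
      unfolding c_def
    proof (rule integral_mono_AE[OF iA L2_square_integrable[OF L2_diff[OF that(1) f]]])
      show "AE x in lebesgue. indicator A x * (f x)\<^sup>2 \<le> (norm (w s x - f x))\<^sup>2"
        using that(2) by eventually_elim (auto simp: indicator_def)
    qed
    then show ?thesis by (simp only: L2_norm_power2)
  qed
  have c0: "0 \<le> c" unfolding c_def by (rule Bochner_Integration.integral_nonneg) auto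
  have "c = 0"
  proof (rule ccontr)
    assume "c \<noteq> 0"
    with c0 have "0 < sqrt c" by simp
    with lim have "\<forall>\<^sub>F s in F. L2_norm (\<lambda>x. w s x - f x) < sqrt c" by (rule order_tendstoD(2))
    then have "\<forall>\<^sub>F s in F. w s \<in> L2 \<and> (AE x in lebesgue. x \<in> A \<longrightarrow> w s x = 0) \<longrightarrow>
        (w s \<in> L2 \<and> (AE x in lebesgue. x \<in> A \<longrightarrow> w s x = 0)) \<and> L2_norm (\<lambda>x. w s x - f x) < sqrt c"
      by eventually_elim blast
    from frequently_rev_mp[OF w this]
    have "\<exists>\<^sub>F s in F. (w s \<in> L2 \<and> (AE x in lebesgue. x \<in> A \<longrightarrow> w s x = 0)) \<and> L2_norm (\<lambda>x. w s x - f x) < sqrt c" .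
    then obtain s where s: "w s \<in> L2" "AE x in lebesgue. x \<in> A \<longrightarrow> w s x = 0" "L2_norm (\<lambda>x. w s x - f x) < sqrt c"
      by (metis (mono_tags, lifting) frequently_ex)
    have "(L2_norm (\<lambda>x. w s x - f x))\<^sup>2 < (sqrt c)\<^sup>2"
      using s(3) L2_norm_nonneg by (intro power_strict_mono) auto
    with le[OF s(1,2)] c0 show False by simp
  qed
  then have "AE x in lebesgue. ?h x = 0"
    using integral_nonneg_eq_0_iff_AE[OF iA] by (simp add: c_def)
  then show ?thesis by eventually_elim (auto simp: indicator_def split: if_splits)
qed

text \<open>The complement is a union of open sets on each of which \<open>f\<close> vanishes almost
  everywhere; the Lindelof property leaves countably many exceptional null sets.\<close>

lemma AE_zero_outside_ess_support:
  "AE z in lebesgue. z \<in> S - ess_support S f \<longrightarrow> f z = 0"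
proof -
  define \<F> where "\<F> = {U. open U \<and> (AE w in lebesgue. w \<in> S \<inter> U \<longrightarrow> f w = 0)}"
  obtain \<G> where G: "\<G> \<subseteq> \<F>" "countable \<G>" "\<Union>\<G> = \<Union>\<F>"
    using Lindelof[of \<F>] by (auto simp: \<F>_def)
  have "AE w in lebesgue. \<forall>U\<in>\<G>. w \<in> S \<inter> U \<longrightarrow> f w = 0"
    unfolding AE_ball_countable[OF G(2)] using G(1) by (auto simp: \<F>_def)
  then show ?thesis
  proof eventually_elim
    case (elim w)
    show ?case
    proof
      assume "w \<in> S - ess_support S f"
      then have "w \<in> S" "w \<in> \<Union>\<F>" unfolding ess_support_def \<F>_def by auto
      then show "f w = 0" using elim G(3) by auto
    qed
  qed
qed

section \<open>Test functions and the weak gradient\<close>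

lemma test_function_L2:
  assumes "\<phi> \<in> test_functions U"
  shows "\<phi> \<in> L2"
proof -
  define K where "K = closure {x. \<phi> x \<noteq> 0}"
  have K: "compact K" and c: "continuous_on A \<phi>" for A
    using assms by (auto simp: test_functions_def K_def intro: smooth_imp_continuous_on)
  have z: "\<phi> x = 0" if "x \<notin> K" for x using that closure_subset[of "{x. \<phi> x \<noteq> 0}"] by (auto simp: K_def)
  have "integrable lborel (\<lambda>x. indicator K x *\<^sub>R (norm (\<phi> x))\<^sup>2)"
    by (intro borel_integrable_compact[OF K] continuous_on_power continuous_on_norm c)
  moreover have "indicator K x *\<^sub>R (norm (\<phi> x))\<^sup>2 = (norm (\<phi> x))\<^sup>2" for x
    using z[of x] by (cases "x \<in> K") simp_all
  ultimately have i: "integrable lborel (\<lambda>x. (norm (\<phi> x))\<^sup>2)" by (simp only:)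
  have "integrable lebesgue (\<lambda>x. (norm (\<phi> x))\<^sup>2)"
    using integrable_completion[OF borel_measurable_integrable[OF i]] i by simp
  moreover have "\<phi> \<in> borel_measurable lborel"
    using borel_measurable_continuous_onI[OF c] by simp
  ultimately show ?thesis by (simp add: L2_def measurable_completion)
qed

lemma test_function_partial:
  assumes "\<phi> \<in> test_functions U" "b \<in> Basis"
  shows "(\<lambda>x. frechet_derivative \<phi> (at x) b) \<in> test_functions U"
proof -
  define K where "K = closure {x. \<phi> x \<noteq> 0}"
  have K: "compact K" "K \<subseteq> U" and s: "smooth \<phi>"
    using assms by (auto simp: test_functions_def K_def)
  show ?thesis
  proof (rule test_functionI[OF smooth_frechet_derivative[OF s assms(2)] K])
    fix x assume x: "x \<notin> K"
    have o: "open (- K)" by (simp add: K_def open_Compl)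
    have "((\<lambda>_. 0) has_derivative (\<lambda>_. 0)) (at x)" by simp
    then have "(\<phi> has_derivative (\<lambda>_. 0)) (at x)"
      by (rule has_derivative_transform_within_open[OF _ o])
         (use x closure_subset[of "{x. \<phi> x \<noteq> 0}"] in \<open>auto simp: K_def\<close>)
    from frechet_derivative_at[OF this] show "frechet_derivative \<phi> (at x) b = 0" by metis
  qed
qed

text \<open>Partial derivatives of \<phi> are again test functions; the defining identity is applied
  to each of them and only the component in the same direction is kept. Both vector integrands are
  shown integrable because that component has to pass under the integral.\<close>

lemma weak_gradient_pairing:
  fixes f :: "'a::euclidean_space \<Rightarrow> real"
  assumes f: "f \<in> H1" and \<phi>: "\<phi> \<in> test_functions UNIV"
  shows "(LINT x|lebesgue. weak_gradient f x \<bullet> gradient \<phi> x) =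
    - (LINT x|lebesgue. f x * (\<Sum>b\<in>Basis. frechet_derivative (\<lambda>y. frechet_derivative \<phi> (at y) b) (at x) b))"
proof -
  define g where "g = weak_gradient f"
  have f2: "f \<in> L2" using f by (simp add: H1_def)
  have "\<exists>g. g \<in> L2 \<and> is_weak_gradient f g" using f by (auto simp: H1_def)
  from someI_ex[OF this] have g: "g \<in> L2" "is_weak_gradient f g"
    by (simp_all add: g_def weak_gradient_def)
  have gb: "(\<lambda>x. g x \<bullet> b) \<in> L2" if b: "b \<in> Basis" for b
  proof -
    have m: "(\<lambda>x. g x \<bullet> b) \<in> borel_measurable lebesgue"
      using L2_measurable[OF g(1)] by simp
    have "integrable lebesgue (\<lambda>x. (norm (g x \<bullet> b))\<^sup>2)"
    proof (rule Bochner_Integration.integrable_bound[OF L2_square_integrable[OF g(1)]])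
      show "(\<lambda>x. (norm (g x \<bullet> b))\<^sup>2) \<in> borel_measurable lebesgue" using m by simp
      have "(norm (g x \<bullet> b))\<^sup>2 \<le> (norm (g x))\<^sup>2" for x
        using Basis_le_norm[OF b, of "g x"] by (intro power_mono) auto
      then show "AE x in lebesgue. norm ((norm (g x \<bullet> b))\<^sup>2) \<le> norm ((norm (g x))\<^sup>2)" by simp
    qed
    with m show ?thesis by (simp add: L2_def)
  qed
  define d where "d b x = frechet_derivative \<phi> (at x) b" for b x
  have d: "d b \<in> test_functions UNIV" if "b \<in> Basis" for b
    unfolding d_def by (rule test_function_partial[OF \<phi> that])
  have dd: "(\<lambda>x. frechet_derivative (d b) (at x) b') \<in> L2" if "b \<in> Basis" "b' \<in> Basis" for b b'
    by (rule test_function_L2[OF test_function_partial[OF d[OF that(1)] that(2)]])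
  have comp: "(LINT x|lebesgue. f x * frechet_derivative (d b) (at x) b) = - (LINT x|lebesgue. d b x * (g x \<bullet> b))"
    if b: "b \<in> Basis" for b
  proof -
    have "integrable lebesgue (\<lambda>x. \<Sum>b'\<in>Basis. (f x * frechet_derivative (d b) (at x) b') *\<^sub>R b')"
      by (intro Bochner_Integration.integrable_sum integrable_scaleR_left impI L2_mult_integrable[OF f2 dd[OF b]])
    then have i1: "integrable lebesgue (\<lambda>x. f x *\<^sub>R gradient (d b) x)"
      by (simp add: gradient_def scaleR_sum_right)
    have "integrable lebesgue (\<lambda>x. \<Sum>b'\<in>Basis. (d b x * (g x \<bullet> b')) *\<^sub>R b')"
      by (intro Bochner_Integration.integrable_sum integrable_scaleR_left impI
          L2_mult_integrable[OF test_function_L2[OF d[OF b]] gb])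
    moreover have "(\<Sum>b'\<in>Basis. (d b x * (g x \<bullet> b')) *\<^sub>R b') = d b x *\<^sub>R g x" for x
    proof -
      have "(\<Sum>b'\<in>Basis. (d b x * (g x \<bullet> b')) *\<^sub>R b') = d b x *\<^sub>R (\<Sum>b'\<in>Basis. (g x \<bullet> b') *\<^sub>R b')"
        by (simp add: scaleR_sum_right)
      then show ?thesis by (simp add: euclidean_representation)
    qed
    ultimately have i2: "integrable lebesgue (\<lambda>x. d b x *\<^sub>R g x)" by simp
    have "(LINT x|lebesgue. f x *\<^sub>R gradient (d b) x) \<bullet> b = (- (LINT x|lebesgue. d b x *\<^sub>R g x)) \<bullet> b"
      using g(2) d[OF b] by (simp add: is_weak_gradient_def)
    then have "(LINT x|lebesgue. (f x *\<^sub>R gradient (d b) x) \<bullet> b) = - (LINT x|lebesgue. (d b x *\<^sub>R g x) \<bullet> b)"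
      using i1 i2 by (simp only: integral_inner_left inner_minus_left)
    moreover have "gradient (d b) x \<bullet> b = frechet_derivative (d b) (at x) b" for x
      using b by (simp add: gradient_def inner_sum_left inner_Basis if_distrib cong: if_cong)
    ultimately show ?thesis by simp
  qed
  have "(LINT x|lebesgue. g x \<bullet> gradient \<phi> x) = (LINT x|lebesgue. (\<Sum>b\<in>Basis. d b x * (g x \<bullet> b)))"
    by (simp add: gradient_def inner_sum_right d_def)
  also have "\<dots> = (\<Sum>b\<in>Basis. (LINT x|lebesgue. d b x * (g x \<bullet> b)))"
    by (intro Bochner_Integration.integral_sum L2_mult_integrable test_function_L2[OF d] gb)
  also have "\<dots> = (\<Sum>b\<in>Basis. - (LINT x|lebesgue. f x * frechet_derivative (d b) (at x) b))"
    by (intro sum.cong refl) (simp add: comp)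
  also have "\<dots> = - (LINT x|lebesgue. (\<Sum>b\<in>Basis. f x * frechet_derivative (d b) (at x) b))"
    by (subst Bochner_Integration.integral_sum) (auto simp: sum_negf intro!: L2_mult_integrable f2 dd)
  finally show ?thesis by (simp add: g_def sum_distrib_left d_def[abs_def])
qed

subsection \<open>Moments of an energy solution\<close>

lemma lifespan_interval_upper:
  assumes "ereal L < T"
  obtains L' where "L < L'" "ereal L' < T"
  using ereal_dense2[OF assms] by auto

lemma atLeastAtMost_subset_lifespan: "ereal L < T \<Longrightarrow> {0..L} \<subseteq> lifespan_interval T"
  by (auto simp: lifespan_interval_def intro: le_less_trans[of _ "ereal L"])

lemma C_H1_imp_C_L2: "C_H1 I \<subseteq> C_L2 I"
proof
  fix w :: "real \<Rightarrow> 'a \<Rightarrow> real" assume w: "w \<in> C_H1 I"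
  have "((\<lambda>s. L2_norm (\<lambda>x. w s x - w t x)) \<longlongrightarrow> 0) (at t within I)" if "t \<in> I" for t
  proof (rule Lim_null_comparison)
    show "((\<lambda>s. H1_norm (\<lambda>x. w s x - w t x)) \<longlongrightarrow> 0) (at t within I)"
      using w that by (simp add: C_H1_def)
    have "L2_norm f \<le> H1_norm f" for f :: "'a \<Rightarrow> real"
      unfolding H1_norm_def by (rule real_le_rsqrt) simp
    then show "\<forall>\<^sub>F s in at t within I. norm (L2_norm (\<lambda>x. w s x - w t x)) \<le> H1_norm (\<lambda>x. w s x - w t x)"
      by (simp add: L2_norm_nonneg)
  qed
  then show "w \<in> C_L2 I" using w by (simp add: C_L2_def C_H1_def H1_def)
qed

text \<open>Slicing the space-time support condition yields the claim for almost every time, whereas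
  the moment equation uses each time. Continuity in L2 carries the vanishing back from later times,
  with a margin \<delta> in the radius that is then removed along \<delta> = 1/(k+1).\<close>

lemma slice_support:
  fixes w :: "real \<Rightarrow> 'a::euclidean_space \<Rightarrow> real"
  assumes w: "w \<in> C_L2 (lifespan_interval T)"
    and supp: "ess_support (lifespan_interval T \<times> UNIV) (\<lambda>(t, x). w t x)
       \<subseteq> {(t, x). t \<in> lifespan_interval T \<and> norm x \<le> t + R}"
    and t: "t \<in> lifespan_interval T"
  shows "AE x in lebesgue. t + R < norm x \<longrightarrow> w t x = 0"
proof -
  let ?I = "lifespan_interval T"
  define good where "good s \<longleftrightarrow> (AE x in lebesgue. s \<in> ?I \<and> s + R < norm x \<longrightarrow> w s x = 0)" for s
  have "AE z in lebesgue. fst z \<in> ?I \<and> fst z + R < norm (snd z) \<longrightarrow> w (fst z) (snd z) = 0"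
    using AE_zero_outside_ess_support[of "?I \<times> UNIV" "\<lambda>(t, x). w t x"]
    by eventually_elim (use supp in force)
  from AE_lebesgue_prodD[OF this] have good: "AE s in lebesgue. good s"
    by (simp add: good_def)
  obtain L' where L': "t < L'" "ereal L' < T"
    using t lifespan_interval_upper by (auto simp: lifespan_interval_def)
  have sub: "{t..L'} \<subseteq> ?I"
  proof -
    have "{t..L'} \<subseteq> {0..L'}" using t by (auto simp: lifespan_interval_def)
    with atLeastAtMost_subset_lifespan[OF L'(2)] show ?thesis by blast
  qed
  have "AE x in lebesgue. x \<in> {x. t + R + \<delta> < norm x} \<longrightarrow> w t x = 0" if \<delta>: "\<delta> > 0" for \<delta>
  proof (rule L2_limit_vanishes)
    show "((\<lambda>s. L2_norm (\<lambda>x. w s x - w t x)) \<longlongrightarrow> 0) (at t within ?I)" "w t \<in> L2"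
      using w t by (auto simp: C_L2_def)
    have "open {x::'a. t + R + \<delta> < norm x}" by (intro open_Collect_less continuous_intros)
    then show "{x::'a. t + R + \<delta> < norm x} \<in> sets lebesgue" by simp
    show "\<exists>\<^sub>F s in at t within ?I. w s \<in> L2 \<and> (AE x in lebesgue. x \<in> {x. t + R + \<delta> < norm x} \<longrightarrow> w s x = 0)"
      unfolding frequently_def
    proof
      assume "\<forall>\<^sub>F s in at t within ?I. \<not> (w s \<in> L2 \<and> (AE x in lebesgue. x \<in> {x. t + R + \<delta> < norm x} \<longrightarrow> w s x = 0))"
      then obtain d where d: "d > 0" and bad: "\<And>s. s \<in> ?I \<Longrightarrow> s \<noteq> t \<Longrightarrow> dist s t < d \<Longrightarrow>
          \<not> (w s \<in> L2 \<and> (AE x in lebesgue. x \<in> {x. t + R + \<delta> < norm x} \<longrightarrow> w s x = 0))"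
        unfolding eventually_at by blast
      \<comment> \<open>Between \<open>t\<close> and \<open>e\<close> the cone has widened by less
        than \<delta>, the time is within \<open>d\<close> of \<open>t\<close>, and it belongs to
        the lifespan. If none of these times were good, an interval of positive length would be
        null.\<close>
      define e where "e = min (t + \<delta>) (min (t + d) L')"
      have e: "t < e" using d \<delta> L' by (simp add: e_def)
      have "\<not> good s" if "s \<in> {t<..<e}" for s
      proof
        assume g: "good s"
        have s: "s \<in> ?I" using sub that by (auto simp: e_def)
        have "AE x in lebesgue. x \<in> {x. t + R + \<delta> < norm x} \<longrightarrow> w s x = 0"
          using g unfolding good_def by eventually_elim (use s that in \<open>auto simp: e_def\<close>)
        moreover have "w s \<in> L2" using w s by (auto simp: C_L2_def)
        ultimately show False
          using bad[OF s] that by (auto simp: e_def dist_real_def)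
      qed
      then have "AE s in lebesgue. s \<notin> {t<..<e}"
        using good by (auto elim: eventually_mono)
      then have "{t<..<e} \<in> null_sets lebesgue"
        by (subst (asm) AE_iff_null_sets[symmetric]) auto
      then have "emeasure lebesgue {t<..<e} = 0" by auto
      then show False using e by simp
    qed
  qed
  then have "AE x in lebesgue. \<forall>k. x \<in> {x. t + R + inverse (real (Suc k)) < norm x} \<longrightarrow> w t x = 0"
    by (subst AE_all_countable) simp
  then show ?thesis
  proof eventually_elim
    case (elim x)
    show ?case
    proof
      assume "t + R < norm x"
      then have "0 < norm x - (t + R)" by simp
      from reals_Archimedean[OF this] obtain k where "inverse (real (Suc k)) < norm x - (t + R)" by blast
      then show "w t x = 0" using elim[rule_format, of k] by simp
    qed
  qed
qed

lemma time_deriv_props: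
  assumes "w \<in> C1_L2 I" "t \<in> I"
  shows "time_deriv I w t \<in> L2" "is_L2_time_deriv I w t (time_deriv I w t)"
proof -
  have "\<exists>d. d \<in> L2 \<and> is_L2_time_deriv I w t d" using assms by (auto simp: C1_L2_def)
  from someI_ex[OF this] show "time_deriv I w t \<in> L2" "is_L2_time_deriv I w t (time_deriv I w t)"
    by (simp_all add: time_deriv_def)
qed

text \<open>Pairing with a fixed L2 weight is continuous, so the difference quotients of the moment
  inherit the limit of the difference quotients in L2.\<close>

lemma moment_has_derivative:
  fixes w :: "real \<Rightarrow> 'a::euclidean_space \<Rightarrow> real"
  assumes w: "w \<in> C1_L2 I" and t: "t \<in> I" and \<theta>: "\<theta> \<in> L2"
  shows "((\<lambda>s. LINT x|lebesgue. w s x * \<theta> x) has_real_derivative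
    (LINT x|lebesgue. time_deriv I w t x * \<theta> x)) (at t within I)"
proof -
  have wL: "w s \<in> L2" if "s \<in> I" for s using w that by (simp add: C1_L2_def)
  have q: "(\<lambda>x. (w s x - w t x) / (s - t)) \<in> L2" if "s \<in> I" for s
    using L2_cmult[OF L2_diff[OF wL[OF that] wL[OF t]], of "inverse (s - t)"]
    by (simp add: divide_inverse mult.commute)
  have inI: "\<forall>\<^sub>F s in at t within I. s \<in> I" by (simp add: eventually_at_filter)
  have "((\<lambda>s. LINT x|lebesgue. (w s x - w t x) / (s - t) * \<theta> x) \<longlongrightarrow>
      (LINT x|lebesgue. time_deriv I w t x * \<theta> x)) (at t within I)"
  proof (rule L2_pairing_tendsto[OF _ _ time_deriv_props(1)[OF w t] \<theta>])
    show "((\<lambda>s. L2_norm (\<lambda>x. (w s x - w t x) / (s - t) - time_deriv I w t x)) \<longlongrightarrow> 0) (at t within I)"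
      using time_deriv_props(2)[OF w t] by (simp add: is_L2_time_deriv_def)
    show "\<forall>\<^sub>F s in at t within I. (\<lambda>x. (w s x - w t x) / (s - t)) \<in> L2"
      using inI by eventually_elim (rule q)
  qed
  then have "((\<lambda>s. ((LINT x|lebesgue. w s x * \<theta> x) - (LINT x|lebesgue. w t x * \<theta> x)) / (s - t)) \<longlongrightarrow>
      (LINT x|lebesgue. time_deriv I w t x * \<theta> x)) (at t within I)"
  proof (rule Lim_transform_eventually)
    show "\<forall>\<^sub>F s in at t within I. (LINT x|lebesgue. (w s x - w t x) / (s - t) * \<theta> x) =
        ((LINT x|lebesgue. w s x * \<theta> x) - (LINT x|lebesgue. w t x * \<theta> x)) / (s - t)"
      using inI
    proof eventually_elim
      case (elim s)
      have "(LINT x|lebesgue. (w s x - w t x) / (s - t) * \<theta> x) = (LINT x|lebesgue. inverse (s - t) * (w s x * \<theta> x - w t x * \<theta> x))"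
        by (rule Bochner_Integration.integral_cong) (simp_all add: divide_inverse algebra_simps)
      then show ?case
        using L2_mult_integrable[OF wL[OF elim] \<theta>] L2_mult_integrable[OF wL[OF t] \<theta>]
        by (simp add: divide_inverse mult.commute)
    qed
  qed
  then show ?thesis by (simp add: has_field_derivative_iff)
qed

lemma moment_continuous:
  assumes w: "w \<in> C_L2 I" and \<theta>: "\<theta> \<in> L2"
  shows "continuous_on I (\<lambda>s. LINT x|lebesgue. w s x * \<theta> x)"
  unfolding continuous_on_def
proof
  fix t assume t: "t \<in> I"
  show "((\<lambda>s. LINT x|lebesgue. w s x * \<theta> x) \<longlongrightarrow> (LINT x|lebesgue. w t x * \<theta> x)) (at t within I)"
  proof (rule L2_pairing_tendsto[OF _ _ _ \<theta>])
    show "\<forall>\<^sub>F s in at t within I. w s \<in> L2"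
      using w by (auto simp: eventually_at_filter C_L2_def)
  qed (use w t in \<open>auto simp: C_L2_def\<close>)
qed

lemma set_lebesgue_integral_continuous:
  fixes f :: "real \<Rightarrow> real"
  assumes "continuous_on {a..b} f"
  shows "(LINT s:{a..b}|lebesgue. f s) = integral {a..b} f"
  using assms by (intro set_lebesgue_integral_eq_integral(2) absolutely_integrable_continuous_real)

lemma radial_test_function:
  assumes "smooth \<theta>" "\<And>z. r\<^sup>2 \<le> z \<Longrightarrow> \<theta> z = 0"
  shows "(\<lambda>x::'a::euclidean_space. \<theta> (x \<bullet> x)) \<in> test_functions UNIV"
proof (rule test_functionI[where K="cball 0 \<bar>r\<bar>"])
  fix x :: 'a assume "x \<notin> cball 0 \<bar>r\<bar>"
  then have "\<bar>r\<bar>\<^sup>2 \<le> (norm x)\<^sup>2" by (intro power_mono) auto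
  then show "\<theta> (x \<bullet> x) = 0" using assms(2) by (simp add: power2_norm_eq_inner)
qed (auto intro: smooth_compose[OF assms(1) smooth_inner_self])

text \<open>The test function is \<eta>(t) \<theta>(|x|^2) with \<eta> = 1 near [0,L], so the term
  with the time derivative vanishes and the Laplacian falls on the weight. The eigenvalue relation
  is demanded for |x| \<le> L + R only, where the slices up to time \<open>L\<close> live; this is
  what permits a cut-off weight.\<close>

lemma moment_equation:
  fixes w :: "real \<Rightarrow> real^'n \<Rightarrow> real" and \<theta> :: "real \<Rightarrow> real"
  assumes L: "0 < L" "ereal L < T" and R: "0 < R"
    and w: "w \<in> C_H1 (lifespan_interval T)" "w \<in> C1_L2 (lifespan_interval T)"
    and supp: "ess_support (lifespan_interval T \<times> UNIV) (\<lambda>(t, x). w t x)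
       \<subseteq> {(t, x). t \<in> lifespan_interval T \<and> norm x \<le> t + R}"
    and weak: "weak_damped_wave T b w1 w Gf"
    and b: "continuous_on {0..} b"
    and \<theta>: "smooth \<theta>" "\<And>z. r\<^sup>2 \<le> z \<Longrightarrow> \<theta> z = 0"
    and eigen: "\<And>z. 0 \<le> z \<Longrightarrow> z \<le> (L + R)\<^sup>2 \<Longrightarrow>
      2 * real CARD('n) * deriv \<theta> z + 4 * z * deriv (deriv \<theta>) z = \<kappa> * \<theta> z"
    and g: "set_integrable lebesgue {0..L} (\<lambda>s. LINT x|lebesgue. Gf s x * \<theta> (x \<bullet> x))"
    and W: "\<And>s. W s = (LINT x|lebesgue. w s x * \<theta> (x \<bullet> x))"
    and P: "\<And>s. P s = (LINT x|lebesgue. time_deriv (lifespan_interval T) w s x * \<theta> (x \<bullet> x))"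
    and t: "t \<in> {0..L}"
  shows "P t + integral {0..t} (\<lambda>s. b s * P s) =
    (LINT x|lebesgue. w1 x * \<theta> (x \<bullet> x)) + \<kappa> * integral {0..t} W
    + integral {0..t} (\<lambda>s. LINT x|lebesgue. Gf s x * \<theta> (x \<bullet> x))"
proof -
  let ?I = "lifespan_interval T"
  define \<phi> where "\<phi> x = \<theta> (x \<bullet> x)" for x :: "real^'n"
  have sub: "{0..L} \<subseteq> ?I" by (rule atLeastAtMost_subset_lifespan[OF L(2)])
  have \<phi>T: "\<phi> \<in> test_functions UNIV" unfolding \<phi>_def[abs_def] by (rule radial_test_function[OF \<theta>])
  have \<phi>2: "\<phi> \<in> L2" by (rule test_function_L2[OF \<phi>T])
  have wc: "w \<in> C_L2 ?I" using w(1) C_H1_imp_C_L2 by blast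
  obtain L2 where L2: "L < L2" "ereal L2 < T" using lifespan_interval_upper[OF L(2)] .
  \<comment> \<open>The time cutoff must vanish before \<open>T\<close> and yet be constant around
    every point of [0,L], endpoints included; hence L < L1 < L2 < T on the right and the values -1
    and -2 on the left.\<close>
  define L1 where "L1 = (L + L2) / 2"
  have L1: "L < L1" "L1 < L2" using L2 by (auto simp: L1_def)
  obtain \<eta> where \<eta>: "smooth \<eta>" "\<And>x. -1 \<le> x \<Longrightarrow> x \<le> L1 \<Longrightarrow> \<eta> x = 1" "\<And>x. x \<le> -2 \<or> L2 \<le> x \<Longrightarrow> \<eta> x = 0"
    by (rule smooth_cutoff_interval[of "-2" "-1" L1 L2]) (use L1 L in auto)
  define \<Phi> where "\<Phi> z = \<eta> (fst z) * \<theta> (snd z \<bullet> snd z)" for z :: "real \<times> (real^'n)"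
  have \<Phi>T: "\<Phi> \<in> test_functions ({s. ereal s < T} \<times> UNIV)"
  proof (rule test_functionI[where K="{-2..L2} \<times> cball 0 \<bar>r\<bar>"])
    show "smooth \<Phi>" unfolding \<Phi>_def[abs_def] by (rule smooth_time_radial[OF \<eta>(1) \<theta>(1)])
    show "{-2..L2} \<times> cball 0 \<bar>r\<bar> \<subseteq> {s. ereal s < T} \<times> (UNIV :: (real^'n) set)"
      using L2(2) by (auto intro: le_less_trans[of _ "ereal L2"])
    fix z :: "real \<times> (real^'n)" assume z: "z \<notin> {-2..L2} \<times> cball 0 \<bar>r\<bar>"
    show "\<Phi> z = 0"
    proof (cases "fst z \<in> {-2..L2}")
      case True
      with z have "\<bar>r\<bar> \<le> norm (snd z)" by (cases z) auto
      then have "\<bar>r\<bar>\<^sup>2 \<le> (norm (snd z))\<^sup>2" by (intro power_mono) auto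
      then show ?thesis using \<theta>(2) by (simp add: \<Phi>_def power2_norm_eq_inner)
    next
      case False
      then show ?thesis using \<eta>(3)[of "fst z"] by (auto simp: \<Phi>_def)
    qed
  qed (intro compact_Times compact_Icc compact_cball)
  have \<Phi>eq: "\<Phi> (s, x) = \<phi> x" if "s \<in> {0..L}" for s x
    using \<eta>(2)[of s] that L1 by (simp add: \<Phi>_def \<phi>_def)
  have d0: "deriv (\<lambda>r. \<Phi> (r, x)) s = 0" if s: "s \<in> {0..L}" for s x
  proof (rule DERIV_imp_deriv)
    have "((\<lambda>_. \<phi> x) has_real_derivative 0) (at s)" by simp
    then show "((\<lambda>r. \<Phi> (r, x)) has_real_derivative 0) (at s)"
      by (rule has_field_derivative_transform_within_open[where S="{-1<..<L1}"])
         (use s L1 \<eta>(2) in \<open>auto simp: \<Phi>_def \<phi>_def\<close>)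
  qed
  have grad: "(LINT x|lebesgue. weak_gradient (w s) x \<bullet> gradient (\<lambda>y. \<Phi> (s, y)) x) = - \<kappa> * W s"
    if s: "s \<in> {0..L}" for s
  proof -
    have sI: "s \<in> ?I" using sub s by auto
    have "(\<lambda>y. \<Phi> (s, y)) = \<phi>" using \<Phi>eq[OF s] by auto
    moreover have "w s \<in> H1" using w(1) sI by (simp add: C_H1_def)
    ultimately have 1: "(LINT x|lebesgue. weak_gradient (w s) x \<bullet> gradient (\<lambda>y. \<Phi> (s, y)) x) =
      - (LINT x|lebesgue. w s x * (\<Sum>b\<in>Basis. frechet_derivative (\<lambda>y. frechet_derivative \<phi> (at y) b) (at x) b))"
      using weak_gradient_pairing[OF _ \<phi>T] by simp
    have 2: "(\<Sum>b\<in>Basis. frechet_derivative (\<lambda>y. frechet_derivative \<phi> (at y) b) (at x) b) =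
        2 * real CARD('n) * deriv \<theta> (x \<bullet> x) + 4 * (x \<bullet> x) * deriv (deriv \<theta>) (x \<bullet> x)" for x
      unfolding \<phi>_def[abs_def] using laplacian_radial[OF \<theta>(1), where x=x] by simp
    have "(LINT x|lebesgue. w s x * (2 * real CARD('n) * deriv \<theta> (x \<bullet> x) + 4 * (x \<bullet> x) * deriv (deriv \<theta>) (x \<bullet> x)))
        = (LINT x|lebesgue. \<kappa> * (w s x * \<phi> x))"
    proof (rule integrable_lebesgue_cong_AE(2))
      show "integrable lebesgue (\<lambda>x. \<kappa> * (w s x * \<phi> x))"
        using wc sI by (intro integrable_mult_right L2_mult_integrable[OF _ \<phi>2]) (auto simp: C_L2_def)
      show "AE x in lebesgue. w s x * (2 * real CARD('n) * deriv \<theta> (x \<bullet> x) + 4 * (x \<bullet> x) * deriv (deriv \<theta>) (x \<bullet> x))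
          = \<kappa> * (w s x * \<phi> x)"
        using slice_support[OF wc supp sI]
      proof eventually_elim
        case (elim x)
        show ?case
        proof (cases "s + R < norm x")
          case True
          then show ?thesis using elim by simp
        next
          case False
          then have "(norm x)\<^sup>2 \<le> (L + R)\<^sup>2" using s by (intro power_mono) auto
          then show ?thesis using eigen[of "x \<bullet> x"] by (simp add: \<phi>_def power2_norm_eq_inner)
        qed
      qed
    qed
    then show ?thesis unfolding 1 2 by (simp add: W \<phi>_def)
  qed
  have damp: "(LINT x|lebesgue. b s * time_deriv ?I w s x * \<Phi> (s, x)) = b s * P s" if "s \<in> {0..L}" for s
    using that by (simp add: \<Phi>eq P \<phi>_def mult.assoc)
  have st: "s \<in> {0..L}" if "s \<in> {0..t}" for s using that t by auto
  have 0: "0 \<in> {0..L}" using L by auto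
  have contP: "continuous_on {0..t} P" and contW: "continuous_on {0..t} W"
  proof -
    have "continuous_on ?I P"
      unfolding P[abs_def] using w(2) by (intro moment_continuous \<phi>2[unfolded \<phi>_def[abs_def]]) (simp add: C1_L2_def)
    then show "continuous_on {0..t} P" by (rule continuous_on_subset) (use sub st in auto)
    have "continuous_on ?I W"
      unfolding W[abs_def] by (intro moment_continuous wc \<phi>2[unfolded \<phi>_def[abs_def]])
    then show "continuous_on {0..t} W" by (rule continuous_on_subset) (use sub st in auto)
  qed
  have contb: "continuous_on {0..t} b" by (rule continuous_on_subset[OF b]) auto
  have cong: "(LINT s:{0..t}|lebesgue. f s) = (LINT s:{0..t}|lebesgue. h s)"
    if "\<And>s. s \<in> {0..L} \<Longrightarrow> f s = h s" for f h :: "real \<Rightarrow> real"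
    by (rule set_lebesgue_integral_cong) (use that st in auto)
  have "(LINT x|lebesgue. time_deriv ?I w t x * \<Phi> (t, x))
        - (LINT x|lebesgue. w1 x * \<Phi> (0, x))
        - (LINT s:{0..t}|lebesgue. LINT x|lebesgue. time_deriv ?I w s x * deriv (\<lambda>r. \<Phi> (r, x)) s)
        + (LINT s:{0..t}|lebesgue. LINT x|lebesgue. weak_gradient (w s) x \<bullet> gradient (\<lambda>y. \<Phi> (s, y)) x)
        + (LINT s:{0..t}|lebesgue. LINT x|lebesgue. b s * time_deriv ?I w s x * \<Phi> (s, x))
        = (LINT s:{0..t}|lebesgue. LINT x|lebesgue. Gf s x * \<Phi> (s, x))"
    using weak \<Phi>T sub t unfolding weak_damped_wave_def Let_def by blast
  moreover have "(LINT x|lebesgue. time_deriv ?I w t x * \<Phi> (t, x)) = P t"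
    by (simp add: \<Phi>eq[OF t] P \<phi>_def)
  moreover have "(LINT x|lebesgue. w1 x * \<Phi> (0, x)) = (LINT x|lebesgue. w1 x * \<theta> (x \<bullet> x))"
    by (simp add: \<Phi>eq[OF 0] \<phi>_def)
  moreover have "(LINT s:{0..t}|lebesgue. LINT x|lebesgue. time_deriv ?I w s x * deriv (\<lambda>r. \<Phi> (r, x)) s)
      = (LINT s:{0..t}|lebesgue. 0)"
    by (rule cong) (simp add: d0)
  moreover have "(LINT s:{0..t}|lebesgue. LINT x|lebesgue. weak_gradient (w s) x \<bullet> gradient (\<lambda>y. \<Phi> (s, y)) x)
      = (LINT s:{0..t}|lebesgue. - \<kappa> * W s)"
    by (rule cong) (simp add: grad)
  moreover have "(LINT s:{0..t}|lebesgue. - \<kappa> * W s) = - \<kappa> * integral {0..t} W"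
  proof -
    have "(LINT s:{0..t}|lebesgue. - \<kappa> * W s) = integral {0..t} (\<lambda>s. - \<kappa> * W s)"
      by (intro set_lebesgue_integral_continuous continuous_on_mult continuous_on_const contW)
    then show ?thesis by (simp only: Henstock_Kurzweil_Integration.integral_mult_right)
  qed
  moreover have "(LINT s:{0..t}|lebesgue. LINT x|lebesgue. b s * time_deriv ?I w s x * \<Phi> (s, x))
      = (LINT s:{0..t}|lebesgue. b s * P s)"
    by (rule cong) (simp add: damp)
  moreover have "(LINT s:{0..t}|lebesgue. b s * P s) = integral {0..t} (\<lambda>s. b s * P s)"
    by (intro set_lebesgue_integral_continuous continuous_on_mult contb contP)
  moreover have "(LINT s:{0..t}|lebesgue. LINT x|lebesgue. Gf s x * \<Phi> (s, x))
      = (LINT s:{0..t}|lebesgue. LINT x|lebesgue. Gf s x * \<theta> (x \<bullet> x))"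
    by (rule cong) (simp add: \<Phi>eq \<phi>_def)
  moreover have "(LINT s:{0..t}|lebesgue. LINT x|lebesgue. Gf s x * \<theta> (x \<bullet> x))
      = integral {0..t} (\<lambda>s. LINT x|lebesgue. Gf s x * \<theta> (x \<bullet> x))"
    by (rule set_lebesgue_integral_eq_integral(2)[OF set_integrable_subset[OF g]]) (use t in auto)
  ultimately show ?thesis by (simp add: set_lebesgue_integral_def)
qed

text \<open>The radial cutoff confines the integrand to a compact subset of the slab, where the
  local integrability hypothesis applies; Fubini does the rest.\<close>

lemma source_integrable:
  fixes z :: "real \<Rightarrow> 'a::euclidean_space \<Rightarrow> real"
  assumes z: "(\<lambda>(t, x). z t x) \<in> Lloc p (I \<times> UNIV)" and I: "{0..L} \<subseteq> I"
    and \<theta>: "smooth \<theta>" "\<And>y. r\<^sup>2 \<le> y \<Longrightarrow> \<theta> y = 0"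
  shows "set_integrable lebesgue {0..L} (\<lambda>s. LINT x|lebesgue. \<bar>z s x\<bar> powr p * \<theta> (x \<bullet> x))"
    and "AE s in lebesgue. s \<in> {0..L} \<longrightarrow> integrable lebesgue (\<lambda>x. \<bar>z s x\<bar> powr p * \<theta> (x \<bullet> x))"
proof -
  define K where "K = {0..L} \<times> cball (0::'a) \<bar>r\<bar>"
  have "compact K" unfolding K_def by (intro compact_Times) auto
  moreover have "K \<subseteq> I \<times> UNIV" using I by (auto simp: K_def)
  ultimately have "set_integrable lebesgue K (\<lambda>y. \<bar>case y of (t, x) \<Rightarrow> z t x\<bar> powr p)"
    using z by (simp add: Lloc_def)
  then have iK: "integrable lebesgue (\<lambda>y. indicator K y * \<bar>z (fst y) (snd y)\<bar> powr p)"
    by (simp add: set_integrable_def case_prod_beta)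
  define \<phi> where "\<phi> x = \<theta> (x \<bullet> x)" for x :: 'a
  have \<phi>T: "\<phi> \<in> test_functions UNIV" unfolding \<phi>_def[abs_def] by (rule radial_test_function[OF \<theta>])
  have sm: "smooth \<phi>" using \<phi>T by (simp add: test_functions_def)
  have \<phi>0: "\<phi> x = 0" if "x \<notin> cball 0 \<bar>r\<bar>" for x
  proof -
    have "\<bar>r\<bar>\<^sup>2 \<le> (norm x)\<^sup>2" using that by (intro power_mono) auto
    then show ?thesis using \<theta>(2) by (simp add: \<phi>_def power2_norm_eq_inner)
  qed
  obtain B where B: "\<And>x. x \<in> cball 0 \<bar>r\<bar> \<Longrightarrow> \<bar>\<phi> x\<bar> \<le> B"
    using compact_imp_bounded[OF compact_continuous_image[OF smooth_imp_continuous_on[OF sm] compact_cball]]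
    by (metis bounded_iff imageI real_norm_def)
  define f where "f y = indicator K y * \<bar>z (fst y) (snd y)\<bar> powr p * \<phi> (snd y)" for y
  have mphi: "(\<lambda>y. \<phi> (snd y)) \<in> borel_measurable (lebesgue :: (real \<times> 'a) measure)"
  proof -
    have "continuous_on UNIV (\<lambda>y::real \<times> 'a. \<phi> (snd y))"
      by (intro continuous_on_compose2[OF smooth_imp_continuous_on[OF sm]] continuous_on_snd continuous_on_id) auto
    then have "(\<lambda>y::real \<times> 'a. \<phi> (snd y)) \<in> borel_measurable lborel"
      using borel_measurable_continuous_onI by simp
    then show ?thesis by (rule measurable_completion)
  qed
  have f: "integrable lebesgue f"
  proof (rule Bochner_Integration.integrable_bound)
    show "integrable lebesgue (\<lambda>y. B * (indicator K y * \<bar>z (fst y) (snd y)\<bar> powr p))"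
      by (intro integrable_mult_right iK)
    show "f \<in> borel_measurable lebesgue"
      unfolding f_def[abs_def] by (intro borel_measurable_times mphi borel_measurable_integrable[OF iK])
    have "norm (f y) \<le> norm (B * (indicator K y * \<bar>z (fst y) (snd y)\<bar> powr p))" for y
    proof (cases "y \<in> K")
      case True
      then have "\<bar>\<phi> (snd y)\<bar> \<le> B" by (intro B) (auto simp: K_def)
      then have "\<bar>z (fst y) (snd y)\<bar> powr p * \<bar>\<phi> (snd y)\<bar> \<le> \<bar>z (fst y) (snd y)\<bar> powr p * \<bar>B\<bar>"
        by (intro mult_left_mono) auto
      with True show ?thesis by (simp add: f_def abs_mult mult.commute)
    qed (simp add: f_def)
    then show "AE y in lebesgue. norm (f y) \<le> norm (B * (indicator K y * \<bar>z (fst y) (snd y)\<bar> powr p))" by simp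
  qed
  have fs: "f (s, x) = indicator {0..L} s * (\<bar>z s x\<bar> powr p * \<theta> (x \<bullet> x))" for s x
    using \<phi>0[of x] by (cases "x \<in> cball 0 \<bar>r\<bar>") (auto simp: f_def K_def \<phi>_def indicator_def)
  show "set_integrable lebesgue {0..L} (\<lambda>s. LINT x|lebesgue. \<bar>z s x\<bar> powr p * \<theta> (x \<bullet> x))"
    using lebesgue_Fubini_integrable(2)[OF f] unfolding fs by (simp add: set_integrable_def)
  show "AE s in lebesgue. s \<in> {0..L} \<longrightarrow> integrable lebesgue (\<lambda>x. \<bar>z s x\<bar> powr p * \<theta> (x \<bullet> x))"
    using lebesgue_Fubini_integrable(1)[OF f] unfolding fs
    by eventually_elim (auto simp: indicator_def)
qed

subsection \<open>Lower bounds for the nonlinear terms\<close>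

text \<open>Hoelder's inequality solved for the norm of \<open>f\<close>: \<open>J\<close> bounds
  the dual integral over the set carrying \<open>f\<close>. It is obtained by integrating a scaled
  Young inequality.\<close>

lemma Holder_lower_bound:
  fixes f \<Phi> :: "'a::euclidean_space \<Rightarrow> real"
  assumes q: "1 < q"
    and f: "integrable lebesgue (\<lambda>x. \<bar>f x\<bar> powr q)" and f\<Phi>: "integrable lebesgue (\<lambda>x. f x * \<Phi> x)"
    and \<Phi>: "integrable lebesgue (\<lambda>x. indicator A x * \<Phi> x powr (q / (q - 1)))" "\<And>x. 0 \<le> \<Phi> x"
    and A: "AE x in lebesgue. x \<notin> A \<longrightarrow> f x = 0"
    and W: "0 \<le> W" "W \<le> (LINT x|lebesgue. f x * \<Phi> x)"
    and J: "(LINT x|lebesgue. indicator A x * \<Phi> x powr (q / (q - 1))) \<le> J" "0 < J"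
  shows "W powr q * J powr (1 - q) \<le> (LINT x|lebesgue. \<bar>f x\<bar> powr q)"
proof (cases "W = 0")
  case True
  then show ?thesis by simp
next
  case False
  with W have W0: "0 < W" by simp
  define q' where "q' = q / (q - 1)"
  have q': "1 < q'" "1 / q + 1 / q' = 1" using q by (auto simp: q'_def field_simps)
  define X where "X = (LINT x|lebesgue. \<bar>f x\<bar> powr q)"
  \<comment> \<open>The scale is chosen so that \<mu>^q' = J/W. The dual term then becomes W/q' and
    is absorbed by the left-hand side, leaving W/q.\<close>
  define \<mu> where "\<mu> = (J / W) powr (1 / q')"
  have \<mu>: "0 < \<mu>" using W0 J by (simp add: \<mu>_def)
  have \<mu>q': "\<mu> powr q' = J / W" using q' W0 J by (simp add: \<mu>_def powr_powr)
  have \<mu>q: "\<mu> powr q = (J / W) powr (q - 1)"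
    using q by (simp add: \<mu>_def powr_powr q'_def)
  have "W \<le> (LINT x|lebesgue. \<mu> powr q / q * \<bar>f x\<bar> powr q
      + inverse (\<mu> powr q' * q') * (indicator A x * \<Phi> x powr q'))"
    using W(2)
  proof (rule order_trans)
    show "(LINT x|lebesgue. f x * \<Phi> x) \<le> (LINT x|lebesgue. \<mu> powr q / q * \<bar>f x\<bar> powr q
      + inverse (\<mu> powr q' * q') * (indicator A x * \<Phi> x powr q'))"
    proof (rule integral_mono_AE[OF f\<Phi>])
      show "integrable lebesgue (\<lambda>x. \<mu> powr q / q * \<bar>f x\<bar> powr q
          + inverse (\<mu> powr q' * q') * (indicator A x * \<Phi> x powr q'))"
        using f \<Phi>(1) by (intro Bochner_Integration.integrable_add integrable_mult_right) (auto simp: q'_def)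
      show "AE x in lebesgue. f x * \<Phi> x \<le> \<mu> powr q / q * \<bar>f x\<bar> powr q
          + inverse (\<mu> powr q' * q') * (indicator A x * \<Phi> x powr q')"
        using A
      proof eventually_elim
        case (elim x)
        show ?case
        proof (cases "x \<in> A")
          case True
          have "f x * \<Phi> x \<le> \<bar>f x\<bar> * \<Phi> x" using \<Phi>(2) by (intro mult_right_mono) auto
          also have "\<dots> = (\<mu> * \<bar>f x\<bar>) * (\<Phi> x / \<mu>)" using \<mu> by simp
          also have "\<dots> \<le> (\<mu> * \<bar>f x\<bar>) powr q / q + (\<Phi> x / \<mu>) powr q' / q'"
            using q q' \<mu> \<Phi>(2)[of x] by (intro Youngs_inequality) auto
          also have "\<dots> = \<mu> powr q / q * \<bar>f x\<bar> powr q + inverse (\<mu> powr q' * q') * (indicator A x * \<Phi> x powr q')"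
            using True by (simp add: powr_mult divide_inverse inverse_powr mult_ac)
          finally show ?thesis .
        next
          case False
          then show ?thesis using elim q by simp
        qed
      qed
    qed
  qed
  also have "\<dots> = \<mu> powr q / q * X + inverse (\<mu> powr q' * q') * (LINT x|lebesgue. indicator A x * \<Phi> x powr q')"
    using f \<Phi>(1) by (simp add: X_def q'_def)
  also have "\<dots> \<le> \<mu> powr q / q * X + inverse (\<mu> powr q' * q') * J"
  proof (intro add_left_mono mult_left_mono)
    show "0 \<le> inverse (\<mu> powr q' * q')" using q' by simp
  qed (use J(1) in \<open>simp add: q'_def\<close>)
  also have "inverse (\<mu> powr q' * q') * J = W * (1 / q')"
    unfolding \<mu>q' using J by (simp add: divide_inverse)
  also have "1 / q' = 1 - 1 / q" using q'(2) by linarith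
  finally have "W / q \<le> \<mu> powr q / q * X" by (simp add: algebra_simps)
  then have "W \<le> (J / W) powr (q - 1) * X" unfolding \<mu>q using q by (simp add: field_simps)
  then have "W * (W powr (q - 1) / J powr (q - 1)) \<le> X"
    using W0 J by (simp add: powr_divide field_simps)
  moreover have "W * (W powr (q - 1) / J powr (q - 1)) = W powr q * J powr (1 - q)"
    using W0 powr_minus[of J "q - 1"] by (simp add: powr_diff divide_inverse)
  ultimately show ?thesis by (simp only: X_def)
qed

text \<open>In units of the unit ball this is the volume of the shell between radii k and k + 1,
  which grows one power slower than that of the ball.\<close>

lemma power_Suc_diff_le: "(real k + 1) ^ m - real k ^ m \<le> real m * (real k + 1) ^ (m - 1)"
proof (induction m)
  case (Suc m)
  have "(real k + 1) ^ Suc m - real k ^ Suc m = (real k + 1) ^ m + real k * ((real k + 1) ^ m - real k ^ m)"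
    by (simp add: algebra_simps)
  also have "\<dots> \<le> (real k + 1) ^ m + real k * (real m * (real k + 1) ^ (m - 1))"
    using Suc by (intro add_left_mono mult_left_mono) auto
  also have "real k * (real m * (real k + 1) ^ (m - 1)) \<le> real m * (real k + 1) ^ m"
  proof (cases m)
    case (Suc l)
    have "real k * (real m * (real k + 1) ^ l) \<le> (real k + 1) * (real m * (real k + 1) ^ l)"
      by (intro mult_right_mono) auto
    then show ?thesis by (simp add: Suc mult_ac)
  qed simp
  finally show ?case by (simp add: algebra_simps)
qed simp

text \<open>The exponent may have either sign, so \<open>x\<close> and 1 + s must be comparable in
  both directions; \<open>m\<close> serves as the constant for both.\<close>

lemma powr_comparable:
  fixes a R :: real
  assumes "0 < R"
  shows "\<exists>C>0. \<forall>s x. 0 \<le> s \<and> 1 \<le> x \<and> s + R \<le> x \<and> x \<le> s + R + 1 \<longrightarrow> x powr a \<le> C * (1 + s) powr a"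
proof -
  define m where "m = R + 2 + 1 / R"
  have m: "1 \<le> m" using assms by (simp add: m_def)
  have "x powr a \<le> m powr \<bar>a\<bar> * (1 + s) powr a" if s: "0 \<le> s" "1 \<le> x" "s + R \<le> x" "x \<le> s + R + 1" for s x
  proof (cases "0 \<le> a")
    case True
    have "x \<le> m * (1 + s)"
    proof -
      have "1 * s \<le> m * s" using s m by (intro mult_right_mono) auto
      moreover have "R + 1 \<le> m" using assms by (simp add: m_def)
      ultimately show ?thesis using s(4) unfolding distrib_left mult_1_left mult_1_right by linarith
    qed
    then have "x powr a \<le> (m * (1 + s)) powr a" using True s by (intro powr_mono2) auto
    then show ?thesis using True by (simp add: powr_mult)
  next
    case False
    have "1 + s \<le> m * x"
    proof -
      have "2 * x \<le> m * x" using s assms by (intro mult_right_mono) (auto simp: m_def)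
      then show ?thesis using s assms by linarith
    qed
    then have "(1 + s) powr (- a) \<le> (m * x) powr (- a)" using False s by (intro powr_mono2) auto
    then have "inverse ((1 + s) powr a) \<le> m powr (- a) * inverse (x powr a)" by (simp add: powr_mult powr_minus)
    then show ?thesis using False s by (simp add: field_simps)
  qed
  moreover have "0 < m powr \<bar>a\<bar>" using m by simp
  ultimately show ?thesis by blast
qed

text \<open>The ball is cut into unit shells, across which the assumed bound on the weight varies by
  a bounded factor. The exponential makes the outermost shell dominate the sum, so the power of 1 +
  s is n - 1 from its volume minus \<sigma> q from the weight.\<close>

lemma radial_integral_bound:
  fixes F :: "real \<Rightarrow> real"
  assumes n: "n = real DIM('a::euclidean_space)" and R: "0 < R" and q: "0 < q"
    and cont: "continuous_on UNIV F" and nn: "\<And>z. 0 \<le> z \<Longrightarrow> 0 \<le> F z"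
    and F: "\<And>r. 0 \<le> r \<Longrightarrow> F (r\<^sup>2) \<le> C * (1 + r) powr (- \<sigma>) * exp r" and C: "0 < C" and \<sigma>: "0 \<le> \<sigma>"
  shows "\<exists>D>0. \<forall>s\<ge>0. (LINT x|lebesgue. indicator (cball (0::'a) (s + R)) x * F (x \<bullet> x) powr q)
    \<le> D * (1 + s) powr (n - 1 - \<sigma> * q) * exp (q * s)"
proof -
  define V where "V = measure lborel (ball (0::'a) 1)"
  have V: "0 < V" by (simp add: V_def content_ball_pos)
  have ball: "measure lebesgue (ball (0::'a) r) = r ^ DIM('a) * V" if "0 \<le> r" for r
    using content_ball_conv_unit_ball[OF that, of "0::'a"] by (simp add: V_def measure_completion)
  define shell where "shell k = ball (0::'a) (real k + 1) - ball 0 (real k)" for k :: nat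
  have shell: "shell k \<in> lmeasurable" for k by (simp add: shell_def fmeasurable.Diff)
  have vol: "measure lebesgue (shell k) \<le> V * n * (1 + real k) powr (n - 1)" for k
  proof -
    have "measure lebesgue (shell k) = measure lebesgue (ball (0::'a) (real k + 1)) - measure lebesgue (ball (0::'a) (real k))"
      unfolding shell_def by (intro measurable_measure_Diff) auto
    also have "\<dots> = ((real k + 1) ^ DIM('a) - real k ^ DIM('a)) * V"
      using ball[of "real k + 1"] ball[of "real k"] by (simp only: left_diff_distrib)
    also have "\<dots> \<le> (real DIM('a) * (real k + 1) ^ (DIM('a) - 1)) * V"
      using power_Suc_diff_le V by (intro mult_right_mono) auto
    also have "(real k + 1) ^ (DIM('a) - 1) = (1 + real k) powr (n - 1)"
      by (simp add: n add.commute of_nat_diff flip: powr_realpow)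
    finally show ?thesis by (simp add: n mult_ac)
  qed
  obtain D1 where D1: "D1 > 0" "\<And>K. (\<Sum>k\<le>K. (1 + real k) powr (n - 1 - \<sigma> * q) * exp (q * real k))
      \<le> D1 * (1 + real K) powr (n - 1 - \<sigma> * q) * exp (q * real K)"
    using exp_weighted_sum_bound[OF q, of "n - 1 - \<sigma> * q"] by blast
  obtain D2 where D2: "D2 > 0" "\<And>s x. 0 \<le> s \<Longrightarrow> 1 \<le> x \<Longrightarrow> s + R \<le> x \<Longrightarrow> x \<le> s + R + 1 \<Longrightarrow>
      x powr (n - 1 - \<sigma> * q) \<le> D2 * (1 + s) powr (n - 1 - \<sigma> * q)"
    using powr_comparable[OF R, of "n - 1 - \<sigma> * q"] by blast
  define D where "D = C powr q * exp q * V * n * D1 * D2 * exp (q * R)"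
  have n1: "1 \<le> n" using DIM_positive[where 'a='a] by (simp add: n Suc_leI)
  have "(LINT x|lebesgue. indicator (cball (0::'a) (s + R)) x * F (x \<bullet> x) powr q)
      \<le> D * (1 + s) powr (n - 1 - \<sigma> * q) * exp (q * s)" if s: "0 \<le> s" for s
  proof -
    \<comment> \<open>Index of the outermost shell met by the ball; 1 + K is traded for 1 + s at the
      end, at the price of \<open>D2\<close> and exp(q R).\<close>
    define K where "K = nat \<lfloor>s + R\<rfloor>"
    have K: "real K \<le> s + R" "s + R \<le> 1 + real K" using s R by (auto simp: K_def) linarith
    define c where "c k = C powr q * (1 + real k) powr (- \<sigma> * q) * exp (q * (1 + real k))" for k
    have cnn: "0 \<le> c k" for k by (simp add: c_def)
    have pt: "indicator (cball (0::'a) (s + R)) x * F (x \<bullet> x) powr q \<le> (\<Sum>k\<le>K. c k * indicator (shell k) x)" for x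
    proof (cases "x \<in> cball 0 (s + R)")
      case True
      define k where "k = nat \<lfloor>norm x\<rfloor>"
      have k: "real k \<le> norm x" "norm x < 1 + real k" by (auto simp: k_def) linarith
      have "k \<le> K" using True s R unfolding k_def K_def by (auto intro!: nat_mono floor_mono)
      have "F (x \<bullet> x) powr q \<le> (C * (1 + real k) powr (- \<sigma>) * exp (1 + real k)) powr q"
      proof (intro powr_mono2)
        have "F (x \<bullet> x) \<le> C * (1 + norm x) powr (- \<sigma>) * exp (norm x)"
          using F[of "norm x"] by (simp add: power2_norm_eq_inner)
        also have "\<dots> \<le> C * (1 + real k) powr (- \<sigma>) * exp (1 + real k)"
          using C k \<sigma> by (intro mult_mono powr_mono2') auto
        finally show "F (x \<bullet> x) \<le> C * (1 + real k) powr (- \<sigma>) * exp (1 + real k)" .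
      qed (use q nn in auto)
      also have "\<dots> = c k" by (simp add: c_def powr_mult powr_powr exp_powr_real mult_ac)
      also have "\<dots> = (\<Sum>j\<in>{k}. c j * indicator (shell j) x)" using k by (simp add: shell_def)
      also have "\<dots> \<le> (\<Sum>j\<le>K. c j * indicator (shell j) x)"
        using \<open>k \<le> K\<close> cnn by (intro sum_mono2) auto
      finally show ?thesis using True by simp
    next
      case False
      then show ?thesis using cnn by (simp add: sum_nonneg)
    qed
    have i1: "integrable lebesgue (\<lambda>x::'a. \<Sum>k\<le>K. c k * indicator (shell k) x)"
      using shell by (intro Bochner_Integration.integrable_sum integrable_mult_right) (simp add: lmeasurable_iff_integrable)
    have "(LINT x|lebesgue. indicator (cball (0::'a) (s + R)) x * F (x \<bullet> x) powr q)
        \<le> (LINT x|lebesgue. (\<Sum>k\<le>K. c k * indicator (shell k) (x::'a)))"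
      by (rule integral_mono_AE'[OF i1]) (use pt in \<open>auto intro!: always_eventually sum_nonneg mult_nonneg_nonneg cnn\<close>)
    also have "\<dots> = (\<Sum>k\<le>K. c k * measure lebesgue (shell k))"
      using shell by (subst Bochner_Integration.integral_sum)
        (auto simp: lmeasurable_iff_integrable intro!: sum.cong integrable_mult_right)
    also have "\<dots> \<le> (\<Sum>k\<le>K. c k * (V * n * (1 + real k) powr (n - 1)))"
      by (intro sum_mono mult_left_mono vol cnn)
    also have "\<dots> = C powr q * exp q * V * n * (\<Sum>k\<le>K. (1 + real k) powr (n - 1 - \<sigma> * q) * exp (q * real k))"
    proof -
      have "c k * (V * n * (1 + real k) powr (n - 1)) =
          C powr q * exp q * V * n * ((1 + real k) powr (n - 1 - \<sigma> * q) * exp (q * real k))" for k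
      proof -
        have "(1 + real k) powr (n - 1 - \<sigma> * q) = (1 + real k) powr (- \<sigma> * q) * (1 + real k) powr (n - 1)"
          by (simp flip: powr_add)
        moreover have "exp (q * (1 + real k)) = exp q * exp (q * real k)"
          by (simp add: distrib_left exp_add)
        ultimately show ?thesis unfolding c_def by (simp only: ac_simps)
      qed
      then show ?thesis by (simp only: sum_distrib_left)
    qed
    also have "\<dots> \<le> C powr q * exp q * V * n * (D1 * (1 + real K) powr (n - 1 - \<sigma> * q) * exp (q * real K))"
      using D1(2)[of K] V n1 by (intro mult_left_mono) auto
    also have "\<dots> \<le> C powr q * exp q * V * n * (D1 * (D2 * (1 + s) powr (n - 1 - \<sigma> * q)) * exp (q * (s + R)))"
      using D2(2)[of s "1 + real K"] D2(1) D1(1) V n1 K s q R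
      by (intro mult_left_mono mult_mono mult_nonneg_nonneg) auto
    also have "\<dots> = D * (1 + s) powr (n - 1 - \<sigma> * q) * exp (q * s)"
      by (simp add: D_def distrib_left exp_add)
    finally show ?thesis .
  qed
  moreover have "D > 0" using C V n1 D1 D2 by (simp add: D_def)
  ultimately show ?thesis by blast
qed

subsection \<open>Estimates for one component\<close>

text \<open>The strict inequality z < a leaves a neighbourhood of \<open>z\<close> on which the
  cutoff is 1, so the product has the derivatives of \<open>F\<close> there.\<close>

lemma deriv_cutoff_mult:
  fixes F F1 F2 :: "real \<Rightarrow> real"
  assumes F: "\<And>y. (F has_real_derivative F1 y) (at y)" "\<And>y. (F1 has_real_derivative F2 y) (at y)"
    and f: "\<And>y. y \<le> a \<Longrightarrow> f y = 1" and z: "z < a"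
  shows "deriv (\<lambda>y. f y * F y) z = F1 z" "deriv (deriv (\<lambda>y. f y * F y)) z = F2 z"
proof -
  have 1: "deriv (\<lambda>y. f y * F y) y = F1 y" if "y < a" for y
    by (rule DERIV_imp_deriv, rule has_field_derivative_transform_within_open[OF F(1), where S="{..<a}"])
       (use that f in auto)
  show "deriv (\<lambda>y. f y * F y) z = F1 z" by (rule 1[OF z])
  show "deriv (deriv (\<lambda>y. f y * F y)) z = F2 z"
    by (rule DERIV_imp_deriv, rule has_field_derivative_transform_within_open[OF F(2), where S="{..<a}"])
       (use z 1 in auto)
qed

lemma indicator_cball_L2: "(indicator (cball (0::'a::euclidean_space) R) :: 'a \<Rightarrow> real) \<in> L2"
proof -
  have "integrable lebesgue (indicator (cball (0::'a) R) :: 'a \<Rightarrow> real)"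
    using lmeasurable_cball lmeasurable_iff_integrable by blast
  moreover have "(norm (indicator (cball (0::'a) R) x :: real))\<^sup>2 = indicator (cball 0 R) x" for x
    by (simp add: indicator_def)
  ultimately show ?thesis by (simp add: L2_def borel_measurable_integrable)
qed

text \<open>The weight \<theta> will carry a cutoff that depends on the time horizon, whereas the
  bound depends on the datum and \<open>R\<close> alone; this keeps the final constants
  uniform.\<close>

lemma integral_data_lower_bound:
  fixes w :: "'a::euclidean_space \<Rightarrow> real"
  assumes w: "w \<in> L2" "AE x in lebesgue. 0 \<le> w x" and \<theta>: "(\<lambda>x::'a. \<theta> (x \<bullet> x)) \<in> L2"
    and nn: "\<And>z. 0 \<le> z \<Longrightarrow> 0 \<le> \<theta> z" and one: "\<And>z. 0 \<le> z \<Longrightarrow> z \<le> R\<^sup>2 \<Longrightarrow> 1 \<le> \<theta> z"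
  shows "(LINT x|lebesgue. w x * indicator (cball 0 R) x) \<le> (LINT x|lebesgue. w x * \<theta> (x \<bullet> x))"
proof (rule integral_mono_AE)
  show "integrable lebesgue (\<lambda>x. w x * indicator (cball 0 R) x)"
    by (rule L2_mult_integrable[OF w(1) indicator_cball_L2])
  show "integrable lebesgue (\<lambda>x. w x * \<theta> (x \<bullet> x))"
    by (rule L2_mult_integrable[OF w(1) \<theta>])
  show "AE x in lebesgue. w x * indicator (cball 0 R) x \<le> w x * \<theta> (x \<bullet> x)"
    using w(2)
  proof eventually_elim
    case (elim x)
    have "indicator (cball 0 R) x \<le> \<theta> (x \<bullet> x)"
    proof (cases "x \<in> cball 0 R")
      case True
      then have "(norm x)\<^sup>2 \<le> R\<^sup>2" by (intro power_mono) auto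
      then show ?thesis using True one[of "x \<bullet> x"] by (simp add: power2_norm_eq_inner)
    qed (simp add: nn)
    with elim show ?case by (intro mult_left_mono)
  qed
qed

text \<open>Formulated for a general weight in order to cover both the cut-off constant, with
  \<kappa> = 0, and the cut-off eigenfunction, with \<kappa> = 1.\<close>

lemma damped_moment_of_solution:
  fixes w z :: "real \<Rightarrow> real^'n \<Rightarrow> real" and \<theta> :: "real \<Rightarrow> real"
  assumes L: "0 < L" "ereal L < T" and R: "0 < R" and \<epsilon>: "0 < \<epsilon>"
    and w: "w \<in> C_H1 (lifespan_interval T)" "w \<in> C1_L2 (lifespan_interval T)"
    and supp: "ess_support (lifespan_interval T \<times> UNIV) (\<lambda>(t, x). w t x)
       \<subseteq> {(t, x). t \<in> lifespan_interval T \<and> norm x \<le> t + R}"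
    and z: "(\<lambda>(t, x). z t x) \<in> Lloc p (lifespan_interval T \<times> UNIV)"
    and weak: "weak_damped_wave T b (\<lambda>x. \<epsilon> * w1 x) w (\<lambda>s x. \<bar>z s x\<bar> powr p)"
    and init: "AE x in lebesgue. w 0 x = \<epsilon> * w0 x"
    and b: "continuous_on {0..} b" "\<And>t. 0 \<le> t \<Longrightarrow> 0 \<le> b t"
    and data: "w0 \<in> L2" "w1 \<in> L2" "AE x in lebesgue. 0 \<le> w0 x" "AE x in lebesgue. 0 \<le> w1 x"
    and \<theta>: "smooth \<theta>" "\<And>y. r\<^sup>2 \<le> y \<Longrightarrow> \<theta> y = 0"
    and \<theta>1: "\<And>y. 0 \<le> y \<Longrightarrow> 0 \<le> \<theta> y" "\<And>y. 0 \<le> y \<Longrightarrow> y \<le> R\<^sup>2 \<Longrightarrow> 1 \<le> \<theta> y"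
    and eigen: "\<And>y. 0 \<le> y \<Longrightarrow> y \<le> (L + R)\<^sup>2 \<Longrightarrow>
      2 * real CARD('n) * deriv \<theta> y + 4 * y * deriv (deriv \<theta>) y = \<kappa> * \<theta> y"
  defines "W \<equiv> \<lambda>s. LINT x|lebesgue. w s x * \<theta> (x \<bullet> x)"
    and "P \<equiv> \<lambda>s. LINT x|lebesgue. time_deriv (lifespan_interval T) w s x * \<theta> (x \<bullet> x)"
    and "G \<equiv> \<lambda>t. integral {0..t} (\<lambda>s. LINT x|lebesgue. \<bar>z s x\<bar> powr p * \<theta> (x \<bullet> x))"
    and "a \<equiv> LINT x|lebesgue. \<epsilon> * w1 x * \<theta> (x \<bullet> x)"
  shows "damped_moment b W P G L a \<kappa>"
    and "\<epsilon> * (LINT x|lebesgue. w0 x * indicator (cball 0 R) x) \<le> W 0"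
    and "\<epsilon> * (LINT x|lebesgue. w1 x * indicator (cball 0 R) x) \<le> a"
proof -
  let ?I = "lifespan_interval T"
  have sub: "{0..L} \<subseteq> ?I" by (rule atLeastAtMost_subset_lifespan[OF L(2)])
  have 0: "0 \<in> ?I" using sub L by auto
  have \<theta>2: "(\<lambda>x::real^'n. \<theta> (x \<bullet> x)) \<in> L2"
    by (rule test_function_L2[OF radial_test_function[OF \<theta>]])
  note src = source_integrable(1)[OF z sub \<theta>]
  define g where "g s = (LINT x|lebesgue. \<bar>z s x\<bar> powr p * \<theta> (x \<bullet> x))" for s
  have gnn: "0 \<le> g s" for s
    unfolding g_def by (rule Bochner_Integration.integral_nonneg) (simp add: \<theta>1)
  have gint: "g integrable_on {0..L}"
    using set_lebesgue_integral_eq_integral(1)[OF src] by (simp add: g_def[abs_def])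
  have gint': "g integrable_on {0..t}" if "t \<le> L" for t
    using integrable_on_subinterval[OF gint] that by auto
  have G: "G t = integral {0..t} g" for t by (simp add: G_def g_def[abs_def])
  have data_le: "\<epsilon> * (LINT x|lebesgue. f x * indicator (cball 0 R) x) \<le> \<epsilon> * (LINT x|lebesgue. f x * \<theta> (x \<bullet> x))"
    if "f \<in> L2" "AE x in lebesgue. 0 \<le> f x" for f :: "real^'n \<Rightarrow> real"
    using integral_data_lower_bound[OF that \<theta>2 \<theta>1] \<epsilon> by simp
  have a: "a = \<epsilon> * (LINT x|lebesgue. w1 x * \<theta> (x \<bullet> x))" by (simp add: a_def mult.assoc)
  have W0: "W 0 = \<epsilon> * (LINT x|lebesgue. w0 x * \<theta> (x \<bullet> x))"
  proof -
    have "W 0 = (LINT x|lebesgue. \<epsilon> * (w0 x * \<theta> (x \<bullet> x)))"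
      unfolding W_def
    proof (rule integrable_lebesgue_cong_AE(2))
      show "integrable lebesgue (\<lambda>x. \<epsilon> * (w0 x * \<theta> (x \<bullet> x)))"
        by (intro integrable_mult_right L2_mult_integrable data \<theta>2)
      show "AE x in lebesgue. w 0 x * \<theta> (x \<bullet> x) = \<epsilon> * (w0 x * \<theta> (x \<bullet> x))"
        using init by eventually_elim simp
    qed
    then show ?thesis by simp
  qed
  have nonneg: "0 \<le> (LINT x|lebesgue. f x * indicator (cball 0 R) x)"
    if "AE x in lebesgue. 0 \<le> f x" for f :: "real^'n \<Rightarrow> real"
    by (rule integral_nonneg_AE) (use that in eventually_elim, simp)
  show "\<epsilon> * (LINT x|lebesgue. w0 x * indicator (cball 0 R) x) \<le> W 0"
    unfolding W0 by (rule data_le[OF data(1,3)])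
  show "\<epsilon> * (LINT x|lebesgue. w1 x * indicator (cball 0 R) x) \<le> a"
    unfolding a by (rule data_le[OF data(2,4)])
  show "damped_moment b W P G L a \<kappa>"
  proof
    show "0 \<le> L" using L by simp
    show "continuous_on {0..L} b" by (rule continuous_on_subset[OF b(1)]) auto
    show "0 \<le> b s" if "s \<in> {0..L}" for s using b(2) that by simp
    show "(W has_real_derivative P s) (at s within {0..L})" if s: "s \<in> {0..L}" for s
      unfolding W_def P_def
      by (rule has_field_derivative_subset[OF moment_has_derivative[OF w(2) _ \<theta>2] sub]) (use s sub in auto)
    show "continuous_on {0..L} P"
      unfolding P_def
      by (rule continuous_on_subset[OF moment_continuous[OF _ \<theta>2] sub]) (use w(2) in \<open>simp add: C1_L2_def\<close>)
    show "mono_on {0..L} G"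
      unfolding G by (intro mono_onI integral_subset_le gint') (auto simp: gnn)
    show "0 \<le> G s" if "s \<in> {0..L}" for s
      unfolding G using that by (intro integral_nonneg gint') (auto simp: gnn)
    show "0 \<le> a" unfolding a using data_le[OF data(2,4)] nonneg[OF data(4)] \<epsilon>
      by (meson less_imp_le mult_nonneg_nonneg order_trans)
    show "0 \<le> W 0" unfolding W0 using data_le[OF data(1,3)] nonneg[OF data(3)] \<epsilon>
      by (meson less_imp_le mult_nonneg_nonneg order_trans)
    show "P s + integral {0..s} (\<lambda>r. b r * P r) = a + \<kappa> * integral {0..s} W + G s" if s: "s \<in> {0..L}" for s
      unfolding G_def a_def
      by (rule moment_equation[OF L R w supp weak b(1) \<theta> eigen src W_def[THEN meta_eq_to_obj_eq, THEN fun_cong]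
            P_def[THEN meta_eq_to_obj_eq, THEN fun_cong] s])
  qed
qed


lemma integral_indicator_cball:
  "(LINT x|lebesgue. indicator (cball (0::'a::euclidean_space) r) x * (1::real)) = unit_ball_vol (real DIM('a)) * r ^ DIM('a)"
  if "0 \<le> r"
  using that content_cball[of r "0::'a"] by (simp add: measure_completion)

text \<open>One equation of the system, together with what it needs about the other unknown
  \<open>z\<close>; phrased for a generic pair so that one estimate serves both components.\<close>

definition component_solution ::
  "ereal \<Rightarrow> (real \<Rightarrow> real) \<Rightarrow> real \<Rightarrow> real \<Rightarrow> (real^'n \<Rightarrow> real) \<Rightarrow> (real^'n \<Rightarrow> real)
     \<Rightarrow> real \<Rightarrow> (real \<Rightarrow> real^'n \<Rightarrow> real) \<Rightarrow> real \<Rightarrow> (real \<Rightarrow> real^'n \<Rightarrow> real) \<Rightarrow> bool" where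
  "component_solution T b R \<epsilon> w0 w1 q w p z \<longleftrightarrow>
     w \<in> C_H1 (lifespan_interval T) \<and> w \<in> C1_L2 (lifespan_interval T) \<and>
     (\<lambda>(t, x). w t x) \<in> Lloc q (lifespan_interval T \<times> UNIV) \<and>
     ess_support (lifespan_interval T \<times> UNIV) (\<lambda>(t, x). w t x)
       \<subseteq> {(t, x). t \<in> lifespan_interval T \<and> norm x \<le> t + R} \<and>
     z \<in> C_H1 (lifespan_interval T) \<and>
     (\<lambda>(t, x). z t x) \<in> Lloc p (lifespan_interval T \<times> UNIV) \<and>
     ess_support (lifespan_interval T \<times> UNIV) (\<lambda>(t, x). z t x)
       \<subseteq> {(t, x). t \<in> lifespan_interval T \<and> norm x \<le> t + R} \<and>
     (AE x in lebesgue. w 0 x = \<epsilon> * w0 x) \<and>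
     weak_damped_wave T b (\<lambda>x. \<epsilon> * w1 x) w (\<lambda>s x. \<bar>z s x\<bar> powr p)"

text \<open>Only the first clause concerns the source in the equation for \<open>w\<close>. The
  other two bound the power of \<open>w\<close> that drives the partner equation, so each component
  supplies its partner with lower bounds.\<close>

definition component_bounds ::
  "real \<Rightarrow> real \<Rightarrow> real \<Rightarrow> real \<Rightarrow> (real \<Rightarrow> real^'n \<Rightarrow> real) \<Rightarrow> real \<Rightarrow> (real \<Rightarrow> real^'n \<Rightarrow> real) \<Rightarrow> bool" where
  "component_bounds c \<epsilon> L q w p z \<longleftrightarrow>
     driven L c (\<lambda>s. LINT x|lebesgue. w s x) (\<lambda>s. LINT x|lebesgue. \<bar>z s x\<bar> powr p) \<and>
     (AE s in lebesgue. s \<in> {0..L} \<longrightarrow>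
       c * (1 + s) powr (- real CARD('n) * (q - 1)) * (LINT x|lebesgue. w s x) powr q
         \<le> (LINT x|lebesgue. \<bar>w s x\<bar> powr q)) \<and>
     (AE s in lebesgue. s \<in> {1..L} \<longrightarrow>
       c * \<epsilon> powr q * (1 + s) powr ((real CARD('n) - 1) * (1 - q / 2))
         \<le> (LINT x|lebesgue. \<bar>w s x\<bar> powr q))"

lemma component_estimate:
  fixes w0 w1 :: "real^'n \<Rightarrow> real" and b :: "real \<Rightarrow> real"
  assumes q: "1 < q" and R: "0 < R"
    and b: "continuous_on {0..} b" "set_integrable lebesgue {0..} b" "\<And>t. 0 \<le> t \<Longrightarrow> 0 \<le> b t"
    and data: "w0 \<in> L2" "w1 \<in> L2" "AE x in lebesgue. 0 \<le> w0 x" "AE x in lebesgue. 0 \<le> w1 x"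
    and nontriv: "\<not> ((AE x in lebesgue. w0 x = 0) \<and> (AE x in lebesgue. w1 x = 0))"
    and dsupp: "ess_support UNIV w0 \<subseteq> cball 0 R" "ess_support UNIV w1 \<subseteq> cball 0 R"
  shows "\<exists>c0>0. \<forall>c \<epsilon> L T w z p. 0 < c \<and> c \<le> c0 \<and> 0 < \<epsilon> \<and> 0 < L \<and> ereal L < T \<and>
    component_solution T b R \<epsilon> w0 w1 q w p z \<longrightarrow> component_bounds c \<epsilon> L q w p z"
proof -
  define n where "n = real CARD('n)"
  have n: "1 \<le> n" by (simp add: n_def Suc_leI)
  define q' where "q' = q / (q - 1)"
  have q': "0 < q'" using q by (simp add: q'_def)
  define \<sigma> where "\<sigma> = (n - 1) / 2"
  define F where "F = bessel n 0"
  have dF: "(bessel n j has_real_derivative bessel n (Suc j) y) (at y)" for j y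
    by (rule bessel_deriv[OF n])
  have smF: "smooth F" unfolding F_def by (rule smooth_real_sequence[of "bessel n", OF dF])
  have F1: "1 \<le> F y" if "0 \<le> y" for y unfolding F_def by (rule bessel_ge_1[OF n that])
  obtain C where C: "0 < C" "\<And>r. 0 \<le> r \<Longrightarrow> F (r\<^sup>2) \<le> C * (1 + r) powr (- \<sigma>) * exp r"
    using bessel_upper_bound[OF n] unfolding F_def \<sigma>_def by blast
  have "\<exists>D>0. \<forall>s\<ge>0. (LINT x|lebesgue. indicator (cball (0::real^'n) (s + R)) x * F (x \<bullet> x) powr q')
    \<le> D * (1 + s) powr (n - 1 - \<sigma> * q') * exp (q' * s)"
  proof (rule radial_integral_bound[OF _ R q' smooth_imp_continuous_on[OF smF] _ C(2) C(1)])
    show "n = real DIM(real^'n)" by (simp add: n_def)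
    show "0 \<le> F z" if "0 \<le> z" for z using F1[OF that] by simp
    show "0 \<le> \<sigma>" using n by (simp add: \<sigma>_def)
  qed
  then obtain D where D: "0 < D" "\<And>s. 0 \<le> s \<Longrightarrow>
      (LINT x|lebesgue. indicator (cball (0::real^'n) (s + R)) x * F (x \<bullet> x) powr q')
      \<le> D * (1 + s) powr (n - 1 - \<sigma> * q') * exp (q' * s)" by blast
  \<comment> \<open>From s + R \<le> max(1,R) (1 + s): \<open>D0\<close> times (1 + s)^n bounds the
    volume of the support at time s.\<close>
  define D0 where "D0 = unit_ball_vol n * max 1 R powr n"
  have D0: "0 < D0" using n by (auto simp: D0_def)
  have J0: "(LINT x|lebesgue. indicator (cball (0::real^'n) (s + R)) x * (1::real)) \<le> D0 * (1 + s) powr n"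
    if s: "0 \<le> s" for s
  proof -
    have "1 * s \<le> max 1 R * s" using s by (intro mult_right_mono) auto
    then have "s + R \<le> max 1 R * (1 + s)" by (simp add: distrib_left)
    then have "(s + R) powr n \<le> (max 1 R * (1 + s)) powr n" using s R n by (intro powr_mono2) auto
    then have "(s + R) powr n \<le> max 1 R powr n * (1 + s) powr n" by (simp add: powr_mult)
    moreover have "(s + R) ^ CARD('n) = (s + R) powr n" using s R by (simp add: n_def powr_realpow)
    ultimately have "unit_ball_vol n * (s + R) ^ CARD('n) \<le> unit_ball_vol n * (max 1 R powr n * (1 + s) powr n)"
      using n by (intro mult_left_mono) auto
    then show ?thesis
      using integral_indicator_cball[of "s + R", where 'a="real^'n"] s R by (simp add: D0_def n_def mult.assoc)
  qed
  define I0 where "I0 = (LINT x|lebesgue. w0 x * indicator (cball 0 R) x)"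
  define I1 where "I1 = (LINT x|lebesgue. w1 x * indicator (cball 0 R) x)"
  have Inn: "0 \<le> (LINT x|lebesgue. f x * indicator (cball 0 R) x)"
    if "AE x in lebesgue. 0 \<le> f x" for f :: "real^'n \<Rightarrow> real"
    by (rule integral_nonneg_AE) (use that in eventually_elim, simp)
  have I0: "AE x in lebesgue. f x = 0"
    if f: "f \<in> L2" "AE x in lebesgue. 0 \<le> f x" "ess_support UNIV f \<subseteq> cball 0 R"
      "(LINT x|lebesgue. f x * indicator (cball 0 R) x) = 0" for f :: "real^'n \<Rightarrow> real"
  proof -
    have "AE x in lebesgue. 0 \<le> f x * indicator (cball 0 R) x"
      using f(2) by eventually_elim simp
    then have "AE x in lebesgue. f x * indicator (cball 0 R) x = 0"
      using integral_nonneg_eq_0_iff_AE[OF L2_mult_integrable[OF f(1) indicator_cball_L2]] f(4) by blast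
    then show ?thesis using AE_zero_outside_ess_support[of UNIV f]
      by eventually_elim (use f(3) in \<open>auto simp: indicator_def split: if_splits\<close>)
  qed
  \<comment> \<open>Nontriviality enters here: a nonnegative datum supported in the ball with zero
    integral vanishes almost everywhere, so one summand is positive, though possibly not
    both.\<close>
  define I where "I = I0 + I1"
  have I: "0 < I"
    using Inn[OF data(3)] Inn[OF data(4)] I0[OF data(1,3) dsupp(1)] I0[OF data(2,4) dsupp(2)] nontriv
    unfolding I_def I0_def I1_def by linarith
  define \<beta> where "\<beta> = integral {0..} b"
  have \<beta>: "integral {0..t} b \<le> \<beta>" if "0 \<le> t" for t
    unfolding \<beta>_def
    using set_lebesgue_integral_eq_integral(1)[OF b(2)] b(3) that continuous_on_subset[OF b(1)]
    by (intro integral_subset_le integrable_continuous_real) auto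
  define k where "k = exp (- \<beta>) * I / 4"
  have k: "0 < k" using I by (simp add: k_def)
  \<comment> \<open>The entries serve, in order, the damping, Hoelder with weight 1, and Hoelder
    with the eigenfunction.\<close>
  define c0 where "c0 = min (exp (- \<beta>)) (min (D0 powr (1 - q)) (k powr q * D powr (1 - q)))"
  have "0 < c0" using k D D0 by (simp add: c0_def)
  moreover have "component_bounds c \<epsilon> L q w p z"
    if c: "0 < c" "c \<le> c0" and \<epsilon>: "0 < \<epsilon>" and L: "0 < L" "ereal L < T"
      and sol: "component_solution T b R \<epsilon> w0 w1 q w p z"
    for c \<epsilon> L T w z p
  proof -
    have w: "w \<in> C_H1 (lifespan_interval T)" "w \<in> C1_L2 (lifespan_interval T)"
      and wq: "(\<lambda>(t, x). w t x) \<in> Lloc q (lifespan_interval T \<times> UNIV)"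
      and wsupp: "ess_support (lifespan_interval T \<times> UNIV) (\<lambda>(t, x). w t x)
        \<subseteq> {(t, x). t \<in> lifespan_interval T \<and> norm x \<le> t + R}"
      and zH: "z \<in> C_H1 (lifespan_interval T)"
      and zp: "(\<lambda>(t, x). z t x) \<in> Lloc p (lifespan_interval T \<times> UNIV)"
      and zsupp: "ess_support (lifespan_interval T \<times> UNIV) (\<lambda>(t, x). z t x)
        \<subseteq> {(t, x). t \<in> lifespan_interval T \<and> norm x \<le> t + R}"
      and init: "AE x in lebesgue. w 0 x = \<epsilon> * w0 x"
      and weak: "weak_damped_wave T b (\<lambda>x. \<epsilon> * w1 x) w (\<lambda>s x. \<bar>z s x\<bar> powr p)"
      using sol unfolding component_solution_def by blast+
    let ?I = "lifespan_interval T"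
    have sub: "{0..L} \<subseteq> ?I" by (rule atLeastAtMost_subset_lifespan[OF L(2)])
    have wc: "w \<in> C_L2 ?I" and zc: "z \<in> C_L2 ?I" using w(1) zH C_H1_imp_C_L2 by auto
    have wL: "w s \<in> L2" and zL: "z s \<in> L2" if "s \<in> {0..L}" for s
      using wc zc sub that by (auto simp: C_L2_def)
    \<comment> \<open>Cutoffs act on |x|^2. The margin 1 beyond (L + R)^2 makes also their
      derivatives vanish on the whole closed support.\<close>
    define a where "a = (L + R)\<^sup>2 + 1"
    define r where "r = sqrt (a + 1)"
    have r: "r\<^sup>2 = a + 1" by (simp add: r_def a_def)
    obtain \<chi>' :: "real \<Rightarrow> real" where ch: "smooth \<chi>'" "\<And>x. x \<le> a \<Longrightarrow> \<chi>' x = 1" "\<And>x. x \<ge> a + 1 \<Longrightarrow> \<chi>' x = 0"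
      "\<And>x. 0 \<le> \<chi>' x" "\<And>x. \<chi>' x \<le> 1"
      by (rule smooth_cutoff_below[of a "a + 1"]) auto
    have RL: "R\<^sup>2 \<le> (L + R)\<^sup>2" using L R by (intro power_mono) auto
    have ch0: "\<chi>' y = 0" if "r\<^sup>2 \<le> y" for y using ch(3) that r by simp
    have ch1: "1 \<le> \<chi>' y" if "0 \<le> y" "y \<le> R\<^sup>2" for y using ch(2)[of y] that RL by (simp add: a_def)
    have dch: "deriv \<chi>' y = 0" "deriv (deriv \<chi>') y = 0" if "y \<le> (L + R)\<^sup>2" for y
      using deriv_cutoff_mult[of "\<lambda>_. 1" "\<lambda>_. 0" "\<lambda>_. 0" a \<chi>' y] ch(2) that by (auto simp: a_def)
    have eig0: "2 * real CARD('n) * deriv \<chi>' y + 4 * y * deriv (deriv \<chi>') y = 0 * \<chi>' y"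
      if "0 \<le> y" "y \<le> (L + R)\<^sup>2" for y
      using dch[OF that(2)] by simp
    define \<theta> where "\<theta> y = \<chi>' y * F y" for y
    have \<theta>: "smooth \<theta>" unfolding \<theta>_def[abs_def] by (rule smooth_mult[OF ch(1) smF])
    have \<theta>0: "\<theta> y = 0" if "r\<^sup>2 \<le> y" for y using ch0[OF that] by (simp add: \<theta>_def)
    have \<theta>nn: "0 \<le> \<theta> y" if "0 \<le> y" for y using ch(4)[of y] F1[OF that] by (simp add: \<theta>_def)
    have \<theta>1: "1 \<le> \<theta> y" if "0 \<le> y" "y \<le> R\<^sup>2" for y
      using ch(2)[of y] that RL F1 by (simp add: \<theta>_def a_def)
    have eig1: "2 * real CARD('n) * deriv \<theta> y + 4 * y * deriv (deriv \<theta>) y = 1 * \<theta> y"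
      if y: "0 \<le> y" "y \<le> (L + R)\<^sup>2" for y
    proof -
      have "deriv \<theta> y = bessel n 1 y" "deriv (deriv \<theta>) y = bessel n 2 y"
        using deriv_cutoff_mult[of F "bessel n 1" "bessel n 2" a \<chi>' y] ch(2) y dF[of 0] dF[of 1]
        by (auto simp: \<theta>_def[abs_def] F_def a_def numeral_2_eq_2)
      moreover have "\<theta> y = bessel n 0 y" using ch(2)[of y] y by (simp add: \<theta>_def F_def a_def)
      ultimately show ?thesis using bessel_ode[OF n, of y] by (simp add: n_def)
    qed
    have in_ball: "x \<bullet> x \<le> (L + R)\<^sup>2" if "s \<in> {0..L}" "\<not> s + R < norm x" for s and x :: "real^'n"
      using power_mono[of "norm x" "L + R" 2] that by (auto simp: power2_norm_eq_inner)

    define W0 where "W0 s = (LINT x|lebesgue. w s x * \<chi>' (x \<bullet> x))" for s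
    define P0 where "P0 s = (LINT x|lebesgue. time_deriv ?I w s x * \<chi>' (x \<bullet> x))" for s
    define G0 where "G0 t = integral {0..t} (\<lambda>s. LINT x|lebesgue. \<bar>z s x\<bar> powr p * \<chi>' (x \<bullet> x))" for t
    define W1 where "W1 s = (LINT x|lebesgue. w s x * \<theta> (x \<bullet> x))" for s
    define P1 where "P1 s = (LINT x|lebesgue. time_deriv ?I w s x * \<theta> (x \<bullet> x))" for s
    define G1 where "G1 t = integral {0..t} (\<lambda>s. LINT x|lebesgue. \<bar>z s x\<bar> powr p * \<theta> (x \<bullet> x))" for t
    note sol0 = damped_moment_of_solution[OF L R \<epsilon> w wsupp zp weak init b(1,3) data ch(1) ch0 ch(4) ch1 eig0,
        folded W0_def[abs_def] P0_def[abs_def] G0_def[abs_def]]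
    note sol1 = damped_moment_of_solution[OF L R \<epsilon> w wsupp zp weak init b(1,3) data \<theta> \<theta>0 \<theta>nn \<theta>1 eig1,
        folded W1_def[abs_def] P1_def[abs_def] G1_def[abs_def]]
    interpret M0: damped_moment b W0 P0 G0 L "LINT x|lebesgue. \<epsilon> * w1 x * \<chi>' (x \<bullet> x)" 0
      by (rule sol0(1))
    interpret M1: damped_moment b W1 P1 G1 L "LINT x|lebesgue. \<epsilon> * w1 x * \<theta> (x \<bullet> x)" 1
      by (rule sol1(1))
    have chL2: "(\<lambda>x::real^'n. \<chi>' (x \<bullet> x)) \<in> L2"
      by (rule test_function_L2[OF radial_test_function[OF ch(1) ch0]])
    have \<theta>L2: "(\<lambda>x::real^'n. \<theta> (x \<bullet> x)) \<in> L2"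
      by (rule test_function_L2[OF radial_test_function[OF \<theta> \<theta>0]])

    define U where "U s = (LINT x|lebesgue. w s x)" for s
    have w_ch: "AE x in lebesgue. w s x = w s x * \<chi>' (x \<bullet> x)" if s: "s \<in> {0..L}" for s
    proof -
      have "AE x in lebesgue. s + R < norm x \<longrightarrow> w s x = 0"
        using slice_support[OF wc wsupp, of s] s sub by blast
      then show ?thesis
        by eventually_elim (use in_ball[OF s] ch(2) in \<open>force simp: a_def\<close>)
    qed
    have U: "U s = W0 s" if s: "s \<in> {0..L}" for s
      unfolding U_def W0_def
      by (rule integrable_lebesgue_cong_AE(2)[OF L2_mult_integrable[OF wL[OF s] chL2] w_ch[OF s]])
    have w_int: "integrable lebesgue (w s)" if s: "s \<in> {0..L}" for s
      by (rule integrable_lebesgue_cong_AE(1)[OF L2_mult_integrable[OF wL[OF s] chL2] w_ch[OF s]])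
    define g where "g s = (LINT x|lebesgue. \<bar>z s x\<bar> powr p)" for s
    have g: "g s = (LINT x|lebesgue. \<bar>z s x\<bar> powr p * \<chi>' (x \<bullet> x))" if s: "s \<in> {0..L}" for s
      unfolding g_def
    proof (rule integral_cong_AE)
      have [measurable]: "z s \<in> borel_measurable lebesgue" by (rule L2_measurable[OF zL[OF s]])
      have [measurable]: "(\<lambda>x::real^'n. \<chi>' (x \<bullet> x)) \<in> borel_measurable lebesgue" by (rule L2_measurable[OF chL2])
      show "(\<lambda>x. \<bar>z s x\<bar> powr p) \<in> borel_measurable lebesgue" by measurable
      then show "(\<lambda>x. \<bar>z s x\<bar> powr p * \<chi>' (x \<bullet> x)) \<in> borel_measurable lebesgue" by measurable
      have "AE x in lebesgue. s + R < norm x \<longrightarrow> z s x = 0"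
        using slice_support[OF zc zsupp, of s] s sub by blast
      then show "AE x in lebesgue. \<bar>z s x\<bar> powr p = \<bar>z s x\<bar> powr p * \<chi>' (x \<bullet> x)"
        by eventually_elim (use in_ball[OF s] ch(2) in \<open>force simp: a_def\<close>)
    qed
    have G0: "G0 t = integral {0..t} g" if "t \<in> {0..L}" for t
      unfolding G0_def by (rule integral_cong) (use that g in auto)
    have driven: "driven L c U g"
      unfolding driven_def
    proof (intro conjI exI[of _ P0] ballI allI)
      show "0 \<le> U 0" using U[of 0] M0.W0 L by simp
      have "(\<lambda>s. LINT x|lebesgue. \<bar>z s x\<bar> powr p * \<chi>' (x \<bullet> x)) integrable_on {0..L}"
        by (rule set_lebesgue_integral_eq_integral(1)[OF source_integrable(1)[OF zp sub ch(1) ch0]])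
      then show "g integrable_on {0..L}"
        by (rule integrable_eq) (simp add: g)
      show "0 \<le> g s" for s unfolding g_def by (rule Bochner_Integration.integral_nonneg) simp
    next
      fix t assume t: "t \<in> {0..L}"
      show "(U has_real_derivative P0 t) (at t within {0..L})"
        by (rule has_field_derivative_transform_within[OF M0.W[OF t], where d=1]) (use t U in auto)
      interpret Mt: damped_moment b W0 P0 G0 t "LINT x|lebesgue. \<epsilon> * w1 x * \<chi>' (x \<bullet> x)" 0
        by (rule M0.restrict) (use t in auto)
      have G: "0 \<le> G0 t" using M0.G(2)[OF t] .
      have 1: "G0 t \<le> exp (integral {0..t} b) * P0 t" using Mt.growth_free Mt.a by simp
      \<comment> \<open>The sign of \<open>P0\<close> has to be known before the integral of
        \<open>b\<close> over [0,t] can be enlarged to \<beta>.\<close>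
      then have "0 \<le> P0 t" using G by (meson exp_gt_zero order_trans zero_le_mult_iff not_less)
      then have "G0 t \<le> exp \<beta> * P0 t"
        using 1 \<beta>[of t] t by (meson atLeastAtMost_iff exp_le_cancel_iff mult_right_mono order_trans)
      then have "exp (- \<beta>) * G0 t \<le> P0 t" by (simp add: exp_minus field_simps)
      moreover have "c * G0 t \<le> exp (- \<beta>) * G0 t" using c G by (intro mult_right_mono) (auto simp: c0_def)
      ultimately show "c * integral {0..t} g \<le> P0 t" using G0[OF t] by simp
    qed
    have Unn: "0 \<le> U s" if "s \<in> {0..L}" for s
      using driven_nonneg[OF driven c(1)] that by auto
    have "AE s in lebesgue. s \<in> {0..L} \<longrightarrow> integrable lebesgue (\<lambda>x. \<bar>w s x\<bar> powr q * \<chi>' (x \<bullet> x))"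
      by (rule source_integrable(2)[OF wq sub ch(1) ch0])
    then have wq_int: "AE s in lebesgue. s \<in> {0..L} \<longrightarrow> integrable lebesgue (\<lambda>x. \<bar>w s x\<bar> powr q)"
    proof eventually_elim
      case (elim s)
      show ?case
      proof
        assume s: "s \<in> {0..L}"
        have "AE x in lebesgue. s + R < norm x \<longrightarrow> w s x = 0"
          using slice_support[OF wc wsupp, of s] s sub by blast
        then have "AE x in lebesgue. \<bar>w s x\<bar> powr q = \<bar>w s x\<bar> powr q * \<chi>' (x \<bullet> x)"
          by eventually_elim (use in_ball[OF s] ch(2) in \<open>force simp: a_def\<close>)
        from integrable_lebesgue_cong_AE(1)[OF elim[rule_format, OF s] this]
        show "integrable lebesgue (\<lambda>x. \<bar>w s x\<bar> powr q)" .
      qed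
    qed
    have outside: "AE x in lebesgue. x \<notin> cball 0 (s + R) \<longrightarrow> w s x = 0" if "s \<in> {0..L}" for s
    proof -
      have "AE x in lebesgue. s + R < norm x \<longrightarrow> w s x = 0"
        using slice_support[OF wc wsupp, of s] that sub by blast
      then show ?thesis by eventually_elim auto
    qed
    have h0: "AE s in lebesgue. s \<in> {0..L} \<longrightarrow>
        c * (1 + s) powr (- n * (q - 1)) * U s powr q \<le> (LINT x|lebesgue. \<bar>w s x\<bar> powr q)"
      using wq_int
    proof eventually_elim
      case (elim s)
      show ?case
      proof
        assume s: "s \<in> {0..L}"
        have "U s powr q * (D0 * (1 + s) powr n) powr (1 - q) \<le> (LINT x|lebesgue. \<bar>w s x\<bar> powr q)"
        proof (rule Holder_lower_bound[OF q, where \<Phi>="\<lambda>_. 1"])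
          show "integrable lebesgue (\<lambda>x. \<bar>w s x\<bar> powr q)" using elim s by blast
          show "integrable lebesgue (\<lambda>x. w s x * 1)" using w_int[OF s] by simp
          show "integrable lebesgue (\<lambda>x::real^'n. indicator (cball 0 (s + R)) x * 1 powr (q / (q - 1)))"
            using lmeasurable_iff_integrable[THEN iffD1, OF lmeasurable_cball] by simp
          show "(LINT x|lebesgue. indicator (cball (0::real^'n) (s + R)) x * 1 powr (q / (q - 1))) \<le> D0 * (1 + s) powr n"
            using J0[of s] s by simp
        qed (use outside[OF s] Unn[OF s] D0 s in \<open>auto simp: U_def\<close>)
        moreover have "(D0 * (1 + s) powr n) powr (1 - q) = D0 powr (1 - q) * (1 + s) powr (- n * (q - 1))"
          by (simp add: powr_mult powr_powr algebra_simps)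
        moreover have "c * ((1 + s) powr (- n * (q - 1)) * U s powr q)
            \<le> D0 powr (1 - q) * ((1 + s) powr (- n * (q - 1)) * U s powr q)"
          using c by (intro mult_right_mono) (auto simp: c0_def)
        ultimately show "c * (1 + s) powr (- n * (q - 1)) * U s powr q \<le> (LINT x|lebesgue. \<bar>w s x\<bar> powr q)"
          by (simp add: mult_ac)
      qed
    qed
    have h1: "AE s in lebesgue. s \<in> {1..L} \<longrightarrow>
        c * \<epsilon> powr q * (1 + s) powr ((n - 1) * (1 - q / 2)) \<le> (LINT x|lebesgue. \<bar>w s x\<bar> powr q)"
      using wq_int
    proof eventually_elim
      case (elim s)
      show ?case
      proof
        assume s1: "s \<in> {1..L}"
        then have s: "s \<in> {0..L}" by auto
        interpret Ms: damped_moment b W1 P1 G1 s "LINT x|lebesgue. \<epsilon> * w1 x * \<theta> (x \<bullet> x)" 1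
          by (rule M1.restrict) (use s in auto)
        have I\<epsilon>: "\<epsilon> * I \<le> W1 0 + (LINT x|lebesgue. \<epsilon> * w1 x * \<theta> (x \<bullet> x))"
          using sol1(2,3)[of r] by (simp add: I_def I0_def I1_def W1_def distrib_left)
        have pos: "0 < \<epsilon> * I" using \<epsilon> I by simp
        have "exp (- \<beta>) * (W1 0 + (LINT x|lebesgue. \<epsilon> * w1 x * \<theta> (x \<bullet> x))) / 4 * exp s \<le> W1 s"
          by (rule Ms.exponential_lower_bound) (use I\<epsilon> pos \<beta>[of s] s1 in auto)
        moreover have "exp (- \<beta>) * (\<epsilon> * I) / 4 * exp s \<le>
            exp (- \<beta>) * (W1 0 + (LINT x|lebesgue. \<epsilon> * w1 x * \<theta> (x \<bullet> x))) / 4 * exp s"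
          using I\<epsilon> by (intro mult_right_mono divide_right_mono mult_left_mono) auto
        ultimately have "exp (- \<beta>) * (\<epsilon> * I) / 4 * exp s \<le> W1 s" by (rule order_trans[rotated])
        moreover have "k * \<epsilon> * exp s = exp (- \<beta>) * (\<epsilon> * I) / 4 * exp s" by (simp add: k_def mult_ac)
        ultimately have low: "k * \<epsilon> * exp s \<le> W1 s" by (simp only:)
        have wF: "AE x in lebesgue. w s x * F (x \<bullet> x) = w s x * \<theta> (x \<bullet> x)"
          using w_ch[OF s] by eventually_elim (auto simp: \<theta>_def)
        note w\<theta> = L2_mult_integrable[OF wL[OF s] \<theta>L2]
        have J: "(LINT x|lebesgue. indicator (cball (0::real^'n) (s + R)) x * F (x \<bullet> x) powr q')
            \<le> D * (1 + s) powr (n - 1 - \<sigma> * q') * exp (q' * s)" using D(2) s by auto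
        have "(k * \<epsilon> * exp s) powr q * (D * (1 + s) powr (n - 1 - \<sigma> * q') * exp (q' * s)) powr (1 - q)
            \<le> (LINT x|lebesgue. \<bar>w s x\<bar> powr q)"
        proof (rule Holder_lower_bound[OF q, where \<Phi>="\<lambda>x. if 0 \<le> x \<bullet> x then F (x \<bullet> x) else 0" and A="cball 0 (s + R)"])
          show "integrable lebesgue (\<lambda>x. \<bar>w s x\<bar> powr q)" using elim s by blast
          show "integrable lebesgue (\<lambda>x. w s x * (if 0 \<le> x \<bullet> x then F (x \<bullet> x) else 0))"
            using integrable_lebesgue_cong_AE(1)[OF w\<theta> wF] by simp
          have "continuous_on (cball 0 (s + R)) (\<lambda>x::real^'n. F (x \<bullet> x) powr q')"
            by (intro continuous_on_powr' continuous_on_const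
                smooth_imp_continuous_on[OF smooth_compose[OF smF smooth_inner_self]])
               (use F1 q' in \<open>auto intro: order_trans[OF zero_le_one]\<close>)
          from borel_integrable_compact[OF compact_cball this]
          have i: "integrable lborel (\<lambda>x::real^'n. indicator (cball 0 (s + R)) x *\<^sub>R F (x \<bullet> x) powr q')" .
          have "integrable lebesgue (\<lambda>x::real^'n. indicator (cball 0 (s + R)) x *\<^sub>R F (x \<bullet> x) powr q')"
            using integrable_completion[OF borel_measurable_integrable[OF i]] i by simp
          then show "integrable lebesgue (\<lambda>x::real^'n. indicator (cball 0 (s + R)) x * (if 0 \<le> x \<bullet> x then F (x \<bullet> x) else 0) powr (q / (q - 1)))"
            by (simp add: q'_def)
          show "k * \<epsilon> * exp s \<le> (LINT x|lebesgue. w s x * (if 0 \<le> x \<bullet> x then F (x \<bullet> x) else 0))"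
            using low integrable_lebesgue_cong_AE(2)[OF w\<theta> wF] by (simp add: W1_def)
          show "(LINT x|lebesgue. indicator (cball (0::real^'n) (s + R)) x * (if 0 \<le> x \<bullet> x then F (x \<bullet> x) else 0) powr (q / (q - 1)))
              \<le> D * (1 + s) powr (n - 1 - \<sigma> * q') * exp (q' * s)"
            using J by (simp add: q'_def)
          show "0 \<le> (if 0 \<le> x \<bullet> x then F (x \<bullet> x) else 0)" for x :: "real^'n"
            using F1[of "x \<bullet> x"] by simp
        qed (use outside[OF s] D s k \<epsilon> in auto)
        moreover have "(k * \<epsilon> * exp s) powr q * (D * (1 + s) powr (n - 1 - \<sigma> * q') * exp (q' * s)) powr (1 - q)
            = k powr q * D powr (1 - q) * (\<epsilon> powr q * (1 + s) powr ((n - 1) * (1 - q / 2)))"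
        proof -
          \<comment> \<open>This identity makes the exponential growth of the moment cancel that of
            the dual integral exactly; with \<sigma> = (n-1)/2 only the power (n-1)(1-q/2) of 1 + s
            survives.\<close>
          have qq: "q' * (q - 1) = q" using q by (simp add: q'_def)
          have e1: "(n - 1 - \<sigma> * q') * (1 - q) = (n - 1) * (1 - q / 2)"
          proof -
            have "(n - 1 - \<sigma> * q') * (1 - q) = (n - 1) * (1 - q) + \<sigma> * (q' * (q - 1))"
              by (simp add: algebra_simps)
            then show ?thesis by (simp only: qq \<sigma>_def) (simp add: field_simps)
          qed
          have "(q' * s) * (1 - q) = - (q' * (q - 1)) * s" by (simp add: algebra_simps)
          then have e2: "exp s powr q * exp (q' * s) powr (1 - q) = 1"
            unfolding exp_powr_real qq by (simp add: mult_exp_exp mult.commute)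
          have "(k * \<epsilon> * exp s) powr q * (D * (1 + s) powr (n - 1 - \<sigma> * q') * exp (q' * s)) powr (1 - q)
            = k powr q * D powr (1 - q) * (\<epsilon> powr q * (1 + s) powr ((n - 1 - \<sigma> * q') * (1 - q)))
              * (exp s powr q * exp (q' * s) powr (1 - q))"
            by (simp only: powr_mult powr_powr ac_simps)
          then show ?thesis by (simp only: e1 e2 mult_1_right)
        qed
        moreover have "c * (\<epsilon> powr q * (1 + s) powr ((n - 1) * (1 - q / 2))) \<le>
            k powr q * D powr (1 - q) * (\<epsilon> powr q * (1 + s) powr ((n - 1) * (1 - q / 2)))"
          using c by (intro mult_right_mono) (auto simp: c0_def)
        ultimately show "c * \<epsilon> powr q * (1 + s) powr ((n - 1) * (1 - q / 2)) \<le> (LINT x|lebesgue. \<bar>w s x\<bar> powr q)"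
          by (simp add: mult.assoc)
      qed
    qed
    show ?thesis
      using driven h0 h1 unfolding component_bounds_def U_def[abs_def] g_def[abs_def] n_def by blast
  qed
  ultimately show ?thesis by blast
qed

section \<open>The lifespan bound for the system\<close>

lemma energy_solution_swap:
  "energy_solution b1 b2 p q u0 u1 v0 v1 \<epsilon> T u v \<Longrightarrow> energy_solution b2 b1 q p v0 v1 u0 u1 \<epsilon> T v u"
  by (simp add: energy_solution_def)

text \<open>The iteration is run on the mass of \<open>u\<close>, whose source is the power p of
  \<open>v\<close> and starts at size \<epsilon>^p; this order of the components leads to the
  exponent with \<open>q\<close> before \<open>p\<close>. Every time \<open>L\<close> before
  \<open>T\<close> is bounded, so no finiteness of \<open>T\<close> is presupposed.\<close>

lemma existence_time_bound:
  fixes b1 b2 :: "real \<Rightarrow> real"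
    and u0 u1 v0 v1 :: "real^'n \<Rightarrow> real"
  assumes b1: "continuous_on {0..} b1" "set_integrable lebesgue {0..} b1" "\<And>t. 0 \<le> t \<Longrightarrow> 0 \<le> b1 t"
    and b2: "continuous_on {0..} b2" "set_integrable lebesgue {0..} b2" "\<And>t. 0 \<le> t \<Longrightarrow> 0 \<le> b2 t"
    and pq: "1 < p" "1 < q"
    and F: "0 < lifespan_F CARD('n) q p"
    and R: "0 < R"
    and spaces: "u0 \<in> L2" "v0 \<in> L2" "u1 \<in> L2" "v1 \<in> L2"
    and nonneg: "AE x in lebesgue. 0 \<le> u0 x" "AE x in lebesgue. 0 \<le> u1 x"
      "AE x in lebesgue. 0 \<le> v0 x" "AE x in lebesgue. 0 \<le> v1 x"
    and nontrivial:
      "\<not> ((AE x in lebesgue. u0 x = 0) \<and> (AE x in lebesgue. u1 x = 0))"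
      "\<not> ((AE x in lebesgue. v0 x = 0) \<and> (AE x in lebesgue. v1 x = 0))"
    and support: "ess_support UNIV u0 \<subseteq> cball 0 R" "ess_support UNIV u1 \<subseteq> cball 0 R"
      "ess_support UNIV v0 \<subseteq> cball 0 R" "ess_support UNIV v1 \<subseteq> cball 0 R"
  shows "\<exists>C>0. \<forall>\<epsilon> (T::ereal) u v L. 0 < \<epsilon> \<and> \<epsilon> \<le> 1 \<and> 0 < L \<and> ereal L < T \<and>
       energy_solution b1 b2 p q u0 u1 v0 v1 \<epsilon> T u v \<and>
       ess_support (lifespan_interval T \<times> UNIV) (\<lambda>(t, x). u t x)
         \<subseteq> {(t, x). t \<in> lifespan_interval T \<and> norm x \<le> t + R} \<and>
       ess_support (lifespan_interval T \<times> UNIV) (\<lambda>(t, x). v t x)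
         \<subseteq> {(t, x). t \<in> lifespan_interval T \<and> norm x \<le> t + R}
       \<longrightarrow> L \<le> C * \<epsilon> powr (- inverse (lifespan_F CARD('n) q p))"
proof -
  obtain cu where cu: "cu > 0" and u_est: "\<And>c \<epsilon> L T w z p. 0 < c \<and> c \<le> cu \<and> 0 < \<epsilon> \<and> 0 < L \<and> ereal L < T \<and>
      component_solution T b1 R \<epsilon> u0 u1 q w p z \<Longrightarrow> component_bounds c \<epsilon> L q w p z"
    using component_estimate[OF pq(2) R b1 spaces(1,3) nonneg(1,2) nontrivial(1) support(1,2)] by blast
  obtain cv where cv: "cv > 0" and v_est: "\<And>c \<epsilon> L T w z q. 0 < c \<and> c \<le> cv \<and> 0 < \<epsilon> \<and> 0 < L \<and> ereal L < T \<and>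
      component_solution T b2 R \<epsilon> v0 v1 p w q z \<Longrightarrow> component_bounds c \<epsilon> L p w q z"
    using component_estimate[OF pq(1) R b2 spaces(2,4) nonneg(3,4) nontrivial(2) support(3,4)] by blast
  define c where "c = min cu cv"
  have c: "0 < c" "c \<le> cu" "c \<le> cv" using cu cv by (auto simp: c_def)
  define F where "F = lifespan_F CARD('n) q p"
  have Feq: "F = (q + 2 + inverse p) / (p * q - 1) - (real CARD('n) - 1) / 2"
    by (simp add: F_def lifespan_F_def mult.commute)
  have n: "1 \<le> real CARD('n)" by (simp add: Suc_leI)
  obtain C where C: "C > 0" and bound: "\<And>\<epsilon> L U V g h. 0 < \<epsilon> \<and> \<epsilon> \<le> 1 \<and> 0 \<le> L \<and> driven L c U g \<and> driven L c V h \<and>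
      (AE r in lebesgue. r \<in> {0..L} \<longrightarrow> c * (1 + r) powr (- real CARD('n) * (p - 1)) * V r powr p \<le> g r) \<and>
      (AE r in lebesgue. r \<in> {0..L} \<longrightarrow> c * (1 + r) powr (- real CARD('n) * (q - 1)) * U r powr q \<le> h r) \<and>
      (AE r in lebesgue. r \<in> {1..L} \<longrightarrow> c * \<epsilon> powr p * (1 + r) powr ((real CARD('n) - 1) * (1 - p / 2)) \<le> g r)
      \<Longrightarrow> L \<le> C * \<epsilon> powr (- inverse F)"
    using coupled_lifespan_bound[OF pq c(1) n Feq F[folded F_def]] by blast
  have "L \<le> C * \<epsilon> powr (- inverse F)"
    if \<epsilon>: "0 < \<epsilon>" "\<epsilon> \<le> 1" and L: "0 < L" "ereal L < T"
      and sol: "energy_solution b1 b2 p q u0 u1 v0 v1 \<epsilon> T u v"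
      and us: "ess_support (lifespan_interval T \<times> UNIV) (\<lambda>(t, x). u t x)
         \<subseteq> {(t, x). t \<in> lifespan_interval T \<and> norm x \<le> t + R}"
      and vs: "ess_support (lifespan_interval T \<times> UNIV) (\<lambda>(t, x). v t x)
         \<subseteq> {(t, x). t \<in> lifespan_interval T \<and> norm x \<le> t + R}" for \<epsilon> T u v L
  proof -
    have "component_solution T b1 R \<epsilon> u0 u1 q u p v" "component_solution T b2 R \<epsilon> v0 v1 p v q u"
      using sol us vs unfolding energy_solution_def component_solution_def by blast+
    then have u: "component_bounds c \<epsilon> L q u p v" and v: "component_bounds c \<epsilon> L p v q u"
      using u_est v_est c \<epsilon> L by blast+
    show ?thesis
      using bound[of \<epsilon> L "\<lambda>s. LINT x|lebesgue. u s x" "\<lambda>s. LINT x|lebesgue. \<bar>v s x\<bar> powr p"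
          "\<lambda>s. LINT x|lebesgue. v s x" "\<lambda>s. LINT x|lebesgue. \<bar>u s x\<bar> powr q"] u v \<epsilon> L(1)
      by (simp only: component_bounds_def less_imp_le simp_thms)
  qed
  with C show ?thesis unfolding F_def by blast
qed

theorem theorem1p2:
  fixes b1 b2 :: "real \<Rightarrow> real"
    and p q R :: real
    and u0 u1 v0 v1 :: "real^'n \<Rightarrow> real"
  assumes b1: "continuous_on {0..} b1" "set_integrable lebesgue {0..} b1" "\<And>t. 0 \<le> t \<Longrightarrow> 0 \<le> b1 t"
    and b2: "continuous_on {0..} b2" "set_integrable lebesgue {0..} b2" "\<And>t. 0 \<le> t \<Longrightarrow> 0 \<le> b2 t"
    and pq: "1 < p" "1 < q"
    and subcritical:
      "max ((p + 2 + inverse q) / (p * q - 1)) ((q + 2 + inverse p) / (p * q - 1))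
         > (real CARD('n) - 1) / 2"
    and R: "0 < R"
    and spaces: "u0 \<in> H1" "v0 \<in> H1" "u1 \<in> L2" "v1 \<in> L2"
    and nonneg: "AE x in lebesgue. 0 \<le> u0 x" "AE x in lebesgue. 0 \<le> u1 x"
      "AE x in lebesgue. 0 \<le> v0 x" "AE x in lebesgue. 0 \<le> v1 x"
    and nontrivial:
      "\<not> ((AE x in lebesgue. u0 x = 0) \<and> (AE x in lebesgue. u1 x = 0))"
      "\<not> ((AE x in lebesgue. v0 x = 0) \<and> (AE x in lebesgue. v1 x = 0))"
    and support: "ess_support UNIV u0 \<subseteq> cball 0 R" "ess_support UNIV u1 \<subseteq> cball 0 R"
      "ess_support UNIV v0 \<subseteq> cball 0 R" "ess_support UNIV v1 \<subseteq> cball 0 R"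
  shows "\<exists>\<epsilon>0>0. \<exists>C>0. \<forall>\<epsilon>. 0 < \<epsilon> \<and> \<epsilon> \<le> \<epsilon>0 \<longrightarrow>
    (\<forall>(T::ereal) u v.
       energy_solution b1 b2 p q u0 u1 v0 v1 \<epsilon> T u v \<and>
       ess_support (lifespan_interval T \<times> UNIV) (\<lambda>(t, x). u t x)
         \<subseteq> {(t, x). t \<in> lifespan_interval T \<and> norm x \<le> t + R} \<and>
       ess_support (lifespan_interval T \<times> UNIV) (\<lambda>(t, x). v t x)
         \<subseteq> {(t, x). t \<in> lifespan_interval T \<and> norm x \<le> t + R}
       \<longrightarrow> T < \<infinity> \<and>
           T \<le> ereal (C * \<epsilon> powr
                 - inverse (max (lifespan_F CARD('n) p q) (lifespan_F CARD('n) q p))))"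
proof -
  define Fm where "Fm = max (lifespan_F CARD('n) p q) (lifespan_F CARD('n) q p)"
  have data: "u0 \<in> L2" "v0 \<in> L2" using spaces by (auto simp: H1_def)
  have Fm: "0 < Fm" using subcritical by (auto simp: Fm_def lifespan_F_def mult.commute less_max_iff_disj)
  have "\<exists>C>0. \<forall>\<epsilon> (T::ereal) u v L. 0 < \<epsilon> \<and> \<epsilon> \<le> 1 \<and> 0 < L \<and> ereal L < T \<and>
       energy_solution b1 b2 p q u0 u1 v0 v1 \<epsilon> T u v \<and>
       ess_support (lifespan_interval T \<times> UNIV) (\<lambda>(t, x). u t x)
         \<subseteq> {(t, x). t \<in> lifespan_interval T \<and> norm x \<le> t + R} \<and>
       ess_support (lifespan_interval T \<times> UNIV) (\<lambda>(t, x). v t x)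
         \<subseteq> {(t, x). t \<in> lifespan_interval T \<and> norm x \<le> t + R}
       \<longrightarrow> L \<le> C * \<epsilon> powr (- inverse Fm)"
  proof (cases "lifespan_F CARD('n) p q \<le> lifespan_F CARD('n) q p")
    case True
    then have "Fm = lifespan_F CARD('n) q p" by (simp add: Fm_def)
    then show ?thesis
      using existence_time_bound[OF b1 b2 pq _ R data(1,2) spaces(3,4) nonneg nontrivial support] Fm by simp
  next
    \<comment> \<open>Exchanging the equations together with p and q brings the larger exponent into
      the position treated by \<open>existence_time_bound\<close>.\<close>
    case False
    then have Feq: "Fm = lifespan_F CARD('n) p q" by (simp add: Fm_def)
    with Fm have "0 < lifespan_F CARD('n) p q" by simp
    from existence_time_bound[OF b2 b1 pq(2,1) this R data(2,1) spaces(4,3) nonneg(3,4,1,2)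
        nontrivial(2,1) support(3,4,1,2)]
    obtain C where C: "C > 0" "\<forall>\<epsilon> (T::ereal) u v L. 0 < \<epsilon> \<and> \<epsilon> \<le> 1 \<and> 0 < L \<and> ereal L < T \<and>
       energy_solution b2 b1 q p v0 v1 u0 u1 \<epsilon> T u v \<and>
       ess_support (lifespan_interval T \<times> UNIV) (\<lambda>(t, x). u t x)
         \<subseteq> {(t, x). t \<in> lifespan_interval T \<and> norm x \<le> t + R} \<and>
       ess_support (lifespan_interval T \<times> UNIV) (\<lambda>(t, x). v t x)
         \<subseteq> {(t, x). t \<in> lifespan_interval T \<and> norm x \<le> t + R}
       \<longrightarrow> L \<le> C * \<epsilon> powr (- inverse Fm)"
      unfolding Feq by blast
    show ?thesis
    proof (rule exI[of _ C], rule conjI[OF C(1)], intro allI impI, elim conjE)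
      fix \<epsilon> T u v L
      assume "0 < \<epsilon>" "\<epsilon> \<le> 1" "0 < L" "ereal L < T" and
        sol: "energy_solution b1 b2 p q u0 u1 v0 v1 \<epsilon> T u v" and
        "ess_support (lifespan_interval T \<times> UNIV) (\<lambda>(t, x). u t x)
         \<subseteq> {(t, x). t \<in> lifespan_interval T \<and> norm x \<le> t + R}"
        "ess_support (lifespan_interval T \<times> UNIV) (\<lambda>(t, x). v t x)
         \<subseteq> {(t, x). t \<in> lifespan_interval T \<and> norm x \<le> t + R}"
      then show "L \<le> C * \<epsilon> powr (- inverse Fm)"
        using C(2) energy_solution_swap[OF sol] by blast
    qed
  qed
  then obtain C where C: "C > 0" and bound: "\<And>\<epsilon> (T::ereal) u v L. 0 < \<epsilon> \<and> \<epsilon> \<le> 1 \<and> 0 < L \<and> ereal L < T \<and>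
       energy_solution b1 b2 p q u0 u1 v0 v1 \<epsilon> T u v \<and>
       ess_support (lifespan_interval T \<times> UNIV) (\<lambda>(t, x). u t x)
         \<subseteq> {(t, x). t \<in> lifespan_interval T \<and> norm x \<le> t + R} \<and>
       ess_support (lifespan_interval T \<times> UNIV) (\<lambda>(t, x). v t x)
         \<subseteq> {(t, x). t \<in> lifespan_interval T \<and> norm x \<le> t + R}
       \<Longrightarrow> L \<le> C * \<epsilon> powr (- inverse Fm)" by blast
  have "T \<le> ereal (C * \<epsilon> powr - inverse Fm)"
    if \<epsilon>: "0 < \<epsilon>" "\<epsilon> \<le> 1" and sol: "energy_solution b1 b2 p q u0 u1 v0 v1 \<epsilon> T u v"
      and us: "ess_support (lifespan_interval T \<times> UNIV) (\<lambda>(t, x). u t x)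
         \<subseteq> {(t, x). t \<in> lifespan_interval T \<and> norm x \<le> t + R}"
      and vs: "ess_support (lifespan_interval T \<times> UNIV) (\<lambda>(t, x). v t x)
         \<subseteq> {(t, x). t \<in> lifespan_interval T \<and> norm x \<le> t + R}" for \<epsilon> T u v
  proof (rule ccontr)
    \<comment> \<open>A time strictly between the claimed bound and \<open>T\<close> would violate
      the estimate valid for all times before \<open>T\<close>; this includes an infinite
      \<open>T\<close>.\<close>
    assume "\<not> T \<le> ereal (C * \<epsilon> powr - inverse Fm)"
    then have "ereal (C * \<epsilon> powr - inverse Fm) < T" by simp
    then obtain L where L: "C * \<epsilon> powr - inverse Fm < L" "ereal L < T"
      using lifespan_interval_upper by blast
    have "0 < C * \<epsilon> powr - inverse Fm" using C \<epsilon> by simp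
    with L bound[of \<epsilon> L T u v] \<epsilon> sol us vs show False by auto
  qed
  note le = this
  have fin: "T < \<infinity>" if "T \<le> ereal x" for T x
    using that by (rule le_less_trans) simp
  show ?thesis
  \<comment> \<open>The threshold for \<epsilon> can be 1: smallness serves only to make the power
    of \<epsilon> at least 1 for short times, and the dependence on the data sits in
    \<open>C\<close>.\<close>
  proof (rule exI[of _ 1], rule conjI[OF zero_less_one], rule exI[of _ C], rule conjI[OF C], intro allI impI)
    fix \<epsilon> T u v
    assume "0 < \<epsilon> \<and> \<epsilon> \<le> 1" and "energy_solution b1 b2 p q u0 u1 v0 v1 \<epsilon> T u v \<and>
       ess_support (lifespan_interval T \<times> UNIV) (\<lambda>(t, x). u t x)
         \<subseteq> {(t, x). t \<in> lifespan_interval T \<and> norm x \<le> t + R} \<and>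
       ess_support (lifespan_interval T \<times> UNIV) (\<lambda>(t, x). v t x)
         \<subseteq> {(t, x). t \<in> lifespan_interval T \<and> norm x \<le> t + R}"
    then have "T \<le> ereal (C * \<epsilon> powr - inverse Fm)" by (intro le) blast+
    with fin[OF this] show "T < \<infinity> \<and> T \<le> ereal (C * \<epsilon> powr
        - inverse (max (lifespan_F CARD('n) p q) (lifespan_F CARD('n) q p)))"
      unfolding Fm_def by blast
  qed
qed

end
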